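(* Let $\mu\in\mathcal{P}_p(\mathbb{R}^N)$ be a successively $\mathcal{W}_p$-continuous martingale measure, i.e. $\int x_{t+1}\,\mu_{x_{1:t}}(dx_{t+1})=x_t$ $\mu$-a.s. for $t=1,\dots,N-1$. Let $K\subset\mathbb{R}$ be a (nonempty) compact set, $\delta>0$, and let $f:\mathbb{R}^N\times\mathbb{R}^N\to\mathbb{R}$ be a lower semicontinuous function that is bounded from below. Define, for $x_{1:t}\in\mathbb{R}^t$, $t=0,\dots,N-1$, $$\Pi^{\mathcal{M}}_\delta(\mu_{x_{1:t}},\cdot):=\Big\{\pi\in\Pi(\mu_{x_{1:t}},\cdot):\ \mathcal{C}_p(\pi)<\delta,\ \int(x-y)\,\pi(dx,dy)=0\Big\},$$ $$\Pi^{\mathcal{M}}_\delta(\mu,\cdot):=\big\{\gamma^1\otimes\gamma_{x_1,y_1}\otimes\dots\otimes\gamma_{x_{1:N-1},y_{1:N-1}}:\ \gamma_{x_{1:s-1},y_{1:s-1}}\in\Pi^{\mathcal{M}}_\delta(\mu_{x_{1:s-1}},\cdot),\ s=1,\dots,N\big\},$$ where $(x_{1:t},y_{1:t})\mapsto\gamma_{x_{1:t},y_{1:t}}$ are Borel measurable, and $\Pi^{\mathcal{M}}_{\mathrm{bc},\delta}(\mu,\cdot):=\{\gamma\in\Pi^{\mathcal{M}}_\delta(\mu,\cdot):\gamma\text{ is bicausal}\}$. Let $$V^{\mathcal{M}}(\delta):=\inf_{\alpha\in\mathcal{A}}\ \sup_{\gamma\in\Pi^{\mathcal{M}}_{\mathrm{bc},\delta}(\mu,\cdot)}\int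 f(y,\alpha(x,y))\,\gamma(dx,dy),$$ and define $V_N^{\mathcal{M},\delta}(x,y,\alpha):=f(y,\alpha)$ and, for $t=N-1,\dots,0$, $$V_t^{\mathcal{M},\delta}(x_{1:t},y_{1:t},\alpha_{1:t}):=\inf_{\alpha_{t+1}\in K}\ \sup_{\gamma^{t+1}\in\Pi^{\mathcal{M}}_\delta(\mu_{x_{1:t}},\cdot)}\int V_{t+1}^{\mathcal{M},\delta}(x_{1:t+1},y_{1:t+1},\alpha_{1:t+1})\,\gamma^{t+1}(dx_{t+1},dy_{t+1}).$$ Then $V^{\mathcal{M}}(\delta)=V_0^{\mathcal{M},\delta}$.
   Context: Fix $N\in\mathbb{N}$ and $p\in[1,\infty)$. $x_{s:t}=(x_s,\dots,x_t)$. $\mathcal{P}(\mathbb{R}^k)$ is the set of Borel probability measures, $\mathcal{P}_p(\mathbb{R}^k)$ those with finite $p$-th moment, and $\mathcal{W}_p$ is the $p$-Wasserstein distance. For $\mu\in\mathcal{P}_p(\mathbb{R}^N)$ write the disintegration $\mu=\mu^1\otimes\mu_{x_1}\otimes\dots\otimes\mu_{x_{1:N-1}}$, where $\mu^1$ is the first marginal, $\mu_{x_{1:t}}\in\mathcal{P}(\mathbb{R})$ is the conditional distribution of the $(t+1)$-st coordinate given that the first $t$ coordinates equal $x_{1:t}$, and $\mu_{x_{1:0}}:=\mu^1$. $\mu$ is successively $\mathcal{W}_p$-continuous if $\mathbb{R}^t\ni x_{1:t}\mapsto\mu_{x_{1:t}}$ is continuous with respect to $\mathcal{W}_p$ for each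 $t=1,\dots,N-1$ (this version of the kernels is used). For $\pi\in\mathcal{P}(\mathbb{R}^2)$ set $\mathcal{C}_p(\pi)=(\int|x-y|^p\,\pi(dx,dy))^{1/p}$. For $\eta\in\mathcal{P}(\mathbb{R})$, $\Pi(\eta,\cdot)$ is the set of $\pi\in\mathcal{P}(\mathbb{R}^2)$ with first marginal $\eta$ (second marginal arbitrary). For two measures, $\Pi(\mu,\nu)$ denotes the set of couplings. In $\gamma=\gamma^1\otimes\gamma_{x_1,y_1}\otimes\dots\otimes\gamma_{x_{1:N-1},y_{1:N-1}}$, a measure on $\mathbb{R}^N\times\mathbb{R}^N$, $\gamma^1=\gamma_{x_{1:0},y_{1:0}}$ is the law of $(x_1,y_1)$ and $\gamma_{x_{1:t},y_{1:t}}$ is the conditional law of $(x_{t+1},y_{t+1})$ given $(x_{1:t},y_{1:t})$. Such a $\gamma$ with marginals $\mu$ and $\nu$ is bicausal if $\gamma^1\in\Pi(\mu^1,\nu^1)$ and $\gamma_{x_{1:t},y_{1:t}}\in\Pi(\mu_{x_{1:t}},\nu_{y_{1:t}})$ for $\gamma$-a.e. $(x,y)$, $t=1,\dots,N-1$. $\mathcal{A}$ is the set of predictable controls: Borel measurable $\alpha=(\alpha_1,\dots,\alpha_N):\mathbb{R}^N\times\mathbb{R}^N\to K^N$ such that $\alpha_t(x,y)$ depends only on $(x_{1:t-1},y_{1:t-1})$. *)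

theory Defs
  imports "HOL-Probability.Probability"
begin

text \<open>
  A point x of R^t is an extensional function on the index set {1..t}. Hence R^0 consists of the
  single point \<open>\<lambda>_. undefined\<close>, the initial segment of x of length t is \<open>restrict x {1..t}\<close>, and
  appending a coordinate u to a point x of R^t is \<open>x(Suc t := u)\<close>.
\<close>

abbreviation R_borel :: "nat \<Rightarrow> (nat \<Rightarrow> real) measure" where
  "R_borel t \<equiv> PiM {1..t} (\<lambda>_. borel)"

abbreviation R_top :: "nat \<Rightarrow> (nat \<Rightarrow> real) topology" where
  "R_top t \<equiv> product_topology (\<lambda>_. euclidean) {1..t}"

abbreviation RR_borel :: "nat \<Rightarrow> ((nat \<Rightarrow> real) \<times> (nat \<Rightarrow> real)) measure" where
  "RR_borel t \<equiv> R_borel t \<Otimes>\<^sub>M R_borel t"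

abbreviation empty_path :: "nat \<Rightarrow> real" where
  "empty_path \<equiv> \<lambda>_. undefined"

definition lsc_on_top :: "'a topology \<Rightarrow> ('a \<Rightarrow> real) \<Rightarrow> bool" where
  "lsc_on_top T g \<longleftrightarrow> (\<forall>c. openin T {z \<in> topspace T. c < g z})"

text \<open>
  The integral of an extended real function as the difference of the integrals of its positive and
  negative parts (\<open>e2ennreal\<close> maps negative numbers to 0). It is only used for functions that are
  bounded below, integrated against probability measures, so that the negative part is finite and
  the value lies in (-\<infinity>, \<infinity>].
\<close>

definition ext_integral :: "'a measure \<Rightarrow> ('a \<Rightarrow> ereal) \<Rightarrow> ereal" where
  "ext_integral M g =
     enn2ereal (\<integral>\<^sup>+ z. e2ennreal (g z) \<partial>M) - enn2ereal (\<integral>\<^sup>+ z. e2ennreal (- g z) \<partial>M)"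

definition P_p :: "real \<Rightarrow> real measure set" where
  "P_p p = {\<eta> \<in> space (prob_algebra borel). integrable \<eta> (\<lambda>x. \<bar>x\<bar> powr p)}"

definition P_p_path :: "real \<Rightarrow> nat \<Rightarrow> (nat \<Rightarrow> real) measure set" where
  "P_p_path p N = {\<mu> \<in> space (prob_algebra (R_borel N)). integrable \<mu> (\<lambda>x. L2_set x {1..N} powr p)}"

definition couplings :: "real measure \<Rightarrow> real measure \<Rightarrow> (real \<times> real) measure set" where
  "couplings \<eta> \<theta> = {\<pi> \<in> space (prob_algebra borel). distr \<pi> borel fst = \<eta> \<and> distr \<pi> borel snd = \<theta>}"

definition couplings_fst :: "real measure \<Rightarrow> (real \<times> real) measure set" where
  "couplings_fst \<eta> = {\<pi> \<in> space (prob_algebra borel). distr \<pi> borel fst = \<eta>}"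

definition cost_p :: "real \<Rightarrow> (real \<times> real) measure \<Rightarrow> ennreal" where
  "cost_p p \<pi> =
     (let I = \<integral>\<^sup>+ (x, y). ennreal (\<bar>x - y\<bar> powr p) \<partial>\<pi>
      in if I = \<infinity> then \<infinity> else ennreal (enn2real I powr (1 / p)))"

definition wasserstein :: "real \<Rightarrow> real measure \<Rightarrow> real measure \<Rightarrow> ennreal" where
  "wasserstein p \<eta> \<theta> = (INF \<pi>\<in>couplings \<eta> \<theta>. cost_p p \<pi>)"

text \<open>
  \<open>path_law k t\<close> is the measure on R^t composed of the kernels \<open>k 0, ..., k (t - 1)\<close>, where
  \<open>k s x\<close> is the conditional law of the coordinate s + 1 given that the first s coordinates are x;
  in particular \<open>k 0 empty_path\<close> is the law of the first coordinate.
\<close>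

primrec path_law :: "(nat \<Rightarrow> (nat \<Rightarrow> real) \<Rightarrow> real measure) \<Rightarrow> nat \<Rightarrow> (nat \<Rightarrow> real) measure" where
  "path_law k 0 = return (R_borel 0) empty_path"
| "path_law k (Suc t) =
     path_law k t \<bind> (\<lambda>x. distr (k t x) (R_borel (Suc t)) (\<lambda>u. x(Suc t := u)))"

definition disintegration ::
  "nat \<Rightarrow> (nat \<Rightarrow> (nat \<Rightarrow> real) \<Rightarrow> real measure) \<Rightarrow> (nat \<Rightarrow> real) measure \<Rightarrow> bool" where
  "disintegration N k \<mu> \<longleftrightarrow>
     (\<forall>t<N. k t \<in> measurable (R_borel t) (prob_algebra borel)) \<and> \<mu> = path_law k N"

text \<open>The same for measures on R^t x R^t, with a pair of coordinates appended in each step.\<close>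

type_synonym pair_kernel = "nat \<Rightarrow> (nat \<Rightarrow> real) \<times> (nat \<Rightarrow> real) \<Rightarrow> (real \<times> real) measure"

primrec pair_path_law :: "pair_kernel \<Rightarrow> nat \<Rightarrow> ((nat \<Rightarrow> real) \<times> (nat \<Rightarrow> real)) measure" where
  "pair_path_law g 0 = return (RR_borel 0) (empty_path, empty_path)"
| "pair_path_law g (Suc t) =
     pair_path_law g t \<bind>
       (\<lambda>(x, y). distr (g t (x, y)) (RR_borel (Suc t)) (\<lambda>(u, v). (x(Suc t := u), y(Suc t := v))))"

definition pair_disintegration ::
  "nat \<Rightarrow> pair_kernel \<Rightarrow> ((nat \<Rightarrow> real) \<times> (nat \<Rightarrow> real)) measure \<Rightarrow> bool" where
  "pair_disintegration N g \<gamma> \<longleftrightarrow>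
     (\<forall>t<N. g t \<in> measurable (RR_borel t) (prob_algebra borel)) \<and> \<gamma> = pair_path_law g N"

text \<open>
  Continuity of the kernels \<open>k 1, ..., k (N - 1)\<close> as maps into the p-th moment measures with the
  p-Wasserstein distance, at every point (not only almost everywhere).
\<close>

definition successively_W_continuous ::
  "real \<Rightarrow> nat \<Rightarrow> (nat \<Rightarrow> (nat \<Rightarrow> real) \<Rightarrow> real measure) \<Rightarrow> bool" where
  "successively_W_continuous p N k \<longleftrightarrow>
     (\<forall>t\<in>{1..<N}. \<forall>x\<in>topspace (R_top t).
        k t x \<in> P_p p \<and>
        (\<forall>\<epsilon>>0. \<exists>U. openin (R_top t) U \<and> x \<in> U \<and>
                 (\<forall>x'\<in>U. wasserstein p (k t x') (k t x) < ennreal \<epsilon>)))"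

definition martingale_measure ::
  "nat \<Rightarrow> (nat \<Rightarrow> (nat \<Rightarrow> real) \<Rightarrow> real measure) \<Rightarrow> (nat \<Rightarrow> real) measure \<Rightarrow> bool" where
  "martingale_measure N k \<mu> \<longleftrightarrow>
     (\<forall>t\<in>{1..<N}. AE x in \<mu>. (\<integral>z. z \<partial>k t (restrict x {1..t})) = x t)"

text \<open>
  The kernels of a measure are unique up to null sets, so the property below does not depend on
  which disintegrations g of \<open>\<gamma>\<close> and m, n of its two marginals are chosen. For t = 0 the initial
  segments are \<open>empty_path\<close>, and the condition says that the law of the first pair of coordinates
  couples the first marginals.
\<close>

definition bicausal :: "nat \<Rightarrow> ((nat \<Rightarrow> real) \<times> (nat \<Rightarrow> real)) measure \<Rightarrow> bool" where
  "bicausal N \<gamma> \<longleftrightarrow>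
     (\<exists>g m n. pair_disintegration N g \<gamma> \<and>
        disintegration N m (distr \<gamma> (R_borel N) fst) \<and>
        disintegration N n (distr \<gamma> (R_borel N) snd) \<and>
        (\<forall>t<N. AE (x, y) in \<gamma>.
           g t (restrict x {1..t}, restrict y {1..t})
             \<in> couplings (m t (restrict x {1..t})) (n t (restrict y {1..t}))))"

definition Pi_M :: "real \<Rightarrow> real \<Rightarrow> real measure \<Rightarrow> (real \<times> real) measure set" where
  "Pi_M p \<delta> \<eta> = {\<pi> \<in> couplings_fst \<eta>. cost_p p \<pi> < ennreal \<delta> \<and> (\<integral>(x, y). x - y \<partial>\<pi>) = 0}"

definition Pi_M_path ::
  "real \<Rightarrow> nat \<Rightarrow> real \<Rightarrow> (nat \<Rightarrow> (nat \<Rightarrow> real) \<Rightarrow> real measure)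
     \<Rightarrow> ((nat \<Rightarrow> real) \<times> (nat \<Rightarrow> real)) measure set" where
  "Pi_M_path p N \<delta> k =
     {\<gamma>. \<exists>g. pair_disintegration N g \<gamma> \<and>
        (\<forall>t<N. \<forall>(x, y)\<in>space (RR_borel t). g t (x, y) \<in> Pi_M p \<delta> (k t x))}"

definition Pi_M_bc ::
  "real \<Rightarrow> nat \<Rightarrow> real \<Rightarrow> (nat \<Rightarrow> (nat \<Rightarrow> real) \<Rightarrow> real measure)
     \<Rightarrow> ((nat \<Rightarrow> real) \<times> (nat \<Rightarrow> real)) measure set" where
  "Pi_M_bc p N \<delta> k = {\<gamma> \<in> Pi_M_path p N \<delta> k. bicausal N \<gamma>}"

definition controls ::
  "nat \<Rightarrow> real set \<Rightarrow> ((nat \<Rightarrow> real) \<times> (nat \<Rightarrow> real) \<Rightarrow> nat \<Rightarrow> real) set" where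
  "controls N K =
     {\<alpha> \<in> measurable (RR_borel N) (R_borel N).
        (\<forall>z\<in>space (RR_borel N). \<alpha> z \<in> {1..N} \<rightarrow>\<^sub>E K) \<and>
        (\<forall>t\<in>{1..N}. \<forall>(x, y)\<in>space (RR_borel N). \<forall>(x', y')\<in>space (RR_borel N).
           restrict x {1..t - 1} = restrict x' {1..t - 1} \<and>
           restrict y {1..t - 1} = restrict y' {1..t - 1} \<longrightarrow> \<alpha> (x, y) t = \<alpha> (x', y') t)}"

definition value_M ::
  "real \<Rightarrow> nat \<Rightarrow> (nat \<Rightarrow> (nat \<Rightarrow> real) \<Rightarrow> real measure) \<Rightarrow> real set
     \<Rightarrow> ((nat \<Rightarrow> real) \<times> (nat \<Rightarrow> real) \<Rightarrow> real) \<Rightarrow> real \<Rightarrow> ereal" where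
  "value_M p N k K f \<delta> =
     (INF \<alpha>\<in>controls N K. SUP \<gamma>\<in>Pi_M_bc p N \<delta> k.
        ext_integral \<gamma> (\<lambda>(x, y). ereal (f (y, \<alpha> (x, y)))))"

function dyn_value_M ::
  "real \<Rightarrow> nat \<Rightarrow> (nat \<Rightarrow> (nat \<Rightarrow> real) \<Rightarrow> real measure) \<Rightarrow> real set
     \<Rightarrow> ((nat \<Rightarrow> real) \<times> (nat \<Rightarrow> real) \<Rightarrow> real) \<Rightarrow> real
     \<Rightarrow> nat \<Rightarrow> (nat \<Rightarrow> real) \<Rightarrow> (nat \<Rightarrow> real) \<Rightarrow> (nat \<Rightarrow> real) \<Rightarrow> ereal" where
  "dyn_value_M p N k K f \<delta> t x y a =
     (if t < N then
        (INF b\<in>K. SUP \<pi>\<in>Pi_M p \<delta> (k t x).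
           ext_integral \<pi> (\<lambda>(u, v).
             dyn_value_M p N k K f \<delta> (Suc t) (x(Suc t := u)) (y(Suc t := v)) (a(Suc t := b))))
      else ereal (f (y, a)))"
  by pat_completeness auto
termination
  by (relation "Wellfounded.measure (\<lambda>(p, N, k, K, f, \<delta>, t, x, y, a). N - t)") auto

declare dyn_value_M.simps [simp del]

end

theory Submission
  imports Defs
begin

text \<open>
  Let V be the value of the control problem and \<open>V_t\<close> the functions of the dynamic programme.
  The inequality \<open>V \<le> V_0\<close> comes from an optimal feedback control, the inequality \<open>V \<ge> V_0\<close> from the
  adversary choosing nearly optimal kernels one after the other. Both rest on one parametrisation of
  the one-step couplings.

  Let q be the quantile function of a law \<open>\<eta>\<close> on the reals. A coupling in \<open>Pi_M p \<delta> \<eta>\<close> is the law of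
  \<open>(q u, q u - d)\<close>, where the pair (u, d) has u uniform on (0, 1), d centred and of p-norm less than
  \<open>\<delta>\<close> (\<open>Pi_M_eq_seeds\<close>, which uses the distributional transform). Such laws of (u, d) are called seeds
  below. The set of seeds does not depend on \<open>\<eta>\<close>: cost and mean of a coupling only involve x - y = d.
  So the sets over which the adversary maximises at different histories are images of one
  set. If the kernels are continuous for the Wasserstein distance, their quantile functions converge
  almost everywhere along convergent histories, and for a fixed seed Fatou's lemma makes the integral
  of a lower semicontinuous function over the corresponding coupling lower semicontinuous in the
  history. Suprema over seeds and infima over the compact set K preserve lower semicontinuity, hence
  all functions \<open>V_t\<close> are lower semicontinuous (\<open>lsc_V\<close>).

  For the upper bound, a lower semicontinuous function of (z, b) has a Borel minimiser in b
  (\<open>lsc_measurable_argmin\<close>). Under the feedback control made of these minimisers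
  the integral of \<open>V_t\<close> over the first t steps does not increase with t, whatever kernels the
  adversary uses (\<open>upper_bound\<close>).

  For the lower bound fix a control and c < \<open>V_0\<close>. By the Lindelof property countably many
  seeds suffice for the supremum in every history, so the adversary can select a nearly optimal seed
  measurably (\<open>measurable_SUP_selection\<close>). Kernels are added from the first step on while keeping the
  integral of \<open>V_t\<close> above c, so infinite values cause no trouble. It remains to make
  the resulting measure bicausal. To this end y is rounded to a fine grid, the coordinate x is
  written into the digits below the grid, and the result is recentred. The change tends to 0 with the mesh of the
  grid, hence the strict bound on the cost survives and by lower semicontinuity almost nothing of the
  integral is lost (\<open>encoded_family\<close>). Afterwards the y-path determines the x-path, so that
  conditioning on the y-path is the same as conditioning on both (\<open>bicausal_if_decodable\<close>).
\<close>

section \<open>Quantile functions and the distributional transform\<close>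

definition unif :: "real measure" where
  "unif = uniform_measure lborel {0<..<1}"

definition quantile :: "real measure \<Rightarrow> real \<Rightarrow> real" where
  "quantile M u = (if 0 < u \<and> u < 1 then Inf {y. u \<le> cdf M y} else 0)"

lemma sets_unif [simp, measurable_cong]: "sets unif = sets borel"
  by (simp add: unif_def)

lemma space_unif [simp]: "space unif = UNIV"
  by (simp add: unif_def)

lemma emeasure_unif: "A \<in> sets borel \<Longrightarrow> emeasure unif A = emeasure lborel ({0<..<1} \<inter> A)"
  by (simp add: unif_def divide_ennreal_def)

lemma prob_space_unif: "prob_space unif"
  unfolding unif_def by (rule prob_space_uniform_measure) simp_all

interpretation unif: prob_space unif by (rule prob_space_unif)

lemma AE_unif: "AE u in unif. 0 < u \<and> u < 1"
  unfolding unif_def by (rule AE_uniform_measureI) auto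

lemma measure_unif: "A \<in> sets borel \<Longrightarrow> measure unif A = measure lborel ({0<..<1} \<inter> A)"
  by (simp add: measure_def emeasure_unif)

lemma cdf_unif: assumes "0 \<le> s" "s \<le> 1" shows "measure unif {..s} = s" "measure unif {..<s} = s"
proof -
  have "measure unif {..<s} = measure lborel {0<..<s}"
  proof -
    have "{0<..<1} \<inter> {..<s} = {0<..<s}" using assms by auto
    then show ?thesis by (simp only: measure_unif borel_open open_lessThan)
  qed
  then show "measure unif {..<s} = s" using assms by simp
  show "measure unif {..s} = s"
  proof (cases "s < 1")
    case True
    have "measure unif {..s} = measure lborel {0<..s}"
    proof -
      have "{0<..<1} \<inter> {..s} = {0<..s}" using assms True by auto
      then show ?thesis by (simp only: measure_unif borel_closed closed_atMost)
    qed
    then show ?thesis using assms by simp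
  next
    case False
    then have "measure unif {..s} = measure lborel {0<..<1::real}"
    proof -
      have "{0<..<1} \<inter> {..s} = {0<..<1}" using assms False by auto
      then show ?thesis by (simp only: measure_unif borel_closed closed_atMost)
    qed
    then show ?thesis using assms False by simp
  qed
qed

lemma quantile_le_iff:
  assumes "real_distribution M" "0 < u" "u < 1"
  shows "quantile M u \<le> y \<longleftrightarrow> u \<le> cdf M y"
proof -
  interpret cdf_distribution M using assms(1) by (simp add: cdf_distribution_def)
  show ?thesis using pseudoinverse[of u y] assms by (simp add: quantile_def)
qed

lemma measurable_quantile:
  assumes [measurable]: "k \<in> measurable X (prob_algebra borel)"
  shows "(\<lambda>z. quantile (k (fst z)) (snd z)) \<in> borel_measurable (X \<Otimes>\<^sub>M borel)"
proof (rule borel_measurableI_le)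
  fix y
  have real: "real_distribution (k x)" if "x \<in> space X" for x
    using measurable_space[OF assms that] sets_eq_imp_space_eq[of "k x" borel]
    by (auto simp: space_prob_algebra real_distribution_def real_distribution_axioms_def)
  have [measurable]: "(\<lambda>x. cdf (k x) y) \<in> borel_measurable X"
    unfolding cdf_def by measurable
  have "{z \<in> space (X \<Otimes>\<^sub>M borel). quantile (k (fst z)) (snd z) \<le> y}
     = {z \<in> space (X \<Otimes>\<^sub>M borel). if 0 < snd z \<and> snd z < 1 then snd z \<le> cdf (k (fst z)) y else 0 \<le> y}"
  proof -
    have "quantile (k x) u \<le> y \<longleftrightarrow> (if 0 < u \<and> u < 1 then u \<le> cdf (k x) y else 0 \<le> y)"
      if "x \<in> space X" for x u
      using quantile_le_iff[OF real[OF that]] by (auto simp: quantile_def)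
    then show ?thesis by (auto simp: space_pair_measure)
  qed
  also have "\<dots> \<in> sets (X \<Otimes>\<^sub>M borel)" by measurable
  finally show "{z \<in> space (X \<Otimes>\<^sub>M borel). quantile (k (fst z)) (snd z) \<le> y} \<in> sets (X \<Otimes>\<^sub>M borel)" .
qed

lemma measurable_quantile_single:
  assumes "real_distribution M"
  shows "quantile M \<in> borel_measurable borel"
proof -
  interpret real_distribution M by fact
  have "(\<lambda>_. M) \<in> measurable (count_space {()}) (prob_algebra borel)"
    by (auto simp: space_prob_algebra prob_space_axioms)
  from measurable_quantile[OF this]
  have "(\<lambda>z. quantile M (snd z)) \<in> borel_measurable (count_space {()} \<Otimes>\<^sub>M borel)" .
  from measurable_compose[OF measurable_Pair1'[of "()"] this] show ?thesis by simp
qed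

lemma distr_quantile:
  assumes "real_distribution M"
  shows "distr unif borel (quantile M) = M"
proof -
  interpret cdf_distribution M using assms(1) by (simp add: cdf_distribution_def)
  note [measurable] = measurable_quantile_single[OF assms]
  show ?thesis
  proof (rule cdf_unique)
    show "real_distribution (distr unif borel (quantile M))"
      by (intro unif.real_distribution_distr) simp
    show "real_distribution M" by fact
    show "cdf (distr unif borel (quantile M)) = cdf M"
    proof
      fix y
      have "cdf (distr unif borel (quantile M)) y = measure unif {u. quantile M u \<le> y}"
        by (simp add: cdf_def measure_distr vimage_def)
      also have "\<dots> = measure unif {u. u \<le> cdf M y}"
        by (rule measure_eq_AE) (rule AE_mp[OF AE_unif], auto simp: quantile_le_iff[OF assms])
      also have "\<dots> = cdf M y"
        using cdf_unif(1)[of "cdf M y"] cdf_nonneg[of y] cdf_bounded_prob[of y] by (simp add: atMost_def)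
      finally show "cdf (distr unif borel (quantile M)) y = cdf M y" .
    qed
  qed
qed

text \<open>
  A bounded strictly increasing function, here the arctangent, turns the claim into the vanishing of the integral of a nonnegative function.
\<close>

lemma (in prob_space) AE_eq_if_le_same_law:
  fixes A B :: "'a \<Rightarrow> real"
  assumes [measurable]: "A \<in> borel_measurable M" "B \<in> borel_measurable M"
    and le: "AE \<omega> in M. A \<omega> \<le> B \<omega>" and eq: "distr M borel A = distr M borel B"
  shows "AE \<omega> in M. A \<omega> = B \<omega>"
proof -
  have bd: "norm (arctan t) \<le> pi / 2" for t :: real
    using arctan_lbound[of t] arctan_ubound[of t] by (simp add: abs_le_iff)
  have m[measurable]: "arctan \<in> borel_measurable borel"
    by (intro borel_measurable_continuous_onI continuous_on_arctan continuous_on_id)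
  have i[simp]: "integrable M (\<lambda>\<omega>. arctan (A \<omega>))" "integrable M (\<lambda>\<omega>. arctan (B \<omega>))"
    by (rule integrable_const_bound[where B="pi/2"], use bd in auto)+
  have "(\<integral>\<omega>. arctan (A \<omega>) \<partial>M) = (\<integral>t. arctan t \<partial>distr M borel A)" by (simp add: integral_distr)
  also have "\<dots> = (\<integral>\<omega>. arctan (B \<omega>) \<partial>M)" by (simp add: eq integral_distr)
  finally have "(\<integral>\<omega>. arctan (B \<omega>) - arctan (A \<omega>) \<partial>M) = 0" by simp
  then have "AE \<omega> in M. arctan (B \<omega>) - arctan (A \<omega>) = 0"
    by (subst (asm) integral_nonneg_eq_0_iff_AE) (use le in \<open>auto simp: arctan_le_iff elim!: eventually_mono\<close>)
  then show ?thesis by (auto simp: arctan_eq_iff elim!: eventually_mono)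
qed

text \<open>
  With an independent uniform u', the variable U = P(X < x) + u' P(X = x), evaluated at x = X, is uniform, and
  the quantile function maps it back to X: the randomisation spreads the atoms of X over
  the jumps of its distribution function. Applied to the first coordinate x of \<open>\<pi>\<close>, the pair
  (U, x - y) has the required law. The identity q(U) = X follows from \<open>q(U) \<le> X\<close> and equality of laws.
\<close>

lemma distributional_transform:
  fixes \<pi> :: "(real \<times> real) measure"
  assumes \<pi>: "\<pi> \<in> space (prob_algebra borel)"
  defines "M \<equiv> distr \<pi> borel fst"
  shows "\<exists>\<theta>\<in>space (prob_algebra borel). distr \<theta> borel fst = unif \<and>
     distr \<theta> borel (\<lambda>(u, d). (quantile M u, quantile M u - d)) = \<pi>"
proof -
  have [measurable_cong]: "sets \<pi> = sets borel" and "prob_space \<pi>"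
    using \<pi> by (auto simp: space_prob_algebra)
  then interpret \<pi>: prob_space \<pi> by simp
  have [simp]: "space \<pi> = UNIV" using sets_eq_imp_space_eq[OF \<open>sets \<pi> = sets borel\<close>] by simp
  have [measurable]: "fst \<in> measurable \<pi> borel" "snd \<in> measurable \<pi> borel"
    by (simp_all add: measurable_cong_sets[OF \<open>sets \<pi> = sets borel\<close> refl] borel_prod[symmetric])
  have M: "real_distribution M"
    unfolding M_def by (intro \<pi>.real_distribution_distr) simp
  interpret M: real_distribution M by (rule M)
  note [measurable] = measurable_quantile_single[OF M]
  have meas_M: "measure \<pi> {z. P (fst z)} = measure M {x. P x}" if "Measurable.pred borel P" for P
    using that by (simp add: M_def measure_distr vimage_def)
  define P where "P = \<pi> \<Otimes>\<^sub>M unif"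
  interpret pair_prob_space \<pi> unif ..
  interpret PP: prob_space P unfolding P_def by (rule P.prob_space_axioms)
  define L where "L x = measure M {..<x}" for x
  define J where "J x = measure M {x}" for x
  have Lm: "L x \<le> L y" if "x \<le> y" for x y
    unfolding L_def by (rule M.finite_measure_mono) (use that in auto)
  have LJ: "cdf M x = L x + J x" for x
  proof -
    have "{..x} = {..<x} \<union> {x}" by auto
    then show ?thesis unfolding cdf_def L_def J_def by (simp only:) (rule M.finite_measure_Union; simp)
  qed
  have LF: "cdf M x \<le> L y" if "x < y" for x y
    unfolding L_def cdf_def by (rule M.finite_measure_mono) (use that in auto)
  have J0: "0 \<le> J x" "0 \<le> L x" for x by (auto simp: J_def L_def)
  have [measurable]: "L \<in> borel_measurable borel"
    by (intro borel_measurable_mono monoI Lm)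
  have "J = (\<lambda>x. cdf M x - L x)" by (auto simp: LJ)
  moreover have "cdf M \<in> borel_measurable borel"
    by (intro borel_measurable_mono monoI M.cdf_nondecreasing)
  ultimately have [measurable]: "J \<in> borel_measurable borel" by simp
  define U where "U z = L (fst (fst z)) + snd z * J (fst (fst z))" for z :: "(real \<times> real) \<times> real"
  have [measurable]: "U \<in> borel_measurable P" unfolding U_def P_def by measurable
  have [simp]: "space P = UNIV" by (simp add: P_def space_pair_measure)
  have [simp]: "UNIV \<in> sets P" using sets.top[of P] by simp
  have sP: "{z. S z} \<in> sets P" if "Measurable.pred (\<pi> \<Otimes>\<^sub>M unif) S" for S
    using predE[OF that[folded P_def]] by simp
  have AEu: "AE z in P. 0 < snd z \<and> snd z < 1"
    unfolding P_def
  proof (rule AE_pair_measure)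
    show "{x \<in> space (\<pi> \<Otimes>\<^sub>M unif). 0 < snd x \<and> snd x < 1} \<in> sets (\<pi> \<Otimes>\<^sub>M unif)"
      by measurable
    show "AE x in \<pi>. AE y in unif. 0 < snd (x, y) \<and> snd (x, y) < 1"
      unfolding snd_conv by (rule AE_I2, rule AE_unif)
  qed
  have rect: "measure P {z. Q (fst (fst z)) \<and> R (snd z)} = measure M {x. Q x} * measure unif {u. R u}"
    if [measurable]: "Measurable.pred borel Q" "Measurable.pred borel R" for Q R
  proof -
    have "{z. Q (fst (fst z)) \<and> R (snd z)} = {z :: real \<times> real. Q (fst z)} \<times> {u. R u}" by auto
    moreover have "{z :: real \<times> real. Q (fst z)} \<in> sets \<pi>"
      using measurable_sets[of "\<lambda>z. Q (fst z)" \<pi> "count_space UNIV" "{True}"] by (simp add: vimage_def)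
    moreover have "{u. R u} \<in> sets unif"
      using measurable_sets[of R borel "count_space UNIV" "{True}"] by (simp add: vimage_def)
    ultimately have "measure P {z. Q (fst (fst z)) \<and> R (snd z)} = measure \<pi> {z. Q (fst z)} * measure unif {u. R u}"
      unfolding P_def measure_def
      by (simp only: unif.emeasure_pair_measure_Times enn2real_mult)
    then show ?thesis by (simp add: meas_M)
  qed
  have split: "measure P ({z. fst (fst z) < q} \<union> {z. fst (fst z) = q \<and> R (snd z)}) = L q + J q * measure unif {u. R u}"
    if [measurable]: "Measurable.pred borel R" for q R
  proof -
    have "measure P ({z. fst (fst z) < q} \<union> {z. fst (fst z) = q \<and> R (snd z)})
       = measure P {z. fst (fst z) < q} + measure P {z. fst (fst z) = q \<and> R (snd z)}"
      by (rule PP.finite_measure_Union; (rule sP, measurable)?) auto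
    moreover have "measure P {z. fst (fst z) < q} = L q"
      using rect[of "\<lambda>x. x < q" "\<lambda>_. True"] unif.prob_space by (simp add: L_def lessThan_def)
    moreover have "measure P {z. fst (fst z) = q \<and> R (snd z)} = J q * measure unif {u. R u}"
      using rect[of "\<lambda>x. x = q" R] by (simp add: J_def)
    ultimately show ?thesis by simp
  qed
  \<comment> \<open>With q the s-quantile, U lies below s if X < q and at or above s if X > q, which leaves the atom at q.\<close>
  have U_le: "measure P {z. U z < s} \<le> s" and U_ge: "s \<le> measure P {z. U z \<le> s}" if s: "0 < s" "s < 1" for s
  proof -
    define q where "q = quantile M s"
    have q1: "s \<le> cdf M q" using quantile_le_iff[OF M s, of q] by (simp add: q_def)
    have q2: "cdf M y < s" if "y < q" for y using quantile_le_iff[OF M s, of y] that by (simp add: q_def)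
    have q3: "L q \<le> s"
    proof (rule tendsto_upperbound)
      show "(cdf M \<longlongrightarrow> L q) (at_left q)" unfolding L_def by (rule M.cdf_at_left)
      show "\<forall>\<^sub>F y in at_left q. cdf M y \<le> s"
        using q2 by (auto simp: eventually_at_filter intro!: always_eventually less_imp_le)
    qed simp
    have r: "J q * measure unif {u. u * J q < s - L q} \<le> s - L q"
      "s - L q \<le> J q * measure unif {u. u * J q \<le> s - L q}"
    proof -
      show "J q * measure unif {u. u * J q < s - L q} \<le> s - L q"
      proof (cases "J q = 0")
        case False
        then have "0 < J q" using J0(1)[of q] by linarith
        then have "measure unif {u. u * J q < s - L q} = (s - L q) / J q"
          using cdf_unif(2)[of "(s - L q) / J q"] q3 q1 LJ[of q]
          by (simp add: pos_less_divide_eq lessThan_def divide_le_eq)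
        with \<open>0 < J q\<close> show ?thesis by simp
      qed (use q3 in simp)
      show "s - L q \<le> J q * measure unif {u. u * J q \<le> s - L q}"
      proof (cases "J q = 0")
        case False
        then have "0 < J q" using J0(1)[of q] by linarith
        then have "measure unif {u. u * J q \<le> s - L q} = (s - L q) / J q"
          using cdf_unif(1)[of "(s - L q) / J q"] q3 q1 LJ[of q]
          by (simp add: pos_le_divide_eq atMost_def divide_le_eq)
        with \<open>0 < J q\<close> show ?thesis by simp
      qed (use q1 LJ[of q] in simp)
    qed
    have "measure P {z. U z < s} \<le> measure P ({z. fst (fst z) < q} \<union> {z. fst (fst z) = q \<and> snd z * J q < s - L q})"
    proof (rule PP.finite_measure_mono_AE)
      show "AE z in P. z \<in> {z. U z < s} \<longrightarrow> z \<in> {z. fst (fst z) < q} \<union> {z. fst (fst z) = q \<and> snd z * J q < s - L q}"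
        using AEu
      proof eventually_elim
        case (elim z)
        have "s \<le> U z" if "q < fst (fst z)"
          using LF[OF that] q1 J0 elim by (auto simp: U_def intro: add_increasing2)
        then show ?case by (auto simp: U_def not_less_iff_gr_or_eq)
      qed
    qed (intro sets.Un sP; measurable)
    also have "\<dots> \<le> s" using r(1) by (subst split) auto
    finally show "measure P {z. U z < s} \<le> s" .
    have "s \<le> measure P ({z. fst (fst z) < q} \<union> {z. fst (fst z) = q \<and> snd z * J q \<le> s - L q})"
      using r(2) by (subst split) auto
    also have "\<dots> \<le> measure P {z. U z \<le> s}"
    proof (rule PP.finite_measure_mono_AE)
      show "AE z in P. z \<in> {z. fst (fst z) < q} \<union> {z. fst (fst z) = q \<and> snd z * J q \<le> s - L q} \<longrightarrow> z \<in> {z. U z \<le> s}"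
        using AEu
      proof eventually_elim
        case (elim z)
        have "U z \<le> cdf M (fst (fst z))"
          unfolding LJ U_def using mult_right_mono[of "snd z" 1 "J (fst (fst z))"] J0 elim by auto
        then have "U z \<le> s" if "fst (fst z) < q" using q2[OF that] by linarith
        then show ?case by (auto simp: U_def)
      qed
    qed (rule sP, unfold P_def[symmetric], measurable)
    finally show "s \<le> measure P {z. U z \<le> s}" .
  qed
  \<comment> \<open>The strict and the weak inequality are squeezed together by moving s.\<close>
  have U_le': "measure P {z. U z \<le> s} \<le> s" if s: "0 < s" "s < 1" for s
  proof (rule dense_ge_bounded)
    show "s < 1" by fact
    fix s' assume "s < s'" "s' < 1"
    have "measure P {z. U z \<le> s} \<le> measure P {z. U z < s'}"
      by (rule PP.finite_measure_mono) (use \<open>s < s'\<close> in auto, rule sP, unfold P_def[symmetric], measurable)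
    also have "\<dots> \<le> s'" using U_le[of s'] \<open>s < s'\<close> \<open>s' < 1\<close> s by simp
    finally show "measure P {z. U z \<le> s} \<le> s'" .
  qed
  have U01: "AE z in P. 0 \<le> U z \<and> U z \<le> 1"
    using AEu
  proof eventually_elim
    case (elim z)
    have "U z \<le> cdf M (fst (fst z))"
      unfolding LJ U_def using mult_right_mono[of "snd z" 1 "J (fst (fst z))"] J0 elim by auto
    then show ?case using elim J0 M.cdf_bounded_prob[of "fst (fst z)"] by (auto simp: U_def intro: order_trans)
  qed
  have dU: "distr P borel U = unif"
  proof (rule cdf_unique)
    show "real_distribution (distr P borel U)"
      by (intro PP.real_distribution_distr) simp
    show "real_distribution unif"
      by (simp add: real_distribution_def real_distribution_axioms_def prob_space_unif)
    have eq: "cdf (distr P borel U) s = cdf unif s" if ne: "s \<noteq> 0" "s \<noteq> 1" for s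
    proof -
      have [measurable]: "{z. U z \<le> s} \<in> sets P"
        by (rule sP, unfold P_def[symmetric], measurable)
      have c: "cdf (distr P borel U) s = measure P {z. U z \<le> s}"
        by (simp add: cdf_def measure_distr vimage_def)
      consider "s < 0" | "0 < s" "s < 1" | "1 < s" using ne by linarith
      then show ?thesis
      proof cases
        case 1
        have "measure P {z. U z \<le> s} = measure P {}" by (rule measure_eq_AE, rule AE_mp[OF U01]) (use 1 in auto)
        moreover have "measure unif {..s} = measure unif {}" by (rule measure_eq_AE, rule AE_mp[OF AE_unif]) (use 1 in auto)
        ultimately show ?thesis by (subst c) (simp add: cdf_def)
      next
        case 2
        then show ?thesis using U_le'[of s] U_ge[of s] cdf_unif[of s] by (subst c) (simp add: cdf_def)
      next
        case 3
        have "measure P {z. U z \<le> s} = measure P (space P)" by (rule measure_eq_AE, rule AE_mp[OF U01]) (use 3 in auto)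
        moreover have "measure unif {..s} = measure unif (space unif)" by (rule measure_eq_AE, rule AE_mp[OF AE_unif]) (use 3 in auto)
        ultimately show ?thesis by (subst c) (simp only: cdf_def PP.prob_space unif.prob_space)
      qed
    qed
    show "cdf (distr P borel U) = cdf unif"
    proof
      fix s
      interpret D: real_distribution "distr P borel U" by fact
      interpret E: real_distribution unif by fact
      have ev: "\<forall>\<^sub>F y in at_right s. cdf (distr P borel U) y = cdf unif y"
      proof -
        have "\<forall>\<^sub>F y in at_right s. y \<noteq> 0" "\<forall>\<^sub>F y in at_right s. y \<noteq> 1"
          by (rule eventually_neq_at_within)+
        then show ?thesis by eventually_elim (rule eq)
      qed
      have "(cdf (distr P borel U) \<longlongrightarrow> cdf unif s) (at_right s)"
        using E.cdf_is_right_cont[of s] by (simp add: continuous_within tendsto_cong[OF ev])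
      moreover have "(cdf (distr P borel U) \<longlongrightarrow> cdf (distr P borel U) s) (at_right s)"
        using D.cdf_is_right_cont[of s] by (simp add: continuous_within)
      ultimately show "cdf (distr P borel U) s = cdf unif s"
        by (intro tendsto_unique[OF trivial_limit_at_right_real])
    qed
  qed
  have U01': "AE z in P. 0 < U z \<and> U z < 1"
    using AE_unif unfolding dU[symmetric] by (subst (asm) AE_distr_iff) auto
  have X: "AE z in P. quantile M (U z) = fst (fst z)"
  proof (rule PP.AE_eq_if_le_same_law)
    show "(\<lambda>z. quantile M (U z)) \<in> borel_measurable P" by measurable
    show m: "(\<lambda>z. fst (fst z)) \<in> borel_measurable P" unfolding P_def by measurable
    show "AE z in P. quantile M (U z) \<le> fst (fst z)"
      using AEu U01'
    proof eventually_elim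
      case (elim z)
      have "U z \<le> cdf M (fst (fst z))"
        unfolding LJ U_def using mult_right_mono[of "snd z" 1 "J (fst (fst z))"] J0 elim by auto
      then show ?case using elim by (simp add: quantile_le_iff[OF M])
    qed
    have "distr P borel (\<lambda>z. quantile M (U z)) = distr (distr P borel U) borel (quantile M)"
      by (subst distr_distr) (auto simp: comp_def)
    also have "\<dots> = M" unfolding dU by (rule distr_quantile[OF M])
    also have "M = distr (distr P \<pi> fst) borel fst"
      unfolding P_def M_def by (simp add: unif.distr_pair_fst)
    also have "\<dots> = distr P borel (\<lambda>z. fst (fst z))"
      by (subst distr_distr) (auto simp: P_def comp_def)
    finally show "distr P borel (\<lambda>z. quantile M (U z)) = distr P borel (\<lambda>z. fst (fst z))" .
  qed
  define T where "T z = (U z, fst (fst z) - snd (fst z))" for z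
  have [measurable]: "(\<lambda>z. fst (fst z)) \<in> borel_measurable P" "(\<lambda>z. snd (fst z)) \<in> borel_measurable P"
    unfolding P_def by measurable
  have [measurable]: "T \<in> measurable P borel" unfolding T_def borel_prod[symmetric]
    by measurable
  have [measurable]: "(\<lambda>(u, d). (quantile M u, quantile M u - d)) \<in> measurable borel borel"
    unfolding borel_prod[symmetric] by measurable
  show ?thesis
  proof (intro bexI conjI)
    show "distr P borel T \<in> space (prob_algebra borel)"
      by (simp add: space_prob_algebra PP.prob_space_distr)
    have "distr (distr P borel T) borel fst = distr P borel U"
      by (subst distr_distr) (auto simp: T_def comp_def intro!: borel_measurable_continuous_onI continuous_on_fst continuous_on_id)
    then show "distr (distr P borel T) borel fst = unif" by (simp add: dU)
    have "distr (distr P borel T) borel (\<lambda>(u, d). (quantile M u, quantile M u - d))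
        = distr P borel (\<lambda>z. (quantile M (U z), quantile M (U z) - (fst (fst z) - snd (fst z))))"
      by (subst distr_distr) (auto simp: T_def comp_def)
    also have "\<dots> = distr P \<pi> fst"
    proof (rule distr_cong_AE)
      show "AE x in P. (quantile M (U x), quantile M (U x) - (fst (fst x) - snd (fst x))) = fst x"
        using X by eventually_elim simp
      show "(\<lambda>z. (quantile M (U z), quantile M (U z) - (fst (fst z) - snd (fst z)))) \<in> measurable P borel"
        unfolding borel_prod[symmetric] by measurable
      show "fst \<in> P \<rightarrow>\<^sub>M \<pi>" unfolding P_def by measurable
    qed (simp_all add: \<open>sets \<pi> = sets borel\<close>)
    also have "\<dots> = \<pi>" unfolding P_def by (simp add: unif.distr_pair_fst)
    finally show "distr (distr P borel T) borel (\<lambda>(u, d). (quantile M u, quantile M u - d)) = \<pi>" .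
  qed
qed

section \<open>Quantiles and the Wasserstein distance\<close>

lemma cost_p_less_iff:
  assumes "1 \<le> p" "0 < c"
  shows "cost_p p \<pi> < ennreal c \<longleftrightarrow> (\<integral>\<^sup>+ z. ennreal (\<bar>fst z - snd z\<bar> powr p) \<partial>\<pi>) < ennreal (c powr p)"
proof -
  define I where "I = (\<integral>\<^sup>+ z. ennreal (\<bar>fst z - snd z\<bar> powr p) \<partial>\<pi>)"
  have I: "cost_p p \<pi> = (if I = \<infinity> then \<infinity> else ennreal (enn2real I powr (1 / p)))"
    by (simp add: cost_p_def I_def Let_def case_prod_beta')
  show ?thesis
  proof (cases "I = \<infinity>")
    case False
    then obtain r where r: "I = ennreal r" "0 \<le> r" by (cases I) auto
    have "r powr (1 / p) < c \<longleftrightarrow> r < c powr p"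
    proof
      assume "r powr (1 / p) < c"
      then have "(r powr (1 / p)) powr p < c powr p" using assms by (intro powr_less_mono2) auto
      then show "r < c powr p" using assms r by (simp add: powr_powr)
    next
      assume "r < c powr p"
      then have "r powr (1 / p) < (c powr p) powr (1 / p)" using assms r by (intro powr_less_mono2) auto
      then show "r powr (1 / p) < c" using assms by (simp add: powr_powr)
    qed
    then show ?thesis
      using False r assms unfolding I I_def[symmetric] by (simp add: ennreal_less_iff)
  qed (simp add: I I_def[symmetric])
qed

lemma borel_fst_snd [measurable]:
  "fst \<in> borel_measurable (borel :: ('a::second_countable_topology \<times> 'b::second_countable_topology) measure)"
  "snd \<in> borel_measurable (borel :: ('a::second_countable_topology \<times> 'b::second_countable_topology) measure)"
  by (simp_all add: borel_prod[symmetric])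

text \<open>
  In a coupling of cost less than \<open>r * \<eta>\<close> the two coordinates differ by r or more with probability
  at most \<open>\<eta> powr p\<close>, by Markov's inequality.
\<close>

lemma cdf_shift_le_if_wasserstein_less:
  assumes p: "1 \<le> p" and W: "wasserstein p M M' < ennreal (r * \<eta>)" and r: "0 < r" and \<eta>: "0 < \<eta>" "\<eta> \<le> 1"
  shows "cdf M (y - r) \<le> cdf M' y + \<eta>" "cdf M' y \<le> cdf M (y + r) + \<eta>"
proof -
  obtain \<pi> where \<pi>: "\<pi> \<in> couplings M M'" "cost_p p \<pi> < ennreal (r * \<eta>)"
    using W by (auto simp: wasserstein_def INF_less_iff)
  have s[simp, measurable_cong]: "sets \<pi> = sets borel" and "prob_space \<pi>"
    and M: "M = distr \<pi> borel fst" "M' = distr \<pi> borel snd"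
    using \<pi>(1) by (auto simp: couplings_def space_prob_algebra)
  interpret prob_space \<pi> by fact
  have [simp]: "space \<pi> = UNIV" using sets_eq_imp_space_eq[OF s] by simp
  define A where "A = {z :: real \<times> real. r \<le> \<bar>fst z - snd z\<bar>}"
  have A[measurable]: "A \<in> sets \<pi>"
    unfolding A_def s by measurable
  have set[measurable]: "{z. fst z \<le> a} \<in> sets \<pi>" "{z. snd z \<le> a} \<in> sets \<pi>" for a :: real
    unfolding s by measurable
  have "ennreal (r powr p) * emeasure \<pi> A = (\<integral>\<^sup>+ z. ennreal (r powr p) * indicator A z \<partial>\<pi>)"
    by (rule nn_integral_cmult_indicator[symmetric]) measurable
  also have "\<dots> \<le> (\<integral>\<^sup>+ z. ennreal (\<bar>fst z - snd z\<bar> powr p) \<partial>\<pi>)"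
    by (intro nn_integral_mono) (use r p in \<open>auto simp: indicator_def A_def intro!: ennreal_leI powr_mono2\<close>)
  also have "\<dots> < ennreal ((r * \<eta>) powr p)"
    using \<pi>(2) p r \<eta> by (simp add: cost_p_less_iff)
  finally have "r powr p * prob A < (r * \<eta>) powr p"
    by (simp add: emeasure_eq_measure ennreal_mult[symmetric] ennreal_less_iff)
  then have "prob A < \<eta> powr p" using r \<eta> by (simp add: powr_mult)
  also have "\<dots> \<le> \<eta> powr 1" using \<eta> p by (intro powr_mono') auto
  finally have PA: "prob A \<le> \<eta>" using \<eta> by simp
  have c: "cdf M a = prob {z. fst z \<le> a}" "cdf M' a = prob {z. snd z \<le> a}" for a
    by (simp_all add: M cdf_def measure_distr vimage_def)
  have "cdf M (y - r) \<le> prob ({z. snd z \<le> y} \<union> A)"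
    unfolding c by (intro finite_measure_mono) (use A set in \<open>auto simp: A_def\<close>)
  also have "\<dots> \<le> cdf M' y + prob A" unfolding c by (intro measure_Un_le A set)
  finally show "cdf M (y - r) \<le> cdf M' y + \<eta>" using PA by simp
  have "cdf M' y \<le> prob ({z. fst z \<le> y + r} \<union> A)"
    unfolding c by (intro finite_measure_mono) (use A set in \<open>auto simp: A_def\<close>)
  also have "\<dots> \<le> cdf M (y + r) + prob A" unfolding c by (intro measure_Un_le A set)
  finally show "cdf M' y \<le> cdf M (y + r) + \<eta>" using PA by simp
qed

text \<open>
  A monotone function has only countably many discontinuities.
\<close>

lemma AE_unif_isCont_quantile:
  assumes "real_distribution M"
  shows "AE u in unif. isCont (quantile M) u"
proof -
  define D where "D = {u \<in> {0<..<1}. \<not> isCont (quantile M) u}"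
  have "mono_on {0<..<1} (quantile M)"
  proof (rule mono_onI)
    fix u v :: real assume "u \<in> {0<..<1}" "v \<in> {0<..<1}" "u \<le> v"
    then show "quantile M u \<le> quantile M v"
      using quantile_le_iff[OF assms, of u "quantile M v"] quantile_le_iff[OF assms, of v "quantile M v"] by auto
  qed
  then have "countable D" unfolding D_def by (intro mono_on_ctble_discont_open) auto
  then have "D \<in> null_sets lborel" by (rule countable_imp_null_set_lborel)
  then have "AE u in lborel. u \<notin> D" by (rule AE_not_in)
  then have "AE u in unif. u \<notin> D"
    unfolding unif_def by (intro AE_uniform_measureI) (auto elim: eventually_mono)
  with AE_unif show ?thesis by eventually_elim (auto simp: D_def)
qed

text \<open>
  Convergence holds at every continuity point of the limiting quantile function; continuity enters
  through values s slightly larger than u in the upper bound.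
\<close>

lemma quantile_tendsto_if_wasserstein_tendsto:
  assumes p: "1 \<le> p" and M: "real_distribution M" and Mn: "\<And>n. real_distribution (Mn n)"
    and W: "\<And>\<epsilon>. 0 < \<epsilon> \<Longrightarrow> \<forall>\<^sub>F n in sequentially. wasserstein p (Mn n) M < ennreal \<epsilon>"
  shows "AE u in unif. (\<lambda>n. quantile (Mn n) u) \<longlonglongrightarrow> quantile M u"
  using AE_unif AE_unif_isCont_quantile[OF M]
proof eventually_elim
  case (elim u)
  then have u: "0 < u" "u < 1" by auto
  interpret real_distribution M by (rule M)
  show ?case
  proof (rule tendstoI)
    fix e :: real assume e: "0 < e"
    define q where "q = quantile M u"
    have ev: "\<forall>\<^sub>F n in sequentially. cdf (Mn n) (y - e / 2) \<le> cdf M y + \<eta> \<and> cdf M y \<le> cdf (Mn n) (y + e / 2) + \<eta>"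
      if "0 < \<eta>" "\<eta> \<le> 1" for \<eta> y
    proof -
      have "\<forall>\<^sub>F n in sequentially. wasserstein p (Mn n) M < ennreal (e / 2 * \<eta>)"
        using that e by (intro W) simp
      then show ?thesis
        by eventually_elim (use cdf_shift_le_if_wasserstein_less[OF p, of _ M "e / 2" \<eta>] that e in simp)
    qed
    \<comment> \<open>Half the gaps between u and the distribution function slightly left and right of q serve as probability margins.\<close>
    define \<eta> where "\<eta> = (u - cdf M (q - e / 4)) / 2"
    have "cdf M (q - e / 4) < u"
      using quantile_le_iff[OF M u, of "q - e / 4"] e by (simp add: q_def)
    then have \<eta>: "0 < \<eta>" "\<eta> \<le> 1" using u cdf_nonneg[of "q - e / 4"] by (auto simp: \<eta>_def)
    have "isCont (quantile M) u" using elim by simp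
    then have "(quantile M \<longlongrightarrow> q) (at_right u)"
      unfolding q_def isCont_def by (rule filterlim_mono) (auto intro: at_le)
    then have "\<forall>\<^sub>F s in at_right u. quantile M s < q + e / 4"
      using e by (intro order_tendstoD) auto
    moreover have "\<forall>\<^sub>F s in at_right u. s < 1" using u by (intro order_tendstoD) (auto intro: tendsto_ident_at)
    moreover have "\<forall>\<^sub>F s in at_right u. u < s" by (rule eventually_at_right_less)
    ultimately have "\<forall>\<^sub>F s in at_right u. quantile M s < q + e / 4 \<and> s < 1 \<and> u < s"
      by eventually_elim simp
    then obtain s where s: "quantile M s < q + e / 4" "s < 1" "u < s"
      using eventually_happens[of _ "at_right u"] by (auto simp: trivial_limit_at_right_real)
    then have Fs: "s \<le> cdf M (q + e / 4)"
      using quantile_le_iff[OF M, of s "q + e / 4"] u by simp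
    define \<eta>' where "\<eta>' = (s - u) / 2"
    have \<eta>': "0 < \<eta>'" "\<eta>' \<le> 1" using s u by (auto simp: \<eta>'_def)
    have half: "x + (u - x) / 2 < u" if "x < u" for x
      using that by (simp add: field_simps)
    have half2: "(s - u) / 2 < s - u" using s by simp
    show "\<forall>\<^sub>F n in sequentially. dist (quantile (Mn n) u) (quantile M u) < e"
      using ev[OF \<eta>, of "q - e / 4"] ev[OF \<eta>', of "q + e / 4"]
    proof eventually_elim
      case (elim n)
      have h: "q - e / 4 - e / 2 = q - 3 / 4 * e" "q + e / 4 + e / 2 = q + 3 / 4 * e" by simp_all
      have "\<not> u \<le> cdf (Mn n) (q - 3 / 4 * e)"
        using conjunct1[OF elim(1)] half[OF \<open>cdf M (q - e / 4) < u\<close>] unfolding \<eta>_def h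
        by (meson not_le order_trans le_less_trans)
      then have 1: "q - 3 / 4 * e < quantile (Mn n) u"
        using quantile_le_iff[OF Mn u, of n "q - 3 / 4 * e"] by simp
      have "u \<le> cdf (Mn n) (q + 3 / 4 * e)"
        using conjunct2[OF elim(2)] Fs half2 unfolding \<eta>'_def h by linarith
      then have 2: "quantile (Mn n) u \<le> q + 3 / 4 * e"
        using quantile_le_iff[OF Mn u, of n "q + 3 / 4 * e"] by simp
      show ?case using 1 2 e unfolding q_def[symmetric] dist_real_def by (simp add: abs_less_iff)
    qed
  qed
qed

section \<open>Lower semicontinuous functions\<close>

text \<open>
  For nonnegative functions on the spaces that occur here this topological form agrees with the
  sequential one used in the proofs, see \<open>lscI_seq\<close> and \<open>lsc_le_liminf\<close>.
\<close>

definition lsc :: "('a::topological_space \<Rightarrow> ennreal) \<Rightarrow> bool" where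
  "lsc g \<longleftrightarrow> (\<forall>c. open {z. c < g z})"

lemma lsc_measurable: "lsc g \<Longrightarrow> g \<in> borel_measurable borel"
  by (rule borel_measurableI_greater) (simp add: lsc_def)

lemma lscI_seq:
  fixes g :: "'a::first_countable_topology \<Rightarrow> ennreal"
  assumes "\<And>c z zn. zn \<longlonglongrightarrow> z \<Longrightarrow> (\<And>n. g (zn n) \<le> c) \<Longrightarrow> g z \<le> c"
  shows "lsc g"
  unfolding lsc_def
proof
  fix c
  have "closed {z. g z \<le> c}" unfolding closed_sequential_limits using assms by auto
  then have "open (- {z. g z \<le> c})" by (rule open_Compl)
  also have "- {z. g z \<le> c} = {z. c < g z}" by auto
  finally show "open {z. c < g z}" .
qed

lemma lsc_le_liminf:
  assumes "lsc g" "zn \<longlonglongrightarrow> z"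
  shows "g z \<le> liminf (\<lambda>n. g (zn n))"
  unfolding le_Liminf_iff
proof safe
  fix c assume "c < g z"
  then show "\<forall>\<^sub>F n in sequentially. c < g (zn n)"
    using topological_tendstoD[OF assms(2), of "{z. c < g z}"] assms(1) by (auto simp: lsc_def)
qed

lemma lsc_SUP:
  assumes "\<And>i. i \<in> I \<Longrightarrow> lsc (g i)"
  shows "lsc (\<lambda>z. SUP i\<in>I. g i z)"
proof -
  have "{z. c < (SUP i\<in>I. g i z)} = (\<Union>i\<in>I. {z. c < g i z})" for c
    by (auto simp: less_SUP_iff)
  then show ?thesis using assms by (auto simp: lsc_def)
qed

text \<open>
  The common compactness argument behind attainment and lower semicontinuity of the infimum over K.
\<close>

lemma lsc_compact_limit:
  fixes G :: "'a::first_countable_topology \<Rightarrow> real \<Rightarrow> ennreal"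
  assumes G: "lsc (\<lambda>(z, b). G z b)" and K: "compact K"
    and z: "zn \<longlonglongrightarrow> z" and b: "\<And>n. bn n \<in> K" and c: "cn \<longlonglongrightarrow> c" and le: "\<And>n. G (zn n) (bn n) \<le> cn n"
  shows "\<exists>b\<in>K. G z b \<le> c"
proof -
  obtain b r where r: "b \<in> K" "strict_mono r" "(bn \<circ> r) \<longlonglongrightarrow> b"
    using K b unfolding compact_def by metis
  have "(\<lambda>n. (zn (r n), bn (r n))) \<longlonglongrightarrow> (z, b)"
    using r LIMSEQ_subseq_LIMSEQ[OF z r(2)] by (intro tendsto_Pair) (auto simp: comp_def)
  from lsc_le_liminf[OF G this] have "G z b \<le> liminf (\<lambda>n. G (zn (r n)) (bn (r n)))" by simp
  also have "\<dots> \<le> liminf (\<lambda>n. cn (r n))" by (intro Liminf_mono always_eventually allI le)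
  also have "\<dots> = c"
    using LIMSEQ_subseq_LIMSEQ[OF c r(2)] by (intro lim_imp_Liminf) (auto simp: comp_def)
  finally show ?thesis using r by auto
qed

lemma lsc_compact_INF_attained:
  fixes G :: "'a::first_countable_topology \<Rightarrow> real \<Rightarrow> ennreal"
  assumes G: "lsc (\<lambda>(z, b). G z b)" and K: "compact K" "K \<noteq> {}"
  shows "\<exists>b\<in>K. G z b = (INF b\<in>K. G z b)"
proof -
  obtain f where f: "range f \<subseteq> G z ` K" "f \<longlonglongrightarrow> (INF b\<in>K. G z b)"
    using Inf_as_limit[of "G z ` K"] K by auto
  then have "\<forall>n. \<exists>b\<in>K. f n = G z b" by auto
  then obtain bn where bn: "\<And>n. bn n \<in> K" "\<And>n. f n = G z (bn n)" by metis
  have "\<exists>b\<in>K. G z b \<le> (INF b\<in>K. G z b)"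
    by (rule lsc_compact_limit[where zn="\<lambda>_. z" and bn=bn and cn=f, OF G K(1)]) (use bn f in auto)
  then show ?thesis by (meson INF_lower order_antisym)
qed

lemma lsc_compact_INF:
  fixes G :: "'a::first_countable_topology \<Rightarrow> real \<Rightarrow> ennreal"
  assumes G: "lsc (\<lambda>(z, b). G z b)" and K: "compact K" "K \<noteq> {}"
  shows "lsc (\<lambda>z. INF b\<in>K. G z b)"
proof (rule lscI_seq)
  fix c z zn assume z: "zn \<longlonglongrightarrow> z" and le: "\<And>n. (INF b\<in>K. G (zn n) b) \<le> c"
  have "\<forall>n. \<exists>b\<in>K. G (zn n) b \<le> c" using lsc_compact_INF_attained[OF G K] le by metis
  then obtain bn where bn: "\<And>n. bn n \<in> K" "\<And>n. G (zn n) (bn n) \<le> c" by metis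
  have "\<exists>b\<in>K. G z b \<le> c" by (rule lsc_compact_limit[where bn=bn and cn="\<lambda>_. c", OF G K(1) z]) (use bn in auto)
  then show "(INF b\<in>K. G z b) \<le> c" by (meson INF_lower2)
qed

text \<open>
  The smallest minimiser is Borel: it is at most c exactly if the infimum over the compact set
  \<open>K \<inter> {..c}\<close> equals the infimum over K, and both infima are lower semicontinuous in z.
\<close>

lemma lsc_measurable_argmin:
  fixes G :: "'a::first_countable_topology \<Rightarrow> real \<Rightarrow> ennreal"
  assumes G: "lsc (\<lambda>(z, b). G z b)" and K: "compact K" "K \<noteq> {}"
  shows "\<exists>s \<in> borel_measurable borel. \<forall>z. s z \<in> K \<and> G z (s z) = (INF b\<in>K. G z b)"
proof -
  define S where "S z = {b\<in>K. G z b \<le> (INF b\<in>K. G z b)}" for z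
  define s where "s z = Inf (S z)" for z
  have S_eq: "b \<in> S z \<longleftrightarrow> b \<in> K \<and> G z b = (INF b\<in>K. G z b)" for b z
    unfolding S_def by (auto intro: antisym INF_lower)
  have ne: "S z \<noteq> {}" for z using lsc_compact_INF_attained[OF G K, of z] S_eq by blast
  have bdd: "bdd_below (S z)" for z
    using bounded_imp_bdd_below[OF compact_imp_bounded[OF K(1)]] unfolding S_def by (rule bdd_below_mono) auto
  have cl: "closed (S z)" for z
    unfolding closed_sequential_limits
  proof safe
    fix bn b assume bn: "\<forall>n. bn n \<in> S z" and lim: "bn \<longlonglongrightarrow> b"
    have "b \<in> K" using closed_sequentially[OF compact_imp_closed[OF K(1)] _ lim] bn by (auto simp: S_def)
    have "(\<lambda>n. (z, bn n)) \<longlonglongrightarrow> (z, b)" using lim by (intro tendsto_Pair tendsto_const)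
    from lsc_le_liminf[OF G this] have "G z b \<le> liminf (\<lambda>n. G z (bn n))" by simp
    also have "\<dots> = (INF b\<in>K. G z b)" using bn unfolding S_eq by (simp add: Liminf_const)
    finally show "b \<in> S z" using \<open>b \<in> K\<close> by (simp add: S_def)
  qed
  have s: "s z \<in> S z" for z unfolding s_def by (rule closed_contains_Inf[OF ne bdd cl])
  have "s \<in> borel_measurable borel"
  proof (rule borel_measurableI_le)
    fix c
    define V where "V z = (INF b\<in>K. G z b)" for z
    have V: "V \<in> borel_measurable borel"
      unfolding V_def by (rule lsc_measurable[OF lsc_compact_INF[OF G K]])
    \<comment> \<open>If no point of K is at most c, then neither is the minimiser, and the infimum over the empty set has to be avoided.\<close>
    define Kc where "Kc = K \<inter> {..c}"
    have iff: "s z \<le> c \<longleftrightarrow> (\<exists>b\<in>Kc. G z b \<le> V z)" for z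
      using s[of z] cInf_lower[OF _ bdd, of _ z] unfolding s_def[symmetric]
      by (auto simp: S_def V_def Kc_def intro: order_trans)
    show "{z \<in> space borel. s z \<le> c} \<in> sets borel"
    proof (cases "Kc = {}")
      case False
      have "compact Kc" unfolding Kc_def using K(1) by (intro compact_Int_closed) auto
      note Kc = this False
      have "s z \<le> c \<longleftrightarrow> (INF b\<in>Kc. G z b) \<le> V z" for z
        unfolding iff using lsc_compact_INF_attained[OF G Kc, of z] by (metis INF_lower2)
      moreover have "(\<lambda>z. INF b\<in>Kc. G z b) \<in> borel_measurable borel"
        by (rule lsc_measurable[OF lsc_compact_INF[OF G Kc]])
      ultimately show ?thesis using V by simp
    qed (simp add: iff)
  qed
  then show ?thesis using s S_eq by blast
qed

text \<open>
  For each rational level the open superlevel sets of the family have a countable subfamily with the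
  same union, by the Lindelof property.
\<close>

lemma lsc_countable_SUP:
  fixes g :: "'i \<Rightarrow> 'a::second_countable_topology \<Rightarrow> ennreal"
  assumes g: "\<And>i. i \<in> I \<Longrightarrow> lsc (g i)" and "I \<noteq> {}"
  shows "\<exists>e :: nat \<Rightarrow> 'i. range e \<subseteq> I \<and> (\<forall>z. (SUP i\<in>I. g i z) = (SUP n. g (e n) z))"
proof -
  have "\<exists>C\<subseteq>I. countable C \<and> (\<Union>i\<in>C. {z. c < g i z}) = (\<Union>i\<in>I. {z. c < g i z})" for c
  proof -
    obtain F where F: "F \<subseteq> (\<lambda>i. {z. c < g i z}) ` I" "countable F" "\<Union>F = (\<Union>i\<in>I. {z. c < g i z})"
      using Lindelof[of "(\<lambda>i. {z. c < g i z}) ` I"] g by (auto simp: lsc_def)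
    then obtain C where "C \<subseteq> I" "countable C" "F = (\<lambda>i. {z. c < g i z}) ` C"
      by (meson countable_subset_image)
    then show ?thesis using F by blast
  qed
  then obtain C where C: "\<And>c. C c \<subseteq> I" "\<And>c. countable (C c)"
    "\<And>c. (\<Union>i\<in>C c. {z. c < g i z}) = (\<Union>i\<in>I. {z. c < g i z})" by metis
  obtain i0 where "i0 \<in> I" using \<open>I \<noteq> {}\<close> by auto
  define D where "D = insert i0 (\<Union>r::rat. C (ennreal (of_rat r)))"
  have D: "D \<subseteq> I" "countable D" "D \<noteq> {}" using C(1,2) \<open>i0 \<in> I\<close> by (auto simp: D_def)
  have "(SUP i\<in>I. g i z) = (SUP i\<in>D. g i z)" for z
  proof (rule antisym)
    show "(SUP i\<in>I. g i z) \<le> (SUP i\<in>D. g i z)"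
    proof (rule dense_le)
      fix c assume "c < (SUP i\<in>I. g i z)"
      then obtain r :: rat where r: "c < ennreal (of_rat r)" "ennreal (of_rat r) < (SUP i\<in>I. g i z)"
        using ennreal_rat_dense by blast
      then have "z \<in> (\<Union>i\<in>C (ennreal (of_rat r)). {z. ennreal (of_rat r) < g i z})"
        unfolding C(3) by (auto simp: less_SUP_iff)
      then obtain i where "i \<in> D" "ennreal (of_rat r) < g i z" by (auto simp: D_def)
      then show "c \<le> (SUP i\<in>D. g i z)" using r(1) by (intro SUP_upper2[of i]) auto
    qed
    show "(SUP i\<in>D. g i z) \<le> (SUP i\<in>I. g i z)" using D by (intro SUP_subset_mono) auto
  qed
  moreover have e: "range (from_nat_into D) = D" using D by (simp add: range_from_nat_into)
  have "(SUP i\<in>D. g i z) = (SUP n. g (from_nat_into D n) z)" for z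
    by (subst e[symmetric]) (simp add: image_image)
  ultimately show ?thesis using D(1) by (intro exI[of _ "from_nat_into D"]) (simp add: e)
qed

lemma lsc_nn_integral_le:
  assumes V: "lsc V" and [measurable]: "\<And>n. \<Phi>n n \<in> borel_measurable M"
    and lim: "AE w in M. (\<lambda>n. \<Phi>n n w) \<longlonglongrightarrow> \<Phi> w"
  shows "(\<integral>\<^sup>+ w. V (\<Phi> w) \<partial>M) \<le> liminf (\<lambda>n. \<integral>\<^sup>+ w. V (\<Phi>n n w) \<partial>M)"
proof -
  have [measurable]: "V \<in> borel_measurable borel" using V by (rule lsc_measurable)
  have "(\<integral>\<^sup>+ w. V (\<Phi> w) \<partial>M) \<le> (\<integral>\<^sup>+ w. liminf (\<lambda>n. V (\<Phi>n n w)) \<partial>M)"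
    by (rule nn_integral_mono_AE) (use lim in eventually_elim, rule lsc_le_liminf[OF V])
  also have "\<dots> \<le> liminf (\<lambda>n. \<integral>\<^sup>+ w. V (\<Phi>n n w) \<partial>M)" by (rule nn_integral_liminf) measurable
  finally show ?thesis .
qed

lemma lsc_nn_integral:
  fixes \<Phi> :: "'a::first_countable_topology \<Rightarrow> 'w \<Rightarrow> 'b::topological_space"
  assumes V: "lsc V" and \<Phi>: "\<And>z. \<Phi> z \<in> borel_measurable M"
    and lim: "\<And>zn z. zn \<longlonglongrightarrow> z \<Longrightarrow> AE w in M. (\<lambda>n. \<Phi> (zn n) w) \<longlonglongrightarrow> \<Phi> z w"
  shows "lsc (\<lambda>z. \<integral>\<^sup>+ w. V (\<Phi> z w) \<partial>M)"
proof (rule lscI_seq)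
  fix c z zn assume z: "zn \<longlonglongrightarrow> z" and le: "\<And>n. (\<integral>\<^sup>+ w. V (\<Phi> (zn n) w) \<partial>M) \<le> c"
  have "(\<integral>\<^sup>+ w. V (\<Phi> z w) \<partial>M) \<le> liminf (\<lambda>n. \<integral>\<^sup>+ w. V (\<Phi> (zn n) w) \<partial>M)"
    by (rule lsc_nn_integral_le[OF V \<Phi> lim[OF z]])
  also have "\<dots> \<le> liminf (\<lambda>n. c)" by (intro Liminf_mono always_eventually allI le)
  finally show "(\<integral>\<^sup>+ w. V (\<Phi> z w) \<partial>M) \<le> c" by (simp add: Liminf_const)
qed

section \<open>Martingale couplings as images of seeds\<close>

text \<open>
  The laws of (u, d) that produce martingale couplings of cost less than \<open>\<delta>\<close> for every first marginal.
\<close>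

definition seeds :: "real \<Rightarrow> real \<Rightarrow> (real \<times> real) measure set" where
  "seeds p \<delta> = {\<theta> \<in> space (prob_algebra borel). distr \<theta> borel fst = unif \<and>
     (\<integral>\<^sup>+ w. ennreal (\<bar>snd w\<bar> powr p) \<partial>\<theta>) < ennreal (\<delta> powr p) \<and> (\<integral>w. snd w \<partial>\<theta>) = 0}"

lemma seeds_nonempty:
  assumes "0 < \<delta>" "1 \<le> p" shows "seeds p \<delta> \<noteq> {}"
proof -
  have [measurable]: "(\<lambda>u. (u, 0 :: real)) \<in> (borel :: real measure) \<rightarrow>\<^sub>M borel" unfolding borel_prod[symmetric] by measurable
  have "distr unif borel (\<lambda>u. (u, 0 :: real)) \<in> seeds p \<delta>"
    using assms by (auto simp: seeds_def space_prob_algebra unif.prob_space_distr distr_distr comp_def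
      nn_integral_distr integral_distr distr_id2)
  then show ?thesis by auto
qed

lemma seedsD:
  assumes "\<theta> \<in> seeds p \<delta>"
  shows "sets \<theta> = sets borel" "prob_space \<theta>" "space \<theta> = UNIV"
    "distr \<theta> borel fst = unif" "(\<integral>\<^sup>+ w. ennreal (\<bar>snd w\<bar> powr p) \<partial>\<theta>) < ennreal (\<delta> powr p)" "(\<integral>w. snd w \<partial>\<theta>) = 0"
  using assms sets_eq_imp_space_eq[of \<theta> borel] by (auto simp: seeds_def space_prob_algebra)

lemma AE_seeds_fst:
  assumes \<theta>: "\<theta> \<in> seeds p \<delta>" and P: "AE u in unif. P u"
  shows "AE w in \<theta>. P (fst w)"
proof -
  note [measurable_cong] = seedsD(1)[OF \<theta>]
  show ?thesis
    using P unfolding seedsD(4)[OF \<theta>, symmetric] by (rule AE_distrD[rotated]) measurable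
qed

definition from_seed :: "real measure \<Rightarrow> real \<times> real \<Rightarrow> real \<times> real" where
  "from_seed M w = (quantile M (fst w), quantile M (fst w) - snd w)"

lemma measurable_from_seed:
  assumes "real_distribution M" shows "from_seed M \<in> borel \<rightarrow>\<^sub>M borel"
  using measurable_quantile_single[OF assms] unfolding from_seed_def borel_prod[symmetric] by measurable

text \<open>
  Cost and mean of the image coupling only see x - y = d, so they are conditions on the seed alone;
  the distributional transform shows that every coupling arises.
\<close>

lemma Pi_M_eq_seeds:
  assumes M: "real_distribution M" and \<delta>: "0 < \<delta>" and p: "1 \<le> p"
  shows "Pi_M p \<delta> M = (\<lambda>\<theta>. distr \<theta> borel (from_seed M)) ` seeds p \<delta>"
proof -
  note [measurable] = measurable_from_seed[OF M]
  have key: "distr \<theta> borel (from_seed M) \<in> Pi_M p \<delta> M \<longleftrightarrow> \<theta> \<in> seeds p \<delta>"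
    if \<theta>: "\<theta> \<in> space (prob_algebra borel)" "distr \<theta> borel fst = unif" for \<theta>
  proof -
    have [measurable_cong]: "sets \<theta> = sets borel" and "prob_space \<theta>"
      using \<theta> by (auto simp: space_prob_algebra)
    then interpret prob_space \<theta> by simp
    have "distr (distr \<theta> borel (from_seed M)) borel fst = distr (distr \<theta> borel fst) borel (quantile M)"
      using measurable_quantile_single[OF M] by (simp add: distr_distr comp_def from_seed_def)
    also have "\<dots> = M" by (simp add: \<theta> distr_quantile[OF M])
    finally show ?thesis
      using \<delta> p \<theta> by (auto simp: Pi_M_def couplings_fst_def seeds_def cost_p_less_iff space_prob_algebra
         prob_space_distr nn_integral_distr integral_distr case_prod_beta from_seed_def)
  qed
  show ?thesis
  proof
    show "(\<lambda>\<theta>. distr \<theta> borel (from_seed M)) ` seeds p \<delta> \<subseteq> Pi_M p \<delta> M"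
      using key by (auto simp: seeds_def)
    show "Pi_M p \<delta> M \<subseteq> (\<lambda>\<theta>. distr \<theta> borel (from_seed M)) ` seeds p \<delta>"
    proof
      fix \<pi> assume \<pi>: "\<pi> \<in> Pi_M p \<delta> M"
      then have "\<pi> \<in> space (prob_algebra borel)" "M = distr \<pi> borel fst"
        by (auto simp: Pi_M_def couplings_fst_def)
      with distributional_transform[of \<pi>] obtain \<theta> where \<theta>: "\<theta> \<in> space (prob_algebra borel)"
        "distr \<theta> borel fst = unif" "distr \<theta> borel (from_seed M) = \<pi>"
        by (auto simp: from_seed_def[abs_def] case_prod_beta')
      then show "\<pi> \<in> (\<lambda>\<theta>. distr \<theta> borel (from_seed M)) ` seeds p \<delta>" using key[of \<theta>] \<pi> by auto
    qed
  qed
qed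

section \<open>Paths\<close>

text \<open>
  Index sets keep the form \<open>{1..t}\<close> under simplification.
\<close>

declare One_nat_def [simp del]

type_synonym path = "nat \<Rightarrow> real"

abbreviation cut :: "nat \<Rightarrow> path \<Rightarrow> path" where
  "cut t x \<equiv> restrict x {1..t}"

lemma tendsto_fun_iff:
  fixes f :: "'a \<Rightarrow> 'b \<Rightarrow> 'c::topological_space"
  shows "(f \<longlongrightarrow> l) F \<longleftrightarrow> (\<forall>i. ((\<lambda>x. f x i) \<longlongrightarrow> l i) F)"
proof -
  have "(f \<longlongrightarrow> l) F \<longleftrightarrow> limitin (product_topology (\<lambda>_. euclidean) UNIV) f l F"
    by (simp add: euclidean_product_topology)
  also have "\<dots> \<longleftrightarrow> (\<forall>i. ((\<lambda>x. f x i) \<longlongrightarrow> l i) F)"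
    by (subst limitin_componentwise) (auto simp: extensional_def)
  finally show ?thesis .
qed

lemma tendsto_fun_upd:
  fixes f :: "'a \<Rightarrow> 'b \<Rightarrow> 'c::topological_space"
  assumes "(f \<longlongrightarrow> l) F" "(u \<longlongrightarrow> v) F"
  shows "((\<lambda>x. (f x)(i := u x)) \<longlongrightarrow> l(i := v)) F"
  using assms by (auto simp: tendsto_fun_iff)

lemma measurable_path_fun_upd:
  fixes f :: "'a \<Rightarrow> path"
  assumes "f \<in> borel_measurable M" "u \<in> borel_measurable M"
  shows "(\<lambda>w. (f w)(i := u w)) \<in> borel_measurable M"
proof (rule measurable_coordinatewise_then_product)
  fix j
  have "(\<lambda>w. f w j) \<in> borel_measurable M"
    using measurable_compose[OF assms(1) borel_measurable_continuous_onI[OF continuous_on_product_coordinates]] .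
  then show "(\<lambda>w. ((f w)(i := u w)) j) \<in> borel_measurable M" using assms(2) by (cases "i = j") auto
qed

lemma measurable_path_coordinate: "(\<lambda>x :: path. x i) \<in> borel_measurable borel"
  by (rule borel_measurable_continuous_onI[OF continuous_on_product_coordinates])

lemma measurable_cut: "cut t \<in> borel \<rightarrow>\<^sub>M R_borel t"
  by (rule measurable_restrict) (rule measurable_path_coordinate)

text \<open>
  Points of R^t are also points of the space of all sequences, and the functions of the dynamic
  programme are defined there: one Polish space serves all t.
\<close>

lemma measurable_path_embed: "(\<lambda>x. x) \<in> R_borel t \<rightarrow>\<^sub>M (borel :: path measure)"
proof (rule measurable_coordinatewise_then_product)
  fix i
  show "(\<lambda>x. x i) \<in> borel_measurable (R_borel t)"
  proof (cases "i \<in> {1..t}")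
    case False
    then have "x i = undefined" if "x \<in> space (R_borel t)" for x
      using that by (auto simp: space_PiM PiE_def extensional_def)
    then show ?thesis by (subst measurable_cong[where g="\<lambda>_. undefined"]) auto
  qed (rule measurable_component_singleton)
qed

lemma measurable_path_append:
  assumes f: "f \<in> M \<rightarrow>\<^sub>M R_borel t" and u: "u \<in> borel_measurable M"
  shows "(\<lambda>z. (f z)(Suc t := u z)) \<in> M \<rightarrow>\<^sub>M R_borel (Suc t)"
proof (rule measurable_PiM_single')
  fix i assume i: "i \<in> {1..Suc t}"
  show "(\<lambda>z. ((f z)(Suc t := u z)) i) \<in> borel_measurable M"
  proof (cases "i = Suc t")
    case False
    then have "i \<in> {1..t}" using i by auto
    from measurable_compose[OF f measurable_component_singleton[OF this]] False show ?thesis by simp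
  qed (use u in simp)
next
  show "(\<lambda>z. (f z)(Suc t := u z)) \<in> space M \<rightarrow> (\<Pi>\<^sub>E i\<in>{1..Suc t}. space borel)"
    using measurable_space[OF f] by (auto simp: space_PiM PiE_def extensional_def)
qed

lemma space_R_borel: "space (R_borel t) = extensional {1..t}"
  by (auto simp: space_PiM PiE_def)

lemma space_RR_borel: "space (RR_borel t) = extensional {1..t} \<times> extensional {1..t}"
  by (simp add: space_pair_measure space_R_borel)

lemma continuous_map_cut: "continuous_map euclidean (R_top t) (cut t)"
  unfolding continuous_map_componentwise
  by (auto simp: continuous_map_iff_continuous2 intro: continuous_on_product_coordinates)

fun advance :: "nat \<Rightarrow> path \<times> path \<times> path \<Rightarrow> real \<Rightarrow> real \<times> real \<Rightarrow> path \<times> path \<times> path" where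
  "advance t (x, y, a) b (u, v) = (x(Suc t := u), y(Suc t := v), a(Suc t := b))"

section \<open>The dynamic programming functions\<close>

text \<open>
  The lower bound on \<open>f + C\<close> is 1 and not 0, so that the value is strictly positive after the shift.
  The lower bound for the control problem below produces a bicausal measure from any number strictly
  below the value; thanks to the positivity this also shows that bicausal measures exist.
\<close>

locale martingale_robust_control =
  fixes p \<delta> :: real and N :: nat and k :: "nat \<Rightarrow> path \<Rightarrow> real measure" and K :: "real set"
    and f :: "path \<times> path \<Rightarrow> real" and C :: real
  assumes p: "1 \<le> p" and \<delta>: "0 < \<delta>" and K: "compact K" "K \<noteq> {}"
    and k_meas: "\<And>t. t < N \<Longrightarrow> k t \<in> R_borel t \<rightarrow>\<^sub>M prob_algebra borel"
    and k_cont: "successively_W_continuous p N k"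
    and f_lsc: "lsc_on_top (prod_topology (R_top N) (R_top N)) f"
    and f_bound_1: "\<And>y a. y \<in> extensional {1..N} \<Longrightarrow> a \<in> extensional {1..N} \<Longrightarrow> 1 - C \<le> f (y, a)"
    and C: "0 \<le> C"
begin

lemma f_bound: "y \<in> extensional {1..N} \<Longrightarrow> a \<in> extensional {1..N} \<Longrightarrow> - C \<le> f (y, a)"
  using f_bound_1[of y a] by simp

definition coord_quantile :: "nat \<Rightarrow> path \<Rightarrow> real \<Rightarrow> real" where
  "coord_quantile t x u = quantile (k t (cut t x)) u"

definition seed_step :: "nat \<Rightarrow> path \<times> path \<times> path \<Rightarrow> real \<Rightarrow> real \<times> real \<Rightarrow> path \<times> path \<times> path" where
  "seed_step t z b w = advance t z b (from_seed (k t (cut t (fst z))) w)"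

text \<open>
  \<open>V t\<close> is the dynamic value after the shift by C, with the suprema over couplings written over seeds.
  It is a function of infinite sequences that only looks at their first t entries.
\<close>

function V :: "nat \<Rightarrow> path \<times> path \<times> path \<Rightarrow> ennreal" where
  "V t z = (if t < N then INF b\<in>K. SUP \<theta>\<in>seeds p \<delta>. \<integral>\<^sup>+ w. V (Suc t) (seed_step t z b w) \<partial>\<theta>
     else ennreal (f (cut N (fst (snd z)), cut N (snd (snd z))) + C))"
  by pat_completeness auto
termination by (relation "Wellfounded.measure (\<lambda>(t, z). N - t)") auto

declare V.simps [simp del]

text \<open>
  The dynamic value at time t once the next control is fixed to be b.
\<close>

definition G :: "nat \<Rightarrow> path \<times> path \<times> path \<Rightarrow> real \<Rightarrow> ennreal" where
  "G t z b = (SUP \<theta>\<in>seeds p \<delta>. \<integral>\<^sup>+ w. V (Suc t) (seed_step t z b w) \<partial>\<theta>)"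

lemma V_step: "t < N \<Longrightarrow> V t z = (INF b\<in>K. G t z b)"
  by (subst V.simps) (simp add: G_def)

lemma V_end: "V N (x, y, a) = ennreal (f (cut N y, cut N a) + C)"
  by (subst V.simps) simp

lemma V_ge_1: assumes "t \<le> N" shows "1 \<le> V t z"
  using assms
proof (induction t arbitrary: z rule: inc_induct)
  case base
  show ?case using f_bound_1[of "cut N (fst (snd z))" "cut N (snd (snd z))"]
    by (simp add: V.simps[of N] ennreal_1[symmetric] del: ennreal_1)
next
  case (step t)
  obtain \<theta> where \<theta>: "\<theta> \<in> seeds p \<delta>" using seeds_nonempty[OF \<delta> p] by auto
  interpret prob_space \<theta> by (rule seedsD(2)[OF \<theta>])
  have "1 \<le> G t z b" for b
  proof -
    have "1 = (\<integral>\<^sup>+ w. 1 \<partial>\<theta>)" by (simp add: emeasure_space_1)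
    also have "\<dots> \<le> (\<integral>\<^sup>+ w. V (Suc t) (seed_step t z b w) \<partial>\<theta>)" by (intro nn_integral_mono step.IH)
    also have "\<dots> \<le> G t z b" unfolding G_def by (rule SUP_upper[OF \<theta>])
    finally show ?thesis .
  qed
  then show ?case using step.hyps by (simp add: V_step le_INF_iff)
qed

lemma real_distribution_k:
  assumes "t < N" "x \<in> extensional {1..t}"
  shows "real_distribution (k t x)"
  using measurable_space[OF k_meas[OF assms(1)], of x] assms sets_eq_imp_space_eq[of "k t x" borel]
  by (auto simp: space_prob_algebra real_distribution_def real_distribution_axioms_def space_R_borel)

lemma real_distribution_k_cut: "t < N \<Longrightarrow> real_distribution (k t (cut t x))"
  by (rule real_distribution_k) auto

lemma measurable_advance: "advance t z b \<in> borel \<rightarrow>\<^sub>M borel"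
proof -
  obtain x y a where z: "z = (x, y, a)" by (cases z) auto
  have "advance t z b = (\<lambda>w. (x(Suc t := fst w), y(Suc t := snd w), a(Suc t := b)))"
    by (auto simp: z fun_eq_iff)
  also have "\<dots> \<in> borel \<rightarrow>\<^sub>M borel"
    by (intro borel_measurable_Pair measurable_path_fun_upd measurable_const borel_fst_snd) auto
  finally show ?thesis .
qed

lemma measurable_seed_step: "t < N \<Longrightarrow> seed_step t z b \<in> borel \<rightarrow>\<^sub>M borel"
  unfolding seed_step_def
  by (rule measurable_compose[OF measurable_from_seed[OF real_distribution_k_cut] measurable_advance])

lemma coord_quantile_tendsto:
  assumes t: "t < N" and x: "xn \<longlonglongrightarrow> x"
  shows "AE u in unif. (\<lambda>n. coord_quantile t (xn n) u) \<longlonglongrightarrow> coord_quantile t x u"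
proof (cases "t = 0")
  case True
  then show ?thesis by (simp add: coord_quantile_def restrict_def)
next
  case False
  have cx: "cut t x \<in> topspace (R_top t)" by simp
  show ?thesis
    unfolding coord_quantile_def
  proof (rule quantile_tendsto_if_wasserstein_tendsto[OF p real_distribution_k_cut[OF t] real_distribution_k_cut[OF t]])
    fix \<epsilon> :: real assume "0 < \<epsilon>"
    then obtain U where U: "openin (R_top t) U" "cut t x \<in> U" "\<And>x'. x' \<in> U \<Longrightarrow> wasserstein p (k t x') (k t (cut t x)) < ennreal \<epsilon>"
      using k_cont cx False t unfolding successively_W_continuous_def
      by (metis atLeastLessThan_iff less_one not_le)
    have "openin euclidean {z \<in> topspace euclidean. cut t z \<in> U}"
      by (rule openin_continuous_map_preimage[OF continuous_map_cut U(1)])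
    then have "open {z. cut t z \<in> U}" by simp
    then have "\<forall>\<^sub>F n in sequentially. xn n \<in> {z. cut t z \<in> U}"
      using U(2) by (intro topological_tendstoD[OF x]) auto
    then show "\<forall>\<^sub>F n in sequentially. wasserstein p (k t (cut t (xn n))) (k t (cut t x)) < ennreal \<epsilon>"
      by eventually_elim (use U(3) in auto)
  qed
qed

lemma seed_step_tendsto:
  assumes t: "t < N" and \<theta>: "\<theta> \<in> seeds p \<delta>" and z: "zn \<longlonglongrightarrow> z" and b: "bn \<longlonglongrightarrow> b"
  shows "AE w in \<theta>. (\<lambda>n. seed_step t (zn n) (bn n) w) \<longlonglongrightarrow> seed_step t z b w"
proof -
  have x: "(\<lambda>n. fst (zn n)) \<longlonglongrightarrow> fst z" "(\<lambda>n. fst (snd (zn n))) \<longlonglongrightarrow> fst (snd z)" "(\<lambda>n. snd (snd (zn n))) \<longlonglongrightarrow> snd (snd z)"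
    using z by (auto intro: tendsto_fst tendsto_snd)
  have e: "seed_step t z b w = ((fst z)(Suc t := coord_quantile t (fst z) (fst w)),
     (fst (snd z))(Suc t := coord_quantile t (fst z) (fst w) - snd w), (snd (snd z))(Suc t := b))" for z b w
    by (cases z) (simp add: seed_step_def from_seed_def coord_quantile_def)
  show ?thesis
    using AE_seeds_fst[OF \<theta> coord_quantile_tendsto[OF t x(1)]]
    unfolding e by eventually_elim (intro tendsto_Pair tendsto_fun_upd tendsto_diff tendsto_const x b)
qed

text \<open>
  Here the parametrisation by seeds pays off: the measure is fixed and only the integrand moves
  with the history, so that Fatou's lemma applies.
\<close>

lemma lsc_seed_integral:
  assumes t: "t < N" and V: "lsc (V (Suc t))" and \<theta>: "\<theta> \<in> seeds p \<delta>"
  shows "lsc (\<lambda>(z, b). \<integral>\<^sup>+ w. V (Suc t) (seed_step t z b w) \<partial>\<theta>)"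
proof -
  have "lsc (\<lambda>zb. \<integral>\<^sup>+ w. V (Suc t) (seed_step t (fst zb) (snd zb) w) \<partial>\<theta>)"
  proof (rule lsc_nn_integral[OF V])
    show "seed_step t (fst zb) (snd zb) \<in> borel_measurable \<theta>" for zb
      using measurable_seed_step[OF t] by (simp add: measurable_cong_sets[OF seedsD(1)[OF \<theta>] refl])
    show "AE w in \<theta>. (\<lambda>n. seed_step t (fst (zn n)) (snd (zn n)) w) \<longlonglongrightarrow> seed_step t (fst z) (snd z) w"
      if "zn \<longlonglongrightarrow> z" for zn z
      by (rule seed_step_tendsto[OF t \<theta> tendsto_fst[OF that] tendsto_snd[OF that]])
  qed
  then show ?thesis by (simp add: case_prod_beta')
qed

lemma lsc_G_if: 
  assumes t: "t < N" and V: "lsc (V (Suc t))"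
  shows "lsc (\<lambda>(z, b). G t z b)"
  using lsc_SUP[of "seeds p \<delta>", OF lsc_seed_integral[OF t V]] by (simp add: G_def case_prod_beta')

lemma lsc_V_end: "lsc (V N)"
  unfolding lsc_def
proof
  fix c
  have nn: "0 \<le> f (cut N (fst (snd z)), cut N (snd (snd z))) + C" for z
    using f_bound[of "cut N (fst (snd z))" "cut N (snd (snd z))"] by auto
  show "open {z. c < V N z}"
  proof (cases c)
    case (real r)
    define T where "T = prod_topology (R_top N) (R_top N)"
    define h where "h = (\<lambda>z :: path \<times> path \<times> path. (cut N (fst (snd z)), cut N (snd (snd z))))"
    have "continuous_map euclidean T h"
      unfolding T_def h_def
      by (intro continuous_map_pairedI continuous_map_compose[OF _ continuous_map_cut, unfolded comp_def])
         (auto simp: continuous_map_iff_continuous2 intro!: continuous_on_fst continuous_on_snd continuous_on_id)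
    moreover have "openin T {w \<in> topspace T. r - C < f w}"
      using f_lsc by (simp add: lsc_on_top_def T_def)
    ultimately have "openin euclidean {z \<in> topspace euclidean. h z \<in> {w \<in> topspace T. r - C < f w}}"
      by (rule openin_continuous_map_preimage)
    also have "{z \<in> topspace euclidean. h z \<in> {w \<in> topspace T. r - C < f w}} = {z. c < V N z}"
      using nn real by (auto simp: T_def h_def V.simps[of N] ennreal_less_iff)
    finally show ?thesis by simp
  qed simp
qed

lemma lsc_V: assumes "t \<le> N" shows "lsc (V t)"
  using assms
proof (induction t rule: inc_induct)
  case (step t)
  then have "V t = (\<lambda>z. INF b\<in>K. G t z b)" by (simp add: fun_eq_iff V_step)
  then show ?case
    using lsc_compact_INF[OF lsc_G_if[of t] K] step by simp
qed (rule lsc_V_end)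

lemma lsc_G: "t < N \<Longrightarrow> lsc (\<lambda>(z, b). G t z b)"
  by (rule lsc_G_if) (auto intro: lsc_V)

lemma measurable_V [measurable]: "t \<le> N \<Longrightarrow> V t \<in> borel_measurable borel"
  by (rule lsc_measurable[OF lsc_V])

lemma G_eq_Pi_M:
  assumes t: "t < N"
  shows "G t z b = (SUP \<pi>\<in>Pi_M p \<delta> (k t (cut t (fst z))). \<integral>\<^sup>+ w. V (Suc t) (advance t z b w) \<partial>\<pi>)"
proof -
  have "(\<integral>\<^sup>+ w. V (Suc t) (advance t z b w) \<partial>distr \<theta> borel (from_seed (k t (cut t (fst z)))))
     = (\<integral>\<^sup>+ w. V (Suc t) (seed_step t z b w) \<partial>\<theta>)" if \<theta>: "\<theta> \<in> seeds p \<delta>" for \<theta>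
  proof -
    have "from_seed (k t (cut t (fst z))) \<in> \<theta> \<rightarrow>\<^sub>M borel"
      using measurable_from_seed[OF real_distribution_k_cut[OF t]]
      by (simp add: measurable_cong_sets[OF seedsD(1)[OF \<theta>] refl])
    moreover have "(\<lambda>w. V (Suc t) (advance t z b w)) \<in> borel_measurable borel"
      by (rule measurable_compose[OF measurable_advance measurable_V]) (use t in simp)
    ultimately show ?thesis by (simp add: nn_integral_distr seed_step_def)
  qed
  then show ?thesis
    by (simp add: G_def Pi_M_eq_seeds[OF real_distribution_k_cut[OF t] \<delta> p] image_image)
qed

lemma Pi_M_nonempty: "t < N \<Longrightarrow> Pi_M p \<delta> (k t (cut t x)) \<noteq> {}"
  using seeds_nonempty[OF \<delta> p] by (simp add: Pi_M_eq_seeds[OF real_distribution_k_cut \<delta> p])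

end

section \<open>Integrals of extended real functions bounded below\<close>

text \<open>
  The order isomorphism from \<open>[0, \<infinity>]\<close> to \<open>[- C, \<infinity>]\<close> that undoes the shift of f by C.
\<close>

definition unshift :: "real \<Rightarrow> ennreal \<Rightarrow> ereal" where
  "unshift C v = enn2ereal v - ereal C"

lemma unshift_mono: "v \<le> w \<Longrightarrow> unshift C v \<le> unshift C w"
  unfolding unshift_def by (intro ereal_minus_mono) (simp_all add: less_eq_ennreal.rep_eq)

lemma unshift_ennreal: "0 \<le> r \<Longrightarrow> unshift C (ennreal r) = ereal (r - C)"
  by (simp add: unshift_def enn2ereal_ennreal)

text \<open>
  The adjunction that makes \<open>unshift\<close> commute with suprema and infima over nonempty index sets.
\<close>

lemma unshift_le_iff:
  assumes "0 \<le> C" "ereal (- C) \<le> s"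
  shows "unshift C v \<le> s \<longleftrightarrow> v \<le> e2ennreal (s + ereal C)"
proof -
  have "v \<le> e2ennreal (s + ereal C) \<longleftrightarrow> enn2ereal v \<le> s + ereal C"
    using assms by (subst less_eq_ennreal.rep_eq, subst enn2ereal_e2ennreal) (cases s; simp)+
  also have "\<dots> \<longleftrightarrow> unshift C v \<le> s" unfolding unshift_def by (simp add: ereal_minus_le)
  finally show ?thesis ..
qed

lemma unshift_lower: "ereal (- C) \<le> unshift C v"
  using unshift_mono[of 0 v C] by (simp add: unshift_def zero_ennreal.rep_eq)

lemma unshift_e2ennreal:
  assumes "ereal (- C) \<le> s" shows "unshift C (e2ennreal (s + ereal C)) = s"
  unfolding unshift_def using assms by (subst enn2ereal_e2ennreal) (cases s; simp)+

lemma unshift_SUP: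
  assumes "0 \<le> C" "I \<noteq> {}"
  shows "unshift C (SUP i\<in>I. g i) = (SUP i\<in>I. unshift C (g i))"
proof (rule antisym)
  obtain i where "i \<in> I" using assms by auto
  then have l: "ereal (- C) \<le> (SUP i\<in>I. unshift C (g i))" by (intro SUP_upper2[of i] unshift_lower)
  show "unshift C (SUP i\<in>I. g i) \<le> (SUP i\<in>I. unshift C (g i))"
    unfolding unshift_le_iff[OF assms(1) l]
    by (rule SUP_least, unfold unshift_le_iff[OF assms(1) l, symmetric], rule SUP_upper)
qed (auto intro!: SUP_least unshift_mono intro: SUP_upper)

lemma unshift_INF:
  assumes "0 \<le> C" "I \<noteq> {}"
  shows "unshift C (INF i\<in>I. g i) = (INF i\<in>I. unshift C (g i))"
proof (rule antisym)
  have l: "ereal (- C) \<le> (INF i\<in>I. unshift C (g i))" by (auto intro!: INF_greatest unshift_lower)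
  define s where "s = e2ennreal ((INF i\<in>I. unshift C (g i)) + ereal C)"
  have us: "unshift C s = (INF i\<in>I. unshift C (g i))" unfolding s_def by (rule unshift_e2ennreal[OF l])
  have "s \<le> g i" if "i \<in> I" for i
  proof -
    have "unshift C s \<le> unshift C (g i)" unfolding us using that by (intro INF_lower)
    then have "s \<le> e2ennreal (unshift C (g i) + ereal C)" by (simp add: unshift_le_iff[OF assms(1)] unshift_lower)
    also have "unshift C (g i) + ereal C = enn2ereal (g i)"
      unfolding unshift_def by (cases "g i") (auto simp: enn2ereal_ennreal)
    finally show ?thesis by simp
  qed
  then have "s \<le> (INF i\<in>I. g i)" by (rule INF_greatest)
  then show "(INF i\<in>I. unshift C (g i)) \<le> unshift C (INF i\<in>I. g i)" unfolding us[symmetric] by (rule unshift_mono)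
qed (auto intro!: INF_greatest unshift_mono intro: INF_lower)

text \<open>
  Pointwise, positive part + C = shifted function + negative part; all four terms are nonnegative and
  the integral of the negative part is at most C, so it may be subtracted.
\<close>

lemma ext_integral_unshift:
  assumes "prob_space M" "0 \<le> C" and h[measurable]: "h \<in> borel_measurable M"
    and eq: "\<And>z. z \<in> space M \<Longrightarrow> g z = unshift C (h z)"
  shows "ext_integral M g = unshift C (\<integral>\<^sup>+ z. h z \<partial>M)"
proof -
  interpret prob_space M by fact
  define P where "P z = e2ennreal (unshift C (h z))" for z
  define Q where "Q z = e2ennreal (- unshift C (h z))" for z
  have [measurable]: "P \<in> borel_measurable M" "Q \<in> borel_measurable M"
    unfolding P_def Q_def unshift_def by measurable
  have pt: "P z + ennreal C = h z + Q z" for z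
  proof (cases "h z")
    case (real r)
    then show ?thesis using \<open>0 \<le> C\<close>
      by (cases "C \<le> r") (simp_all add: P_def Q_def unshift_ennreal e2ennreal_neg e2ennreal_ereal ennreal_plus[symmetric] ennreal_neg del: ennreal_plus)
  next
    case top
    then show ?thesis by (simp add: P_def unshift_def)
  qed
  have Qle: "Q z \<le> ennreal C" for z
    using e2ennreal_mono[of "- unshift C (h z)" "ereal C"] unshift_lower[of C "h z"]
    by (simp add: Q_def e2ennreal_ereal ereal_uminus_le_reorder)
  have sum: "(\<integral>\<^sup>+ z. P z \<partial>M) + ennreal C = (\<integral>\<^sup>+ z. h z \<partial>M) + (\<integral>\<^sup>+ z. Q z \<partial>M)"
  proof -
    have "(\<integral>\<^sup>+ z. P z \<partial>M) + ennreal C = (\<integral>\<^sup>+ z. P z + ennreal C \<partial>M)"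
      by (subst nn_integral_add) (auto simp: emeasure_space_1)
    also have "\<dots> = (\<integral>\<^sup>+ z. h z \<partial>M) + (\<integral>\<^sup>+ z. Q z \<partial>M)"
      unfolding pt by (rule nn_integral_add) measurable
    finally show ?thesis .
  qed
  have "(\<integral>\<^sup>+ z. Q z \<partial>M) \<le> (\<integral>\<^sup>+ z. ennreal C \<partial>M)" by (intro nn_integral_mono Qle)
  also have "\<dots> = ennreal C" by (simp add: emeasure_space_1)
  finally obtain q where q: "(\<integral>\<^sup>+ z. Q z \<partial>M) = ennreal q" "0 \<le> q"
    by (cases "(\<integral>\<^sup>+ z. Q z \<partial>M)") (auto simp: top_unique)
  have "ext_integral M g = enn2ereal (\<integral>\<^sup>+ z. P z \<partial>M) - enn2ereal (\<integral>\<^sup>+ z. Q z \<partial>M)"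
    unfolding ext_integral_def P_def Q_def using eq
    by (intro arg_cong2[where f=minus] arg_cong[where f=enn2ereal] nn_integral_cong) auto
  also have "\<dots> = unshift C (\<integral>\<^sup>+ z. h z \<partial>M)"
  proof (cases "\<integral>\<^sup>+ z. P z \<partial>M")
    case (real r)
    then obtain s where s: "(\<integral>\<^sup>+ z. h z \<partial>M) = ennreal s" "0 \<le> s"
      using sum q \<open>0 \<le> C\<close> by (cases "\<integral>\<^sup>+ z. h z \<partial>M") (auto simp: ennreal_plus[symmetric] simp del: ennreal_plus)
    then have "r + C = s + q" using sum real q \<open>0 \<le> C\<close>
      by (simp add: ennreal_plus[symmetric] del: ennreal_plus)
    then show ?thesis using real s q by (simp add: unshift_def enn2ereal_ennreal)
  next
    case top
    then have "(\<integral>\<^sup>+ z. h z \<partial>M) = \<infinity>" using sum q by (cases "\<integral>\<^sup>+ z. h z \<partial>M") (auto simp: ennreal_plus[symmetric] simp del: ennreal_plus)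
    then show ?thesis using top q by (simp add: unshift_def enn2ereal_ennreal)
  qed
  finally show ?thesis .
qed

context martingale_robust_control
begin

lemma dyn_value_eq:
  assumes "t \<le> N" "x \<in> extensional {1..t}" "y \<in> extensional {1..t}" "a \<in> extensional {1..t}"
  shows "dyn_value_M p N k K f \<delta> t x y a = unshift C (V t (x, y, a))"
  using assms
proof (induction t arbitrary: x y a rule: inc_induct)
  case base
  then have "cut N y = y" "cut N a = a" by (auto simp: extensional_restrict)
  with f_bound[OF base(2,3)] show ?case
    by (subst dyn_value_M.simps) (simp add: V_end unshift_ennreal)
next
  case (step t)
  have cut: "cut t x = x" using step.prems by (simp add: extensional_restrict)
  have ext: "s(Suc t := r) \<in> extensional {1..Suc t}" if "s \<in> extensional {1..t}" for s :: path and r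
    using that by (auto simp: extensional_def)
  have int: "ext_integral \<pi> (\<lambda>(u, v). dyn_value_M p N k K f \<delta> (Suc t) (x(Suc t := u)) (y(Suc t := v)) (a(Suc t := b)))
     = unshift C (\<integral>\<^sup>+ w. V (Suc t) (advance t (x, y, a) b w) \<partial>\<pi>)"
    if \<pi>: "\<pi> \<in> Pi_M p \<delta> (k t x)" for \<pi> b
  proof (rule ext_integral_unshift[OF _ C])
    have s: "prob_space \<pi>" "sets \<pi> = sets borel" using \<pi> by (auto simp: Pi_M_def couplings_fst_def space_prob_algebra)
    show "prob_space \<pi>" by fact
    have "(\<lambda>w. V (Suc t) (advance t (x, y, a) b w)) \<in> borel_measurable borel"
      by (rule measurable_compose[OF measurable_advance measurable_V]) (use step in simp)
    then show "(\<lambda>w. V (Suc t) (advance t (x, y, a) b w)) \<in> borel_measurable \<pi>"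
      by (simp add: measurable_cong_sets[OF s(2) refl])
    show "(case z of (u, v) \<Rightarrow> dyn_value_M p N k K f \<delta> (Suc t) (x(Suc t := u)) (y(Suc t := v)) (a(Suc t := b)))
       = unshift C (V (Suc t) (advance t (x, y, a) b z))" for z
      using step.prems by (cases z) (simp, rule step.IH; intro ext step.prems)
  qed
  have ne: "Pi_M p \<delta> (k t x) \<noteq> {}" using Pi_M_nonempty[of t x] step.hyps cut by simp
  have "dyn_value_M p N k K f \<delta> t x y a =
    (INF b\<in>K. SUP \<pi>\<in>Pi_M p \<delta> (k t x). unshift C (\<integral>\<^sup>+ w. V (Suc t) (advance t (x, y, a) b w) \<partial>\<pi>))"
    using step.hyps by (subst dyn_value_M.simps) (simp add: int)
  also have "\<dots> = unshift C (INF b\<in>K. SUP \<pi>\<in>Pi_M p \<delta> (k t x). \<integral>\<^sup>+ w. V (Suc t) (advance t (x, y, a) b w) \<partial>\<pi>)"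
    by (simp add: unshift_SUP[OF C ne] unshift_INF[OF C K(2)])
  also have "\<dots> = unshift C (V t (x, y, a))"
    using step.hyps by (simp add: V_step G_eq_Pi_M cut)
  finally show ?case .
qed

end

section \<open>Laws of pairs of paths\<close>

definition append_pair :: "nat \<Rightarrow> path \<times> path \<Rightarrow> real \<times> real \<Rightarrow> path \<times> path" where
  "append_pair t z w = ((fst z)(Suc t := fst w), (snd z)(Suc t := snd w))"

lemma pair_path_law_Suc:
  "pair_path_law g (Suc t) = pair_path_law g t \<bind> (\<lambda>z. distr (g t z) (RR_borel (Suc t)) (append_pair t z))"
  by (simp add: append_pair_def[abs_def] case_prod_beta')

declare pair_path_law.simps(2) [simp del]

lemma pair_path_law_cong:
  assumes "\<And>s. s < t \<Longrightarrow> g s = g' s" shows "pair_path_law g t = pair_path_law g' t"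
  using assms by (induction t) (simp_all add: pair_path_law_Suc)

lemma measurable_append_pair:
  "(\<lambda>(z, w). append_pair t z w) \<in> RR_borel t \<Otimes>\<^sub>M borel \<rightarrow>\<^sub>M RR_borel (Suc t)"
  unfolding append_pair_def case_prod_beta'
  by (intro measurable_Pair measurable_path_append
      measurable_compose[OF measurable_fst measurable_fst] measurable_compose[OF measurable_fst measurable_snd]
      measurable_compose[OF measurable_snd borel_fst_snd(1)] measurable_compose[OF measurable_snd borel_fst_snd(2)])

lemma measurable_append_pair_at: "z \<in> space (RR_borel t) \<Longrightarrow> append_pair t z \<in> borel \<rightarrow>\<^sub>M RR_borel (Suc t)"
  using measurable_compose[OF measurable_Pair1' measurable_append_pair[of t], of z] by simp

lemma measurable_append_pair_kernel:
  assumes "g t \<in> RR_borel t \<rightarrow>\<^sub>M prob_algebra borel"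
  shows "(\<lambda>z. distr (g t z) (RR_borel (Suc t)) (append_pair t z)) \<in> RR_borel t \<rightarrow>\<^sub>M prob_algebra (RR_borel (Suc t))"
  by (rule measurable_distr_prob_space2[OF assms measurable_append_pair])

definition kernels :: "nat \<Rightarrow> pair_kernel \<Rightarrow> bool" where
  "kernels t g \<longleftrightarrow> (\<forall>s<t. g s \<in> RR_borel s \<rightarrow>\<^sub>M prob_algebra borel)"

lemma pair_path_law_prob:
  "kernels t g \<Longrightarrow> pair_path_law g t \<in> space (prob_algebra (RR_borel t))"
proof (induction t)
  case 0
  have "(empty_path, empty_path) \<in> space (RR_borel 0)" unfolding space_RR_borel by simp
  from prob_space_return[OF this] show ?case by (simp add: space_prob_algebra)
next
  case (Suc t)
  then have g: "g t \<in> RR_borel t \<rightarrow>\<^sub>M prob_algebra borel" and IH: "pair_path_law g t \<in> space (prob_algebra (RR_borel t))"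
    by (auto simp: kernels_def)
  show ?case
    using prob_space_bind'[OF IH measurable_append_pair_kernel[where g=g, OF g]]
      sets_bind'[OF IH measurable_append_pair_kernel[where g=g, OF g]]
    by (simp add: space_prob_algebra pair_path_law_Suc)
qed

lemma
  assumes "kernels t g"
  shows sets_pair_path_law: "sets (pair_path_law g t) = sets (RR_borel t)"
    and space_pair_path_law: "space (pair_path_law g t) = space (RR_borel t)"
    and prob_space_pair_path_law: "prob_space (pair_path_law g t)"
  using pair_path_law_prob[OF assms] sets_eq_imp_space_eq[of "pair_path_law g t" "RR_borel t"]
  by (simp_all add: space_prob_algebra)

lemma kernels_Suc: "kernels (Suc t) g \<longleftrightarrow> kernels t g \<and> g t \<in> RR_borel t \<rightarrow>\<^sub>M prob_algebra borel"
  by (auto simp: kernels_def less_Suc_eq)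

lemma sets_kernel_at:
  assumes "g \<in> RR_borel t \<rightarrow>\<^sub>M prob_algebra borel" "z \<in> space (RR_borel t)"
  shows "sets (g z) = sets borel" "prob_space (g z)" "space (g z) = UNIV"
  using measurable_space[OF assms] sets_eq_imp_space_eq[of "g z" borel] by (auto simp: space_prob_algebra)

lemma measurable_append_pair_kernel_at:
  assumes "g \<in> RR_borel t \<rightarrow>\<^sub>M prob_algebra borel" "z \<in> space (RR_borel t)"
  shows "append_pair t z \<in> g z \<rightarrow>\<^sub>M RR_borel (Suc t)"
  using measurable_append_pair_at[OF assms(2)] by (simp add: measurable_cong_sets[OF sets_kernel_at(1)[OF assms] refl])

lemma nn_integral_pair_path_law_Suc:
  assumes g: "kernels (Suc t) g" and h: "h \<in> borel_measurable (RR_borel (Suc t))"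
  shows "(\<integral>\<^sup>+ z. h z \<partial>pair_path_law g (Suc t)) = (\<integral>\<^sup>+ z. \<integral>\<^sup>+ w. h (append_pair t z w) \<partial>g t z \<partial>pair_path_law g t)"
proof -
  have g': "kernels t g" "g t \<in> RR_borel t \<rightarrow>\<^sub>M prob_algebra borel" using g by (auto simp: kernels_Suc)
  have m: "(\<lambda>z. distr (g t z) (RR_borel (Suc t)) (append_pair t z)) \<in> pair_path_law g t \<rightarrow>\<^sub>M subprob_algebra (RR_borel (Suc t))"
    using measurable_prob_algebraD[OF measurable_append_pair_kernel[where g=g, OF g'(2)]]
    by (simp add: measurable_cong_sets[OF sets_pair_path_law[OF g'(1)] refl])
  show ?thesis
    unfolding pair_path_law_Suc
    by (subst nn_integral_bind[OF h m])
       (auto intro!: nn_integral_cong nn_integral_distr measurable_append_pair_kernel_at[OF g'(2)] h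
         simp: space_pair_path_law[OF g'(1)])
qed

lemma AE_pair_path_law_Suc:
  assumes g: "kernels (Suc t) g" and P: "Measurable.pred (RR_borel (Suc t)) P"
    and ae: "AE z in pair_path_law g t. AE w in g t z. P (append_pair t z w)"
  shows "AE z in pair_path_law g (Suc t). P z"
proof -
  have g': "kernels t g" "g t \<in> RR_borel t \<rightarrow>\<^sub>M prob_algebra borel" using g by (auto simp: kernels_Suc)
  have m: "(\<lambda>z. distr (g t z) (RR_borel (Suc t)) (append_pair t z)) \<in> pair_path_law g t \<rightarrow>\<^sub>M subprob_algebra (RR_borel (Suc t))"
    using measurable_prob_algebraD[OF measurable_append_pair_kernel[where g=g, OF g'(2)]]
    by (simp add: measurable_cong_sets[OF sets_pair_path_law[OF g'(1)] refl])
  have P': "{x \<in> space (RR_borel (Suc t)). P x} \<in> sets (RR_borel (Suc t))" using P by simp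
  have "AE z in pair_path_law g t. z \<in> space (RR_borel t)"
    using AE_space[of "pair_path_law g t"] by (simp add: space_pair_path_law[OF g'(1)])
  with ae have "AE z in pair_path_law g t. AE z in distr (g t z) (RR_borel (Suc t)) (append_pair t z). P z"
    by eventually_elim (simp only: AE_distr_iff[OF measurable_append_pair_kernel_at[OF g'(2)] P'])
  then show ?thesis unfolding pair_path_law_Suc by (simp only: AE_bind[OF m P])
qed

text \<open>
  The projection is a parameter so that one induction covers both marginals.
\<close>

lemma distr_pair_path_law:
  fixes pr :: "path \<times> path \<Rightarrow> path" and pr' :: "real \<times> real \<Rightarrow> real"
  assumes g: "kernels t g"
    and m: "\<And>s. s < t \<Longrightarrow> m s \<in> R_borel s \<rightarrow>\<^sub>M prob_algebra borel"
    and pr: "\<And>s. pr \<in> RR_borel s \<rightarrow>\<^sub>M R_borel s" and pr': "pr' \<in> borel_measurable borel"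
    and upd: "\<And>s z w. pr (append_pair s z w) = (pr z)(Suc s := pr' w)"
    and marg: "\<And>s. s < t \<Longrightarrow> AE z in pair_path_law g s. distr (g s z) borel pr' = m s (pr z)"
  shows "distr (pair_path_law g t) (R_borel t) pr = path_law m t"
  using g m marg
proof (induction t)
  case 0
  have "pr (empty_path, empty_path) = empty_path"
    using measurable_space[OF pr[of 0], of "(empty_path, empty_path)"]
    by (simp add: space_pair_measure space_PiM_empty)
  then show ?case using distr_return[OF pr[of 0], of "(empty_path, empty_path)"]
    by (simp add: space_pair_measure space_PiM_empty)
next
  case (Suc t)
  have g: "kernels t g" "g t \<in> RR_borel t \<rightarrow>\<^sub>M prob_algebra borel" using Suc.prems(1) by (auto simp: kernels_Suc)
  note sp = sets_pair_path_law[OF g(1)] space_pair_path_law[OF g(1)]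
  interpret prob_space "pair_path_law g t" by (rule prob_space_pair_path_law[OF g(1)])
  have prm: "pr \<in> pair_path_law g t \<rightarrow>\<^sub>M R_borel t"
    using pr by (simp add: measurable_cong_sets[OF sp(1) refl])
  have N: "(\<lambda>z. distr (g t z) (RR_borel (Suc t)) (append_pair t z)) \<in> pair_path_law g t \<rightarrow>\<^sub>M subprob_algebra (RR_borel (Suc t))"
    using measurable_prob_algebraD[OF measurable_append_pair_kernel[where g=g, OF g(2)]]
    by (simp add: measurable_cong_sets[OF sp(1) refl])
  have app: "(\<lambda>(x, u). x(Suc t := u)) \<in> R_borel t \<Otimes>\<^sub>M borel \<rightarrow>\<^sub>M R_borel (Suc t)"
    unfolding case_prod_beta' by (intro measurable_path_append) measurable
  have app': "(\<lambda>u. x(Suc t := u)) \<in> borel \<rightarrow>\<^sub>M R_borel (Suc t)" if "x \<in> space (R_borel t)" for x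
    using measurable_compose[OF measurable_Pair1'[OF that] app] by simp
  have M: "(\<lambda>x. distr (m t x) (R_borel (Suc t)) (\<lambda>u. x(Suc t := u))) \<in> R_borel t \<rightarrow>\<^sub>M subprob_algebra (R_borel (Suc t))"
    by (rule measurable_prob_algebraD[OF measurable_distr_prob_space2[OF Suc.prems(2) app]]) simp
  have "distr (pair_path_law g (Suc t)) (R_borel (Suc t)) pr
    = pair_path_law g t \<bind> (\<lambda>z. distr (distr (g t z) (RR_borel (Suc t)) (append_pair t z)) (R_borel (Suc t)) pr)"
    unfolding pair_path_law_Suc by (rule distr_bind[OF N not_empty pr])
  also have "\<dots> = pair_path_law g t \<bind> (\<lambda>z. distr (m t (pr z)) (R_borel (Suc t)) (\<lambda>u. (pr z)(Suc t := u)))"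
  proof (rule bind_cong_AE[OF refl])
    show "(\<lambda>z. distr (distr (g t z) (RR_borel (Suc t)) (append_pair t z)) (R_borel (Suc t)) pr)
      \<in> pair_path_law g t \<rightarrow>\<^sub>M subprob_algebra (R_borel (Suc t))"
      by (rule measurable_compose[OF N measurable_distr[OF pr]])
    show "(\<lambda>z. distr (m t (pr z)) (R_borel (Suc t)) (\<lambda>u. (pr z)(Suc t := u)))
      \<in> pair_path_law g t \<rightarrow>\<^sub>M subprob_algebra (R_borel (Suc t))"
      by (rule measurable_compose[OF prm M])
    have "AE z in pair_path_law g t. distr (g t z) borel pr' = m t (pr z)" by (rule Suc.prems(3)) simp
    then show "AE z in pair_path_law g t. distr (distr (g t z) (RR_borel (Suc t)) (append_pair t z)) (R_borel (Suc t)) pr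
       = distr (m t (pr z)) (R_borel (Suc t)) (\<lambda>u. (pr z)(Suc t := u))"
      using AE_space
    proof eventually_elim
      case (elim z)
      then have z: "z \<in> space (RR_borel t)" by (simp add: sp)
      have pz: "pr z \<in> space (R_borel t)" by (rule measurable_space[OF pr z])
      have p'': "pr' \<in> g t z \<rightarrow>\<^sub>M borel"
        using pr' by (simp add: measurable_cong_sets[OF sets_kernel_at(1)[OF g(2) z] refl])
      have "distr (distr (g t z) (RR_borel (Suc t)) (append_pair t z)) (R_borel (Suc t)) pr
         = distr (g t z) (R_borel (Suc t)) (\<lambda>w. (pr z)(Suc t := pr' w))"
        by (simp add: distr_distr[OF pr measurable_append_pair_kernel_at[OF g(2) z]] comp_def upd)
      also have "\<dots> = distr (distr (g t z) borel pr') (R_borel (Suc t)) (\<lambda>u. (pr z)(Suc t := u))"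
        by (simp add: distr_distr[OF app'[OF pz] p''] comp_def)
      finally show ?case using elim by simp
    qed
  qed
  also have "\<dots> = distr (pair_path_law g t) (R_borel t) pr \<bind> (\<lambda>x. distr (m t x) (R_borel (Suc t)) (\<lambda>u. x(Suc t := u)))"
    by (rule bind_distr[OF prm M not_empty, symmetric])
  also have "distr (pair_path_law g t) (R_borel t) pr = path_law m t"
    using Suc.prems by (intro Suc.IH g(1)) auto
  finally show ?case unfolding path_law.simps .
qed

section \<open>Decodable couplings are bicausal\<close>

text \<open>
  \<open>\<psi> t (x, y) v\<close> recovers the coordinate t + 1 of the x-path from the histories x, y of length t and the
  coordinate v = y(t + 1). Iterating this recovers the x-path from the y-path alone.
\<close>

primrec decode :: "(nat \<Rightarrow> path \<times> path \<Rightarrow> real \<Rightarrow> real) \<Rightarrow> nat \<Rightarrow> path \<Rightarrow> path" where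
  "decode \<psi> 0 y = empty_path"
| "decode \<psi> (Suc t) y = (decode \<psi> t y)(Suc t := \<psi> t (decode \<psi> t y, cut t y) (y (Suc t)))"

lemma decode_cong:
  assumes "\<And>i. i \<in> {1..t} \<Longrightarrow> y i = y' i" shows "decode \<psi> t y = decode \<psi> t y'"
  using assms
proof (induction t)
  case (Suc t)
  then have "cut t y = cut t y'" by (auto simp: restrict_def fun_eq_iff)
  moreover have "decode \<psi> t y = decode \<psi> t y'" using Suc by auto
  ultimately show ?case using Suc.prems[of "Suc t"] by simp
qed simp

lemma decode_extensional: "decode \<psi> t y \<in> extensional {1..t}"
  by (induction t) (auto simp: extensional_def)

lemma cut_decode: "t \<le> n \<Longrightarrow> cut t (decode \<psi> n y) = decode \<psi> t y"
proof (induction n rule: dec_induct)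
  case base
  show ?case by (rule extensional_restrict[OF decode_extensional])
next
  case (step n)
  have "cut t (decode \<psi> (Suc n) y) = cut t (decode \<psi> n y)"
    using step.hyps by (auto simp: restrict_def fun_eq_iff)
  then show ?case using step.IH by (rule trans)
qed

lemma measurable_decode:
  assumes "\<And>s. s < t \<Longrightarrow> (\<lambda>(z, v). \<psi> s z v) \<in> borel_measurable (RR_borel s \<Otimes>\<^sub>M borel)" and "t \<le> n"
  shows "decode \<psi> t \<in> R_borel n \<rightarrow>\<^sub>M R_borel t"
  using assms
proof (induction t)
  case 0
  show ?case by (simp add: space_R_borel measurable_const)
next
  case (Suc t)
  then have IH: "decode \<psi> t \<in> R_borel n \<rightarrow>\<^sub>M R_borel t" by auto
  have cut: "cut t \<in> R_borel n \<rightarrow>\<^sub>M R_borel t"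
    using measurable_compose[OF measurable_path_embed measurable_cut] .
  have "(\<lambda>y. y (Suc t)) \<in> borel_measurable (R_borel n)"
    using Suc.prems by (intro measurable_component_singleton) auto
  then have "(\<lambda>y. ((decode \<psi> t y, cut t y), y (Suc t))) \<in> R_borel n \<rightarrow>\<^sub>M RR_borel t \<Otimes>\<^sub>M borel"
    using IH cut by (intro measurable_Pair)
  from measurable_compose[OF this Suc.prems(1)[of t]]
  have "(\<lambda>y. \<psi> t (decode \<psi> t y, cut t y) (y (Suc t))) \<in> borel_measurable (R_borel n)" by simp
  note m = this
  have eq: "decode \<psi> (Suc t) = (\<lambda>y. (decode \<psi> t y)(Suc t := \<psi> t (decode \<psi> t y, cut t y) (y (Suc t))))"
    by (rule ext) simp
  show ?case unfolding eq by (rule measurable_path_append[OF IH m])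
qed

lemma AE_decode:
  assumes g: "kernels t g"
    and \<psi>: "\<And>s. s < t \<Longrightarrow> (\<lambda>(z, v). \<psi> s z v) \<in> borel_measurable (RR_borel s \<Otimes>\<^sub>M borel)"
    and dec: "\<And>s z. s < t \<Longrightarrow> z \<in> space (RR_borel s) \<Longrightarrow> AE w in g s z. fst w = \<psi> s z (snd w)"
  shows "AE z in pair_path_law g t. fst z = decode \<psi> t (snd z)"
  using assms
proof (induction t)
  case 0
  interpret prob_space "pair_path_law g 0" by (rule prob_space_pair_path_law[OF 0(1)])
  show ?case
    using AE_space[of "pair_path_law g 0"]
    by eventually_elim (auto simp: space_pair_measure space_PiM_empty)
next
  case (Suc t)
  have g: "kernels t g" using Suc.prems(1) by (simp add: kernels_Suc)
  have IH: "AE z in pair_path_law g t. fst z = decode \<psi> t (snd z)" by (rule Suc.IH) (use g Suc.prems in auto)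
  show ?case
  proof (rule AE_pair_path_law_Suc[OF Suc.prems(1)])
    have m: "(\<lambda>z. decode \<psi> (Suc t) (snd z)) \<in> RR_borel (Suc t) \<rightarrow>\<^sub>M R_borel (Suc t)"
      using Suc.prems(2) by (intro measurable_compose[OF measurable_snd measurable_decode]) auto
    have coord: "(\<lambda>z. z i) \<in> borel_measurable (R_borel (Suc t))" if "i \<in> {1..Suc t}" for i
      using that by (rule measurable_component_singleton)
    have "Measurable.pred (RR_borel (Suc t)) (\<lambda>z. \<forall>i\<in>{1..Suc t}. fst z i = decode \<psi> (Suc t) (snd z) i)"
    proof (rule pred_intros_finite)
      fix i assume i: "i \<in> {1..Suc t}"
      show "Measurable.pred (RR_borel (Suc t)) (\<lambda>z. fst z i = decode \<psi> (Suc t) (snd z) i)"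
        using measurable_compose[OF measurable_fst coord[OF i]] measurable_compose[OF m coord[OF i]]
        by measurable
    qed simp
    moreover have "(\<forall>i\<in>{1..Suc t}. fst z i = decode \<psi> (Suc t) (snd z) i) \<longleftrightarrow> fst z = decode \<psi> (Suc t) (snd z)"
      if "z \<in> space (RR_borel (Suc t))" for z
      using that decode_extensional[of \<psi> "Suc t" "snd z"]
      by (auto simp: space_RR_borel simp del: decode.simps intro: extensionalityI)
    ultimately show "Measurable.pred (RR_borel (Suc t)) (\<lambda>z. fst z = decode \<psi> (Suc t) (snd z))"
      by (rule measurable_cong[THEN iffD1, rotated])
    show "AE z in pair_path_law g t. AE w in g t z. fst (append_pair t z w) = decode \<psi> (Suc t) (snd (append_pair t z w))"
      using IH AE_space
    proof eventually_elim
      case (elim z)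
      then have z: "z \<in> space (RR_borel t)" by (simp add: space_pair_path_law[OF g])
      then have cut: "cut t (snd z) = snd z" by (auto simp: space_RR_borel extensional_restrict)
      have "AE w in g t z. fst w = \<psi> t z (snd w)" by (rule Suc.prems(3)) (use z in auto)
      then show ?case
      proof eventually_elim
        case w: (elim w)
        have "decode \<psi> t ((snd z)(Suc t := snd w)) = decode \<psi> t (snd z)" by (rule decode_cong) auto
        moreover have "cut t ((snd z)(Suc t := snd w)) = snd z"
          by (subst (2) cut[symmetric]) (auto simp: restrict_def fun_eq_iff)
        moreover have "z = (decode \<psi> t (snd z), snd z)" using elim(1) by (simp add: prod_eq_iff)
        ultimately show ?case using w elim(1) by (simp add: append_pair_def)
      qed
    qed
  qed
qed

text \<open>
  If the y-path determines the x-path, the conditional law of the next pair given both histories is a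
  function of the y-history. Its second marginal is then the kernel of the y-marginal.
\<close>

lemma bicausal_if_decodable:
  assumes g: "kernels N g"
    and k: "\<And>t. t < N \<Longrightarrow> k t \<in> R_borel t \<rightarrow>\<^sub>M prob_algebra borel"
    and marg: "\<And>t z. t < N \<Longrightarrow> z \<in> space (RR_borel t) \<Longrightarrow> distr (g t z) borel fst = k t (fst z)"
    and \<psi>: "\<And>t. t < N \<Longrightarrow> (\<lambda>(z, v). \<psi> t z v) \<in> borel_measurable (RR_borel t \<Otimes>\<^sub>M borel)"
    and dec: "\<And>t z. t < N \<Longrightarrow> z \<in> space (RR_borel t) \<Longrightarrow> AE w in g t z. fst w = \<psi> t z (snd w)"
  shows "bicausal N (pair_path_law g N)"
proof -
  define n where "n t y = distr (g t (decode \<psi> t y, y)) borel snd" for t y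
  have gm: "g t \<in> RR_borel t \<rightarrow>\<^sub>M prob_algebra borel" if "t < N" for t
    using g that by (simp add: kernels_def)
  have kern: "kernels t g" if "t \<le> N" for t using g that by (auto simp: kernels_def)
  have n: "n t \<in> R_borel t \<rightarrow>\<^sub>M prob_algebra borel" if t: "t < N" for t
  proof -
    have "decode \<psi> t \<in> R_borel t \<rightarrow>\<^sub>M R_borel t" using t by (intro measurable_decode \<psi>) auto
    then have "(\<lambda>y. (decode \<psi> t y, y)) \<in> R_borel t \<rightarrow>\<^sub>M RR_borel t" by simp
    from measurable_compose[OF this gm[OF t]] show ?thesis
      unfolding n_def by (rule measurable_distr_prob_space2) measurable
  qed
  have space_AE: "AE z in pair_path_law g t. z \<in> space (RR_borel t)" if "t \<le> N" for t
    using AE_space[of "pair_path_law g t"] by (simp add: space_pair_path_law[OF kern[OF that]])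
  have dec_AE: "AE z in pair_path_law g t. fst z = decode \<psi> t (snd z)" if "t \<le> N" for t
    using that by (intro AE_decode kern \<psi> dec) auto
  have 1: "distr (pair_path_law g N) (R_borel N) fst = path_law k N"
  proof (rule distr_pair_path_law[where pr'=fst, OF g k])
    show "AE z in pair_path_law g s. distr (g s z) borel fst = k s (fst z)" if "s < N" for s
      using space_AE[of s] that by (auto elim!: eventually_mono intro: marg)
  qed (auto simp: append_pair_def)
  have 2: "distr (pair_path_law g N) (R_borel N) snd = path_law n N"
  proof (rule distr_pair_path_law[where pr'=snd, OF g n])
    show "AE z in pair_path_law g s. distr (g s z) borel snd = n s (snd z)" if "s < N" for s
      using dec_AE[of s] that by (auto elim!: eventually_mono simp: n_def)
  qed (auto simp: append_pair_def)
  have "AE (x, y) in pair_path_law g N. g t (cut t x, cut t y) \<in> couplings (k t (cut t x)) (n t (cut t y))" if t: "t < N" for t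
    using dec_AE[OF order.refl]
  proof eventually_elim
    case (elim z)
    obtain x y where xy: "z = (x, y)" by (cases z)
    have "cut t x = decode \<psi> t y" using elim xy t by (simp add: cut_decode)
    moreover have "decode \<psi> t y = decode \<psi> t (cut t y)" by (rule decode_cong) auto
    moreover have z: "(cut t x, cut t y) \<in> space (RR_borel t)" by (simp add: space_RR_borel)
    ultimately show ?case
      using measurable_space[OF gm[OF t] z] marg[OF t z] by (simp add: xy couplings_def n_def)
  qed
  then show ?thesis
    unfolding bicausal_def pair_disintegration_def disintegration_def
    using 1 2 gm k n by (intro exI[of _ g] exI[of _ k] exI[of _ n]) auto
qed

section \<open>An optimal control\<close>

context martingale_robust_control
begin

lemma V_extend_measurable:
  assumes "t \<le> N" "A \<in> RR_borel t \<rightarrow>\<^sub>M R_borel s"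
  shows "(\<lambda>z. V t (fst z, snd z, A z)) \<in> borel_measurable (RR_borel t)"
proof (rule measurable_compose[OF _ measurable_V[OF assms(1)]])
  show "(\<lambda>z. (fst z, snd z, A z)) \<in> borel_measurable (RR_borel t)"
    by (intro borel_measurable_Pair measurable_compose[OF measurable_fst measurable_path_embed]
       measurable_compose[OF measurable_snd measurable_path_embed] measurable_compose[OF assms(2) measurable_path_embed])
qed

text \<open>
  The control acts by the Borel minimisers of \<open>G t\<close>. Each kernel of the adversary is admissible in the
  supremum defining \<open>G t\<close>, so that replacing \<open>V t\<close> by the integral of \<open>V (Suc t)\<close> cannot increase the value.
\<close>

lemma upper_bound:
  "\<exists>\<alpha>\<in>controls N K. \<forall>\<gamma>\<in>Pi_M_path p N \<delta> k.
     (\<integral>\<^sup>+ z. ennreal (f (snd z, \<alpha> z) + C) \<partial>\<gamma>) \<le> V 0 (empty_path, empty_path, empty_path)"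
proof -
  have "\<forall>t. \<exists>s. t < N \<longrightarrow> s \<in> borel_measurable borel \<and> (\<forall>z. s z \<in> K \<and> G t z (s z) = V t z)"
    using lsc_measurable_argmin[OF lsc_G K] by (metis V_step)
  then obtain sel where sel: "\<And>t. t < N \<Longrightarrow> sel t \<in> borel_measurable borel"
    "\<And>t z. t < N \<Longrightarrow> sel t z \<in> K" "\<And>t z. t < N \<Longrightarrow> G t z (sel t z) = V t z" by metis
  define act :: "nat \<Rightarrow> path \<times> path \<Rightarrow> path" where
    "act = rec_nat (\<lambda>_. empty_path) (\<lambda>t a z. (a z)(Suc t := sel t (cut t (fst z), cut t (snd z), a z)))"
  have act0: "act 0 z = empty_path" for z by (simp add: act_def)
  have actS: "act (Suc t) z = (act t z)(Suc t := sel t (cut t (fst z), cut t (snd z), act t z))" for t z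
    by (simp add: act_def)
  have act_cong: "act t z = act t z'"
    if "\<And>i. i \<in> {1..t - 1} \<Longrightarrow> fst z i = fst z' i \<and> snd z i = snd z' i" for t z z'
    using that
  proof (induction t)
    case (Suc t)
    have "cut t (fst z) = cut t (fst z')" "cut t (snd z) = cut t (snd z')"
      using Suc.prems by (auto simp: restrict_def fun_eq_iff)
    moreover have "act t z = act t z'" using Suc.prems by (intro Suc.IH) auto
    ultimately show ?case by (simp add: actS)
  qed (simp add: act0)
  have act_stable: "act n z i = act i z i" if "1 \<le> i" "i \<le> n" for n z i
    using that(2,1) by (induction n rule: dec_induct) (auto simp: actS)
  have act_K: "act t z \<in> {1..t} \<rightarrow>\<^sub>E K" if "t \<le> N" for t z
    using that by (induction t) (auto simp: act0 actS PiE_def extensional_def Pi_def le_Suc_eq sel(2))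
  have act_meas: "act t \<in> RR_borel n \<rightarrow>\<^sub>M R_borel t" if "t \<le> N" for t n
    using that
  proof (induction t)
    case 0
    show ?case by (simp add: act0[abs_def] measurable_const space_R_borel cong: measurable_cong)
  next
    case (Suc t)
    then have IH: "act t \<in> RR_borel n \<rightarrow>\<^sub>M R_borel t" by simp
    have cut: "cut t \<in> R_borel n \<rightarrow>\<^sub>M (borel :: path measure)"
      using measurable_compose[OF measurable_compose[OF measurable_path_embed measurable_cut] measurable_path_embed] .
    have "(\<lambda>z. (cut t (fst z), cut t (snd z), act t z)) \<in> borel_measurable (RR_borel n)"
      by (intro borel_measurable_Pair measurable_compose[OF measurable_fst cut]
        measurable_compose[OF measurable_snd cut] measurable_compose[OF IH measurable_path_embed])
    note m = measurable_compose[OF this sel(1)]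
    have eq: "act (Suc t) = (\<lambda>z. (act t z)(Suc t := sel t (cut t (fst z), cut t (snd z), act t z)))"
      by (rule ext) (rule actS)
    show ?case unfolding eq using Suc.prems by (intro measurable_path_append IH m) simp
  qed
  have \<alpha>: "act N \<in> controls N K"
    unfolding controls_def
  proof (intro CollectI conjI ballI act_meas act_K order.refl, clarify)
    fix t x y x' y' assume t: "t \<in> {1..N}"
      and eq: "cut (t - 1) x = cut (t - 1) x'" "cut (t - 1) y = cut (t - 1) y'"
    have "act t (x, y) = act t (x', y')"
      by (rule act_cong) (use eq in \<open>auto simp: restrict_def fun_eq_iff split: if_splits\<close>)
    then show "act N (x, y) t = act N (x', y') t" using t act_stable[of t N] by auto
  qed
  show ?thesis
  proof (intro bexI[OF _ \<alpha>] ballI)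
    fix \<gamma> assume "\<gamma> \<in> Pi_M_path p N \<delta> k"
    then obtain g where \<gamma>: "\<gamma> = pair_path_law g N" and g: "kernels N g"
      and gPi: "\<And>t x y. t < N \<Longrightarrow> (x, y) \<in> space (RR_borel t) \<Longrightarrow> g t (x, y) \<in> Pi_M p \<delta> (k t x)"
      unfolding Pi_M_path_def pair_disintegration_def kernels_def by blast
    have kern: "kernels t g" if "t \<le> N" for t using g that by (auto simp: kernels_def)
    have meas: "(\<lambda>z. V t (fst z, snd z, act t z)) \<in> borel_measurable (RR_borel t)" if "t \<le> N" for t
      by (rule V_extend_measurable[OF that act_meas[OF that]])
    have "(\<integral>\<^sup>+ z. V t (fst z, snd z, act t z) \<partial>pair_path_law g t) \<le> V 0 (empty_path, empty_path, empty_path)" if "t \<le> N" for t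
      using that
    proof (induction t)
      case 0
      show ?case using nn_integral_return[OF _ meas[of 0], of "(empty_path, empty_path)"]
        by (simp add: space_pair_measure space_PiM_empty act0)
    next
      case (Suc t)
      then have t: "t < N" by simp
      have "(\<integral>\<^sup>+ z. V (Suc t) (fst z, snd z, act (Suc t) z) \<partial>pair_path_law g (Suc t))
        = (\<integral>\<^sup>+ z. \<integral>\<^sup>+ w. V (Suc t) (fst (append_pair t z w), snd (append_pair t z w), act (Suc t) (append_pair t z w)) \<partial>g t z \<partial>pair_path_law g t)"
        by (rule nn_integral_pair_path_law_Suc[OF kern meas]) (use Suc.prems in auto)
      also have "\<dots> \<le> (\<integral>\<^sup>+ z. V t (fst z, snd z, act t z) \<partial>pair_path_law g t)"
      proof (rule nn_integral_mono)
        fix z assume "z \<in> space (pair_path_law g t)"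
        then have z: "z \<in> space (RR_borel t)" using t by (simp add: space_pair_path_law[OF kern])
        then have cut: "cut t (fst z) = fst z" "cut t (snd z) = snd z"
          by (auto simp: space_RR_borel extensional_restrict)
        define b where "b = sel t (fst z, snd z, act t z)"
        have actA: "act (Suc t) (append_pair t z w) = (act t z)(Suc t := b)" for w
        proof -
          have "act (Suc t) (append_pair t z w) = act (Suc t) z" by (rule act_cong) (auto simp: append_pair_def)
          then show ?thesis by (simp add: actS b_def cut)
        qed
        have adv: "(fst (append_pair t z w), snd (append_pair t z w), act (Suc t) (append_pair t z w))
          = advance t (fst z, snd z, act t z) b w" for w
          unfolding actA by (cases w) (simp add: append_pair_def)
        have "(\<integral>\<^sup>+ w. V (Suc t) (advance t (fst z, snd z, act t z) b w) \<partial>g t z) \<le> G t (fst z, snd z, act t z) b"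
          unfolding G_eq_Pi_M[OF t] using gPi[OF t, of "fst z" "snd z"] z by (intro SUP_upper) (simp add: cut)
        also have "\<dots> = V t (fst z, snd z, act t z)" unfolding b_def by (rule sel(3)[OF t])
        finally show "(\<integral>\<^sup>+ w. V (Suc t) (fst (append_pair t z w), snd (append_pair t z w), act (Suc t) (append_pair t z w)) \<partial>g t z)
           \<le> V t (fst z, snd z, act t z)" unfolding adv .
      qed
      also have "\<dots> \<le> V 0 (empty_path, empty_path, empty_path)" using Suc by simp
      finally show ?case .
    qed
    from this[of N] have "(\<integral>\<^sup>+ z. V N (fst z, snd z, act N z) \<partial>\<gamma>) \<le> V 0 (empty_path, empty_path, empty_path)"
      by (simp add: \<gamma>)
    moreover have "(\<integral>\<^sup>+ z. V N (fst z, snd z, act N z) \<partial>\<gamma>) = (\<integral>\<^sup>+ z. ennreal (f (snd z, act N z) + C) \<partial>\<gamma>)"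
    proof (rule nn_integral_cong)
      fix z assume "z \<in> space \<gamma>"
      then have "z \<in> space (RR_borel N)" by (simp add: \<gamma> space_pair_path_law[OF g])
      then have "cut N (snd z) = snd z" by (auto simp: space_RR_borel extensional_restrict)
      moreover have "cut N (act N z) = act N z"
        using act_K[OF order.refl, of z] by (auto simp: PiE_def extensional_restrict)
      ultimately show "V N (fst z, snd z, act N z) = ennreal (f (snd z, act N z) + C)" by (simp add: V_end)
    qed
    ultimately show "(\<integral>\<^sup>+ z. ennreal (f (snd z, act N z) + C) \<partial>\<gamma>) \<le> V 0 (empty_path, empty_path, empty_path)" by simp
  qed
qed

end

section \<open>Writing the first coordinate into the second\<close>

text \<open>
  The second coordinate is rounded down to a multiple of 1 / m and the first coordinate, squeezed
  into (0, 1), fills the gap up to the next grid point.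
\<close>

definition encode :: "nat \<Rightarrow> real \<times> real \<Rightarrow> real" where
  "encode m z = (of_int \<lfloor>real m * snd z\<rfloor> + (1 / 2 + arctan (fst z) / pi)) / real m"

lemma arctan_unit: "0 < 1 / 2 + arctan x / pi" "1 / 2 + arctan x / pi < 1"
proof -
  define a where "a = arctan x / pi"
  have "- (1 / 2) < a" using arctan_lbound[of x] by (simp add: a_def field_simps)
  then show "0 < 1 / 2 + arctan x / pi" unfolding a_def[symmetric] by simp
  have "a < 1 / 2" using arctan_ubound[of x] by (simp add: a_def field_simps)
  then show "1 / 2 + arctan x / pi < 1" unfolding a_def[symmetric] by simp
qed

lemma measurable_arctan: "(arctan :: real \<Rightarrow> real) \<in> borel_measurable borel"
  by (intro borel_measurable_continuous_onI continuous_on_arctan continuous_on_id)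

lemma measurable_tan: "(tan :: real \<Rightarrow> real) \<in> borel_measurable borel"
  unfolding tan_def by measurable

lemma measurable_frac: "(frac :: real \<Rightarrow> real) \<in> borel_measurable borel"
  unfolding frac_def[abs_def] by measurable

lemma encode_close:
  assumes "0 < m" shows "\<bar>encode m z - snd z\<bar> \<le> 1 / real m"
proof -
  define h where "h = 1 / 2 + arctan (fst z) / pi"
  have h: "0 < h" "h < 1" unfolding h_def by (rule arctan_unit)+
  have "encode m z - snd z = (of_int \<lfloor>real m * snd z\<rfloor> + h - real m * snd z) / real m"
    using assms by (simp add: encode_def h_def field_simps)
  moreover have "\<bar>of_int \<lfloor>real m * snd z\<rfloor> + h - real m * snd z\<bar> \<le> 1"
    using h of_int_floor_le[of "real m * snd z"] real_of_int_floor_add_one_gt[of "real m * snd z"]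
    by linarith
  ultimately show ?thesis using assms by (simp add: abs_divide divide_right_mono)
qed

lemma encode_inverse:
  assumes "0 < m" shows "tan (pi * (frac (real m * encode m z) - 1 / 2)) = fst z"
proof -
  define h where "h = 1 / 2 + arctan (fst z) / pi"
  have h: "0 < h" "h < 1" unfolding h_def by (rule arctan_unit)+
  have "real m * encode m z = of_int \<lfloor>real m * snd z\<rfloor> + h"
    using assms by (simp add: encode_def h_def)
  then have "frac (real m * encode m z) = h" using h by (simp add: frac_unique_iff)
  then have "pi * (frac (real m * encode m z) - 1 / 2) = arctan (fst z)" by (simp add: h_def)
  then show ?thesis by (simp add: tan_arctan)
qed

lemma measurable_encode [measurable]: "encode m \<in> borel_measurable borel"
proof -
  note [measurable] = measurable_arctan
  show ?thesis unfolding encode_def by measurable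
qed

text \<open>
  The mean error of the encoding; adding it back restores the martingale condition.
\<close>

definition recentre :: "(real \<times> real) measure \<Rightarrow> nat \<Rightarrow> real measure \<Rightarrow> real" where
  "recentre \<theta> m M = (\<integral>w. snd (from_seed M w) - encode m (from_seed M w) \<partial>\<theta>)"

definition encoded_seed :: "(real \<times> real) measure \<Rightarrow> nat \<Rightarrow> real measure \<Rightarrow> real \<times> real \<Rightarrow> real \<times> real" where
  "encoded_seed \<theta> m M w = (fst (from_seed M w), encode m (from_seed M w) + recentre \<theta> m M)"

lemma measurable_from_seed_kernel:
  assumes "k \<in> X \<rightarrow>\<^sub>M prob_algebra borel"
  shows "(\<lambda>z. from_seed (k (fst z)) (snd z)) \<in> X \<Otimes>\<^sub>M borel \<rightarrow>\<^sub>M borel"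
proof -
  have "(\<lambda>z. (fst z, fst (snd z))) \<in> X \<Otimes>\<^sub>M (borel :: (real \<times> real) measure) \<rightarrow>\<^sub>M X \<Otimes>\<^sub>M (borel :: real measure)"
    by (intro measurable_Pair measurable_fst measurable_compose[OF measurable_snd borel_fst_snd(1)])
  from measurable_compose[OF this measurable_quantile[OF assms]]
  have q: "(\<lambda>z. quantile (k (fst z)) (fst (snd z))) \<in> borel_measurable (X \<Otimes>\<^sub>M (borel :: (real \<times> real) measure))" by simp
  show ?thesis
    unfolding from_seed_def
    by (intro borel_measurable_Pair q borel_measurable_diff measurable_compose[OF measurable_snd borel_fst_snd(2)])
qed

lemma measurable_recentre:
  assumes \<theta>: "\<theta> \<in> seeds p \<delta>" and k: "k \<in> X \<rightarrow>\<^sub>M prob_algebra borel"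
  shows "(\<lambda>x. recentre \<theta> m (k x)) \<in> borel_measurable X"
proof -
  interpret prob_space \<theta> by (rule seedsD(2)[OF \<theta>])
  note [measurable] = measurable_from_seed_kernel[OF k]
  have "(\<lambda>(x, w). snd (from_seed (k x) w) - encode m (from_seed (k x) w)) \<in> borel_measurable (X \<Otimes>\<^sub>M borel)"
    unfolding case_prod_beta' by measurable
  moreover have eq: "sets (X \<Otimes>\<^sub>M \<theta>) = sets (X \<Otimes>\<^sub>M borel)" by (intro sets_pair_measure_cong seedsD(1)[OF \<theta>] refl)
  ultimately have "(\<lambda>(x, w). snd (from_seed (k x) w) - encode m (from_seed (k x) w)) \<in> borel_measurable (X \<Otimes>\<^sub>M \<theta>)"
    by (simp add: measurable_cong_sets[OF eq refl])
  then show ?thesis unfolding recentre_def by (rule borel_measurable_lebesgue_integral)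
qed

lemma measurable_encoded_kernel:
  assumes \<theta>: "\<theta> \<in> seeds p \<delta>" and k: "k \<in> X \<rightarrow>\<^sub>M prob_algebra borel"
  shows "(\<lambda>x. distr \<theta> borel (encoded_seed \<theta> m (k x))) \<in> X \<rightarrow>\<^sub>M prob_algebra borel"
proof (rule measurable_distr_prob_space2)
  show "(\<lambda>_. \<theta>) \<in> X \<rightarrow>\<^sub>M prob_algebra borel"
    using seedsD(1,2)[OF \<theta>] by (intro measurable_const) (simp add: space_prob_algebra)
  show "(\<lambda>(x, w). encoded_seed \<theta> m (k x) w) \<in> X \<Otimes>\<^sub>M borel \<rightarrow>\<^sub>M borel"
    unfolding encoded_seed_def case_prod_beta'
    by (intro borel_measurable_Pair borel_measurable_add
      measurable_compose[OF measurable_from_seed_kernel[OF k] borel_fst_snd(1)]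
      measurable_compose[OF measurable_from_seed_kernel[OF k] measurable_encode]
      measurable_compose[OF measurable_fst measurable_recentre[OF \<theta> k]])
qed

context
  fixes p \<delta> :: real and \<theta> :: "(real \<times> real) measure" and M :: "real measure"
  assumes p: "1 \<le> p" and \<delta>: "0 < \<delta>" and \<theta>: "\<theta> \<in> seeds p \<delta>" and M: "real_distribution M"
begin

interpretation prob_space \<theta> by (rule seedsD(2)[OF \<theta>])

lemma seed_sets [measurable_cong]: "sets \<theta> = sets borel" by (rule seedsD(1)[OF \<theta>])

lemmas [measurable] = measurable_from_seed[OF M]

lemma measurable_encoded_seed [measurable]: "encoded_seed \<theta> m M \<in> borel \<rightarrow>\<^sub>M borel"
  unfolding encoded_seed_def by (intro borel_measurable_Pair) measurable

lemma integrable_encode_error: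
  assumes "0 < m" shows "integrable \<theta> (\<lambda>w. snd (from_seed M w) - encode m (from_seed M w))"
proof (rule integrable_const_bound)
  show "AE w in \<theta>. norm (snd (from_seed M w) - encode m (from_seed M w)) \<le> 1 / real m"
    using encode_close[OF assms] by (auto simp: abs_minus_commute)
qed measurable

lemma recentre_le: assumes "0 < m" shows "\<bar>recentre \<theta> m M\<bar> \<le> 1 / real m"
proof -
  have "\<bar>recentre \<theta> m M\<bar> \<le> (\<integral>w. \<bar>snd (from_seed M w) - encode m (from_seed M w)\<bar> \<partial>\<theta>)"
    unfolding recentre_def by (rule integral_abs_bound)
  also have "\<dots> \<le> (\<integral>w. 1 / real m \<partial>\<theta>)"
    using encode_close[OF assms] integrable_encode_error[OF assms]
    by (intro integral_mono) (auto simp: abs_minus_commute)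
  finally show ?thesis by (simp add: prob_space)
qed

lemma encoded_seed_close:
  assumes "0 < m" shows "\<bar>snd (encoded_seed \<theta> m M w) - snd (from_seed M w)\<bar> \<le> 2 / real m"
  using encode_close[OF assms, of "from_seed M w"] recentre_le[OF assms] by (simp add: encoded_seed_def)

lemma encoded_seed_tendsto: "(\<lambda>m. encoded_seed \<theta> m M w) \<longlonglongrightarrow> from_seed M w"
proof -
  have "(\<lambda>m. snd (encoded_seed \<theta> m M w)) \<longlonglongrightarrow> snd (from_seed M w)"
  proof (rule LIM_zero_cancel, rule Lim_null_comparison)
    show "\<forall>\<^sub>F m in sequentially. norm (snd (encoded_seed \<theta> m M w) - snd (from_seed M w)) \<le> 2 / real m"
      using eventually_gt_at_top[of 0] by eventually_elim (simp add: encoded_seed_close)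
    show "(\<lambda>m. 2 / real m) \<longlonglongrightarrow> 0" by (rule lim_const_over_n)
  qed
  from tendsto_Pair[OF tendsto_const this, of "fst (from_seed M w)"] show ?thesis
    by (simp add: encoded_seed_def)
qed

text \<open>
  The power p is at least 1, so that \<open>\<bar>d\<bar> \<le> 1 + \<bar>d\<bar> powr p\<close>.
\<close>

lemma integrable_seed: "integrable \<theta> snd"
proof -
  have "integrable \<theta> (\<lambda>w. 1 + \<bar>snd w\<bar> powr p)"
  proof (rule Bochner_Integration.integrable_add)
    show "integrable \<theta> (\<lambda>w. \<bar>snd w\<bar> powr p)"
      using seedsD(5)[OF \<theta>] by (intro integrableI_bounded) (auto intro: less_trans)
  qed simp
  then show ?thesis
  proof (rule Bochner_Integration.integrable_bound)
    have "\<bar>d\<bar> \<le> 1 + \<bar>d\<bar> powr p" for d :: real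
    proof (cases "\<bar>d\<bar> \<le> 1")
      case False
      then have "\<bar>d\<bar> powr 1 \<le> \<bar>d\<bar> powr p" using p by (intro powr_mono) auto
      then show ?thesis using False by simp
    qed (simp add: add_increasing2)
    then show "AE w in \<theta>. norm (snd w) \<le> norm (1 + \<bar>snd w\<bar> powr p)" by (auto intro!: AE_I2 order_trans[OF _ abs_ge_self])
  qed measurable
qed

text \<open>
  The bound \<open>\<delta>\<close> on the norm of d is strict, and \<open>2 / m\<close> bounds the change caused by encoding and
  recentring, uniformly in the first marginal. The slack survives by dominated convergence.
\<close>

lemma seed_slack:
  "\<exists>m0>0. \<forall>m\<ge>m0. (\<integral>\<^sup>+ w. ennreal ((\<bar>snd w\<bar> + 2 / real m) powr p) \<partial>\<theta>) < ennreal (\<delta> powr p)"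
proof -
  have "(\<lambda>m. \<integral>\<^sup>+ w. ennreal ((\<bar>snd w\<bar> + 2 / real (Suc m)) powr p) \<partial>\<theta>) \<longlonglongrightarrow> (\<integral>\<^sup>+ w. ennreal (\<bar>snd w\<bar> powr p) \<partial>\<theta>)"
  proof (rule nn_integral_dominated_convergence)
    \<comment> \<open>Since 2 / (m + 1) is at most 2, the sum is at most 4 or at most \<open>2 * \<bar>d\<bar>\<close>.\<close>
    let ?w = "\<lambda>w :: real \<times> real. ennreal (4 powr p) + ennreal (2 powr p) * ennreal (\<bar>snd w\<bar> powr p)"
    show "?w \<in> borel_measurable \<theta>" by measurable
    have "(\<bar>d\<bar> + 2 / real (Suc m)) powr p \<le> 4 powr p + 2 powr p * \<bar>d\<bar> powr p" for d m
    proof -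
      have "2 / real (Suc m) \<le> 2" by (simp add: divide_le_eq)
      then have "\<bar>d\<bar> + 2 / real (Suc m) \<le> 4 \<or> \<bar>d\<bar> + 2 / real (Suc m) \<le> 2 * \<bar>d\<bar>" by linarith
      then have "(\<bar>d\<bar> + 2 / real (Suc m)) powr p \<le> 4 powr p \<or> (\<bar>d\<bar> + 2 / real (Suc m)) powr p \<le> (2 * \<bar>d\<bar>) powr p"
        using p by (auto intro!: powr_mono2)
      then show ?thesis by (auto simp: powr_mult intro: add_increasing add_increasing2)
    qed
    then show "AE w in \<theta>. ennreal ((\<bar>snd w\<bar> + 2 / real (Suc m)) powr p) \<le> ?w w" for m
      by (auto intro!: AE_I2 ennreal_leI simp: ennreal_mult[symmetric] ennreal_plus[symmetric] simp del: ennreal_plus)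
    have "(\<integral>\<^sup>+ w. ?w w \<partial>\<theta>) = ennreal (4 powr p) + ennreal (2 powr p) * (\<integral>\<^sup>+ w. ennreal (\<bar>snd w\<bar> powr p) \<partial>\<theta>)"
      by (subst nn_integral_add) (auto simp: nn_integral_cmult emeasure_space_1)
    also have "\<dots> < \<infinity>" using seedsD(5)[OF \<theta>] by (auto simp: ennreal_mult_less_top intro: less_trans)
    finally show "(\<integral>\<^sup>+ w. ?w w \<partial>\<theta>) < \<infinity>" .
    show "AE w in \<theta>. (\<lambda>m. ennreal ((\<bar>snd w\<bar> + 2 / real (Suc m)) powr p)) \<longlonglongrightarrow> ennreal (\<bar>snd w\<bar> powr p)"
    proof (rule AE_I2, rule tendsto_ennrealI)
      fix w :: "real \<times> real"
      have "(\<lambda>m. \<bar>snd w\<bar> + 2 / real (Suc m)) \<longlonglongrightarrow> \<bar>snd w\<bar> + 0"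
        by (intro tendsto_add tendsto_const LIMSEQ_Suc[OF lim_const_over_n])
      then show "(\<lambda>m. (\<bar>snd w\<bar> + 2 / real (Suc m)) powr p) \<longlonglongrightarrow> \<bar>snd w\<bar> powr p"
        using p by (intro tendsto_powr2) auto
    qed
  qed measurable
  from order_tendstoD(2)[OF this seedsD(5)[OF \<theta>]]
  obtain m1 where m1: "\<And>m. m1 \<le> m \<Longrightarrow> (\<integral>\<^sup>+ w. ennreal ((\<bar>snd w\<bar> + 2 / real (Suc m)) powr p) \<partial>\<theta>) < ennreal (\<delta> powr p)"
    by (auto simp: eventually_sequentially)
  show ?thesis
  proof (intro exI[of _ "Suc m1"] conjI allI impI)
    fix m assume "Suc m1 \<le> m"
    then show "(\<integral>\<^sup>+ w. ennreal ((\<bar>snd w\<bar> + 2 / real m) powr p) \<partial>\<theta>) < ennreal (\<delta> powr p)"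
      using m1[of "m - 1"] by (cases m) auto
  qed simp
qed

text \<open>
  The first marginal is untouched and the recentring constant cancels the mean error of the encoding.
\<close>

lemma encoded_seed_Pi_M:
  assumes m: "0 < m" and slack: "(\<integral>\<^sup>+ w. ennreal ((\<bar>snd w\<bar> + 2 / real m) powr p) \<partial>\<theta>) < ennreal (\<delta> powr p)"
  shows "distr \<theta> borel (encoded_seed \<theta> m M) \<in> Pi_M p \<delta> M"
proof -
  let ?\<pi> = "distr \<theta> borel (encoded_seed \<theta> m M)"
  have "distr ?\<pi> borel fst = distr (distr \<theta> borel fst) borel (quantile M)"
    using measurable_quantile_single[OF M] by (simp add: distr_distr comp_def encoded_seed_def from_seed_def)
  also have "\<dots> = M" by (simp add: seedsD(4)[OF \<theta>] distr_quantile[OF M])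
  finally have 1: "?\<pi> \<in> couplings_fst M"
    by (simp add: couplings_fst_def space_prob_algebra prob_space_distr)
  have diff: "fst (encoded_seed \<theta> m M w) - snd (encoded_seed \<theta> m M w)
     = snd w + (snd (from_seed M w) - encode m (from_seed M w)) - recentre \<theta> m M" for w
    by (simp add: encoded_seed_def from_seed_def)
  have "\<bar>fst (encoded_seed \<theta> m M w) - snd (encoded_seed \<theta> m M w)\<bar> \<le> \<bar>snd w\<bar> + 2 / real m" for w
    using encoded_seed_close[OF m, of w] by (simp add: encoded_seed_def from_seed_def)
  then have "(\<integral>\<^sup>+ w. ennreal (\<bar>fst (encoded_seed \<theta> m M w) - snd (encoded_seed \<theta> m M w)\<bar> powr p) \<partial>\<theta>)
      \<le> (\<integral>\<^sup>+ w. ennreal ((\<bar>snd w\<bar> + 2 / real m) powr p) \<partial>\<theta>)"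
    using p by (intro nn_integral_mono ennreal_leI powr_mono2) auto
  then have 2: "cost_p p ?\<pi> < ennreal \<delta>"
    using slack by (simp add: cost_p_less_iff p \<delta> nn_integral_distr)
  have "(\<integral>z. fst z - snd z \<partial>?\<pi>) = (\<integral>w. snd w + (snd (from_seed M w) - encode m (from_seed M w)) - recentre \<theta> m M \<partial>\<theta>)"
    by (subst integral_distr) (auto simp: diff)
  also have "\<dots> = (\<integral>w. snd w \<partial>\<theta>) + recentre \<theta> m M - recentre \<theta> m M"
    using integrable_seed integrable_encode_error[OF m]
    by (simp add: recentre_def prob_space)
  finally have 3: "(\<integral>z. fst z - snd z \<partial>?\<pi>) = 0" by (simp add: seedsD(6)[OF \<theta>])
  show ?thesis using 1 2 3 by (simp add: Pi_M_def case_prod_beta')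
qed

lemma AE_encoded_seed_decode:
  assumes "0 < m"
  shows "AE z in distr \<theta> borel (encoded_seed \<theta> m M).
    fst z = tan (pi * (frac (real m * (snd z - recentre \<theta> m M)) - 1 / 2))"
proof -
  note [measurable] = measurable_tan measurable_frac
  show ?thesis
    by (subst AE_distr_iff) (auto simp: encoded_seed_def encode_inverse[OF assms])
qed

end

text \<open>
  By monotone convergence finitely many of the functions suffice, and among finitely many the first
  maximal one is a measurable choice.
\<close>

lemma measurable_SUP_selection:
  fixes J :: "nat \<Rightarrow> 'a \<Rightarrow> ennreal"
  assumes J[measurable]: "\<And>i. J i \<in> borel_measurable M"
    and c: "c < (\<integral>\<^sup>+ z. (SUP i. J i z) \<partial>M)"
  shows "\<exists>\<iota> \<in> M \<rightarrow>\<^sub>M count_space UNIV. c < (\<integral>\<^sup>+ z. J (\<iota> z) z \<partial>M)"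
proof -
  define S where "S n z = (SUP i\<in>{..n}. J i z)" for n z
  have [measurable]: "S n \<in> borel_measurable M" for n unfolding S_def by measurable
  have "incseq S" by (auto simp: incseq_def le_fun_def S_def intro!: SUP_subset_mono)
  moreover have "(SUP i. J i z) = (SUP n. S n z)" for z
    unfolding S_def by (rule antisym; intro SUP_least) (auto intro: SUP_upper SUP_upper2)
  ultimately have "(\<integral>\<^sup>+ z. (SUP i. J i z) \<partial>M) = (SUP n. \<integral>\<^sup>+ z. S n z \<partial>M)"
    by (simp add: nn_integral_monotone_convergence_SUP)
  then obtain n where n: "c < (\<integral>\<^sup>+ z. S n z \<partial>M)" using c by (auto simp: less_SUP_iff)
  define \<iota> where "\<iota> z = (LEAST i. J i z = S n z)" for z
  have "\<exists>i. J i z = S n z" for z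
  proof -
    have "S n z = Max ((\<lambda>i. J i z) ` {..n})" unfolding S_def by (rule Max_Sup[symmetric]) auto
    also have "\<dots> \<in> (\<lambda>i. J i z) ` {..n}" by (rule Max_in) auto
    finally show ?thesis by auto
  qed
  then have "J (\<iota> z) z = S n z" for z unfolding \<iota>_def by (rule LeastI_ex)
  moreover have "\<iota> \<in> M \<rightarrow>\<^sub>M count_space UNIV" unfolding \<iota>_def by measurable
  ultimately show ?thesis using n by (intro bexI[of _ \<iota>]) auto
qed

context martingale_robust_control
begin

text \<open>
  Countably many seeds exhaust the supremum, by \<open>lsc_countable_SUP\<close>. Every seed is replaced by its
  encodings with mesh \<open>1 / m\<close>, for all m large enough to respect the cost bound. As the mesh tends to 0, the
  encoded pair converges to the original one, and Fatou's lemma for the lower semicontinuous \<open>V (Suc t)\<close>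
  shows that the supremum does not drop.
\<close>

lemma encoded_family:
  assumes t: "t < N"
  shows "\<exists>(e :: nat \<Rightarrow> (real \<times> real) measure) (m :: nat \<Rightarrow> nat).
     (\<forall>i. e i \<in> seeds p \<delta> \<and> 0 < m i \<and>
       (\<forall>x. distr (e i) borel (encoded_seed (e i) (m i) (k t (cut t x))) \<in> Pi_M p \<delta> (k t (cut t x)))) \<and>
     (\<forall>z b. G t z b \<le> (SUP i. \<integral>\<^sup>+ w. V (Suc t) (advance t z b w)
        \<partial>distr (e i) borel (encoded_seed (e i) (m i) (k t (cut t (fst z))))))"
proof -
  note M = real_distribution_k_cut[OF t]
  have "\<exists>e :: nat \<Rightarrow> (real \<times> real) measure. range e \<subseteq> seeds p \<delta> \<and>
     (\<forall>zb. (SUP \<theta>\<in>seeds p \<delta>. case zb of (z, b) \<Rightarrow> \<integral>\<^sup>+ w. V (Suc t) (seed_step t z b w) \<partial>\<theta>)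
        = (SUP n. case zb of (z, b) \<Rightarrow> \<integral>\<^sup>+ w. V (Suc t) (seed_step t z b w) \<partial>e n))"
    by (rule lsc_countable_SUP[OF lsc_seed_integral[OF t lsc_V] seeds_nonempty[OF \<delta> p]]) (use t in auto)
  then obtain e where e: "\<And>i :: nat. e i \<in> seeds p \<delta>"
    and eG: "\<And>z b. G t z b = (SUP i. \<integral>\<^sup>+ w. V (Suc t) (seed_step t z b w) \<partial>e i)"
    unfolding G_def by (fastforce simp: image_subset_iff)
  have "\<forall>i. \<exists>m0>0. \<forall>m\<ge>m0. (\<integral>\<^sup>+ w. ennreal ((\<bar>snd w\<bar> + 2 / real m) powr p) \<partial>e i) < ennreal (\<delta> powr p)"
    by (intro allI seed_slack[OF p \<delta> e M])
  then obtain m0 where m0: "\<And>i. 0 < m0 i"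
    "\<And>i m. m0 i \<le> m \<Longrightarrow> (\<integral>\<^sup>+ w. ennreal ((\<bar>snd w\<bar> + 2 / real m) powr p) \<partial>e i) < ennreal (\<delta> powr p)"
    by metis
  \<comment> \<open>The index i encodes a seed together with a mesh that is fine enough for it.\<close>
  define e' where "e' i = e (fst (prod_decode i))" for i
  define m' where "m' i = m0 (fst (prod_decode i)) + snd (prod_decode i)" for i
  have m': "0 < m' i" for i using m0(1) by (simp add: m'_def add_pos_nonneg)
  have Pi: "distr (e' i) borel (encoded_seed (e' i) (m' i) (k t (cut t x))) \<in> Pi_M p \<delta> (k t (cut t x))" for i x
    unfolding e'_def
    by (rule encoded_seed_Pi_M[OF p \<delta> e M m'], rule m0(2)) (simp add: m'_def)
  have V_adv: "(\<lambda>w. V (Suc t) (advance t z b w)) \<in> borel_measurable borel" for z b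
    by (rule measurable_compose[OF measurable_advance measurable_V]) (use t in simp)
  have J: "(\<integral>\<^sup>+ w. V (Suc t) (advance t z b w) \<partial>distr (e i) borel (encoded_seed (e i) m (k t (cut t x))))
      = (\<integral>\<^sup>+ w. V (Suc t) (advance t z b (encoded_seed (e i) m (k t (cut t x)) w)) \<partial>e i)" for z b x i m
    using measurable_encoded_seed[OF p \<delta> e M] V_adv
    by (intro nn_integral_distr) (simp_all add: measurable_cong_sets[OF seedsD(1)[OF e] refl])
  have "G t z b \<le> (SUP i. \<integral>\<^sup>+ w. V (Suc t) (advance t z b w)
        \<partial>distr (e' i) borel (encoded_seed (e' i) (m' i) (k t (cut t (fst z)))))" (is "_ \<le> ?S") for z b
    unfolding eG
  proof (rule SUP_least)
    fix i
    let ?\<Phi> = "\<lambda>m. advance t z b \<circ> encoded_seed (e i) (m0 i + m) (k t (cut t (fst z)))"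
    have adv_cont: "(\<lambda>m. advance t z b (wn m)) \<longlonglongrightarrow> advance t z b w" if "wn \<longlonglongrightarrow> w" for wn w
    proof -
      have eq: "advance t z b w = ((fst z)(Suc t := fst w), (fst (snd z))(Suc t := snd w), (snd (snd z))(Suc t := b))" for w
        by (cases z; cases w) simp
      show ?thesis unfolding eq using that by (intro tendsto_Pair tendsto_fun_upd tendsto_const tendsto_fst tendsto_snd)
    qed
    have "(\<integral>\<^sup>+ w. V (Suc t) (seed_step t z b w) \<partial>e i) \<le> liminf (\<lambda>m. \<integral>\<^sup>+ w. V (Suc t) (?\<Phi> m w) \<partial>e i)"
    proof (rule lsc_nn_integral_le[OF lsc_V])
      show "Suc t \<le> N" using t by simp
      show "?\<Phi> m \<in> borel_measurable (e i)" for m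
        using measurable_comp[OF measurable_encoded_seed[OF p \<delta> e M] measurable_advance]
        by (simp add: measurable_cong_sets[OF seedsD(1)[OF e] refl])
      show "AE w in e i. (\<lambda>m. ?\<Phi> m w) \<longlonglongrightarrow> seed_step t z b w"
      proof (rule AE_I2)
        fix w
        show "(\<lambda>m. ?\<Phi> m w) \<longlonglongrightarrow> seed_step t z b w"
          unfolding seed_step_def comp_def
          using LIMSEQ_ignore_initial_segment[OF encoded_seed_tendsto[OF p \<delta> e[of i] M[of "fst z"], where w=w], where k="m0 i"]
          by (intro adv_cont) (simp add: add.commute)
      qed
    qed
    also have "\<dots> \<le> ?S"
    proof (rule Liminf_le)
      show "\<forall>\<^sub>F m in sequentially. (\<integral>\<^sup>+ w. V (Suc t) (?\<Phi> m w) \<partial>e i) \<le> ?S"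
      proof (intro always_eventually allI)
        fix m
        show "(\<integral>\<^sup>+ w. V (Suc t) (?\<Phi> m w) \<partial>e i) \<le> ?S"
          by (rule SUP_upper2[of "prod_encode (i, m)"]) (simp_all add: e'_def m'_def J)
      qed
    qed simp
    finally show "(\<integral>\<^sup>+ w. V (Suc t) (seed_step t z b w) \<partial>e i) \<le> ?S" .
  qed
  then show ?thesis
    using e m' Pi by (intro exI[of _ e'] exI[of _ m']) (auto simp: e'_def)
qed

definition decodable_kernel :: "nat \<Rightarrow> (path \<times> path \<Rightarrow> (real \<times> real) measure) \<Rightarrow> (path \<times> path \<Rightarrow> real \<Rightarrow> real) \<Rightarrow> bool" where
  "decodable_kernel t g \<psi> \<longleftrightarrow> g \<in> RR_borel t \<rightarrow>\<^sub>M prob_algebra borel \<and>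
     (\<lambda>(z, v). \<psi> z v) \<in> borel_measurable (RR_borel t \<Otimes>\<^sub>M borel) \<and>
     (\<forall>z\<in>space (RR_borel t). g z \<in> Pi_M p \<delta> (k t (fst z)) \<and> (AE w in g z. fst w = \<psi> z (snd w)))"

text \<open>
  One step of the adversary: an index in the encoded family is selected measurably. The decoder
  knows both histories, hence the selected index and the recentring constant, and reads the first coordinate off the
  fractional part.
\<close>

lemma ex_decodable_kernel_above:
  assumes t: "t < N" and L: "prob_space L" "sets L = sets (RR_borel t)"
    and A: "A \<in> RR_borel t \<rightarrow>\<^sub>M R_borel t" and b: "b \<in> borel_measurable (RR_borel t)"
    and c: "c < (\<integral>\<^sup>+ z. G t (fst z, snd z, A z) (b z) \<partial>L)"
  shows "\<exists>g \<psi>. decodable_kernel t g \<psi> \<and>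
    c < (\<integral>\<^sup>+ z. \<integral>\<^sup>+ w. V (Suc t) (advance t (fst z, snd z, A z) (b z) w) \<partial>g z \<partial>L)"
proof -
  have spL: "space L = space (RR_borel t)" using L(2) by (rule sets_eq_imp_space_eq)
  obtain e m where e: "\<And>i. e i \<in> seeds p \<delta>" and m: "\<And>i. 0 < m i"
    and Pi: "\<And>i x. distr (e i) borel (encoded_seed (e i) (m i) (k t (cut t x))) \<in> Pi_M p \<delta> (k t (cut t x))"
    and sup: "\<And>z b. G t z b \<le> (SUP i :: nat. \<integral>\<^sup>+ w. V (Suc t) (advance t z b w)
        \<partial>distr (e i) borel (encoded_seed (e i) (m i) (k t (cut t (fst z)))))"
    using encoded_family[OF t] by blast
  define \<kappa> where "\<kappa> i z = distr (e i) borel (encoded_seed (e i) (m i) (k t (fst z)))" for i and z :: "path \<times> path"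
  have kf: "(\<lambda>z. k t (fst z)) \<in> RR_borel t \<rightarrow>\<^sub>M prob_algebra borel"
    by (rule measurable_compose[OF measurable_fst k_meas[OF t]])
  have \<kappa>: "\<kappa> i \<in> RR_borel t \<rightarrow>\<^sub>M prob_algebra borel" for i
    unfolding \<kappa>_def by (rule measurable_encoded_kernel[OF e kf])
  have cut: "cut t (fst z) = fst z" if "z \<in> space (RR_borel t)" for z
    using that by (auto simp: space_RR_borel extensional_restrict)
  define F where "F z w = V (Suc t) (advance t (fst z, snd z, A z) (b z) w)" for z w
  define J where "J i z = (\<integral>\<^sup>+ w. F z w \<partial>\<kappa> i z)" for i z
  have F: "(\<lambda>(z, w). F z w) \<in> borel_measurable (RR_borel t \<Otimes>\<^sub>M borel)"
  proof -
    have "(\<lambda>(z, w). advance t (fst z, snd z, A z) (b z) w)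
      = (\<lambda>zw. ((fst (fst zw))(Suc t := fst (snd zw)), (snd (fst zw))(Suc t := snd (snd zw)), (A (fst zw))(Suc t := b (fst zw))))"
      by (auto simp: fun_eq_iff)
    also have "\<dots> \<in> borel_measurable (RR_borel t \<Otimes>\<^sub>M borel)"
      by (intro borel_measurable_Pair measurable_path_fun_upd
        measurable_compose[OF measurable_fst measurable_compose[OF measurable_fst measurable_path_embed]]
        measurable_compose[OF measurable_fst measurable_compose[OF measurable_snd measurable_path_embed]]
        measurable_compose[OF measurable_fst measurable_compose[OF A measurable_path_embed]]
        measurable_compose[OF measurable_fst b]
        measurable_compose[OF measurable_snd borel_fst_snd(1)] measurable_compose[OF measurable_snd borel_fst_snd(2)])
    finally have "(\<lambda>(z, w). advance t (fst z, snd z, A z) (b z) w) \<in> borel_measurable (RR_borel t \<Otimes>\<^sub>M borel)" .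
    from measurable_compose[OF this measurable_V[of "Suc t"]] t show ?thesis
      by (simp add: F_def case_prod_beta')
  qed
  have J: "J i \<in> borel_measurable L" for i
    using nn_integral_measurable_subprob_algebra2[OF F measurable_prob_algebraD[OF \<kappa>]]
    by (simp add: J_def[abs_def] measurable_cong_sets[OF L(2) refl])
  have "(\<integral>\<^sup>+ z. G t (fst z, snd z, A z) (b z) \<partial>L) \<le> (\<integral>\<^sup>+ z. (SUP i. J i z) \<partial>L)"
  proof (rule nn_integral_mono)
    fix z assume "z \<in> space L"
    then have "z \<in> space (RR_borel t)" by (simp add: spL)
    with sup[of "(fst z, snd z, A z)" "b z"] show "G t (fst z, snd z, A z) (b z) \<le> (SUP i. J i z)"
      by (simp add: J_def F_def \<kappa>_def cut)
  qed
  with c have "c < (\<integral>\<^sup>+ z. (SUP i. J i z) \<partial>L)" by (rule less_le_trans)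
  from measurable_SUP_selection[OF J this]
  obtain \<iota> where "\<iota> \<in> L \<rightarrow>\<^sub>M count_space UNIV" and cJ: "c < (\<integral>\<^sup>+ z. J (\<iota> z) z \<partial>L)" by blast
  then have \<iota>: "\<iota> \<in> RR_borel t \<rightarrow>\<^sub>M count_space UNIV" by (simp add: measurable_cong_sets[OF L(2) refl])
  define g where "g z = \<kappa> (\<iota> z) z" for z
  define r where "r i z = recentre (e i) (m i) (k t (fst z))" for i and z :: "path \<times> path"
  define \<psi> where "\<psi> z v = tan (pi * (frac (real (m (\<iota> z)) * (v - r (\<iota> z) z)) - 1 / 2))" for z v
  have "decodable_kernel t g \<psi>"
    unfolding decodable_kernel_def
  proof (intro conjI ballI)
    show "g \<in> RR_borel t \<rightarrow>\<^sub>M prob_algebra borel"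
      unfolding g_def by (rule measurable_compose_countable[OF \<kappa> \<iota>])
    note [measurable] = measurable_tan measurable_frac
    have [measurable]: "r i \<in> borel_measurable (RR_borel t)" for i
      unfolding r_def by (rule measurable_recentre[OF e kf])
    have "(\<lambda>zv. tan (pi * (frac (real (m (\<iota> (fst zv))) * (snd zv - r (\<iota> (fst zv)) (fst zv))) - 1 / 2)))
      \<in> borel_measurable (RR_borel t \<Otimes>\<^sub>M borel)"
      by (rule measurable_compose_countable[where g="\<lambda>zv. \<iota> (fst zv)" and f="\<lambda>i zv. tan (pi * (frac (real (m i) * (snd zv - r i (fst zv))) - 1 / 2))"])
         (measurable, rule measurable_compose[OF measurable_fst \<iota>])
    then show "(\<lambda>(z, v). \<psi> z v) \<in> borel_measurable (RR_borel t \<Otimes>\<^sub>M borel)"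
      by (simp add: \<psi>_def case_prod_beta')
  next
    fix z assume z: "z \<in> space (RR_borel t)"
    show "g z \<in> Pi_M p \<delta> (k t (fst z))"
      using Pi[of "\<iota> z" "fst z"] by (simp add: g_def \<kappa>_def cut[OF z])
    show "AE w in g z. fst w = \<psi> z (snd w)"
      unfolding g_def \<kappa>_def \<psi>_def r_def
      using AE_encoded_seed_decode[OF p \<delta> e[of "\<iota> z"] real_distribution_k_cut[OF t, of "fst z"] m[of "\<iota> z"]]
      unfolding cut[OF z] .
  qed
  moreover have "(\<integral>\<^sup>+ z. J (\<iota> z) z \<partial>L) = (\<integral>\<^sup>+ z. \<integral>\<^sup>+ w. F z w \<partial>g z \<partial>L)"
    by (simp add: J_def g_def)
  ultimately show ?thesis using cJ unfolding F_def by auto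
qed

text \<open>
  Kernels are chosen forward in time, keeping the integral of \<open>V t\<close> strictly above c. The control is
  evaluated on histories of length t by extending them with zeros, which does not affect its
  coordinates up to t + 1 since it is predictable.
\<close>

lemma lower_bound:
  assumes \<alpha>: "\<alpha> \<in> controls N K" and c: "c < V 0 (empty_path, empty_path, empty_path)"
  shows "\<exists>\<gamma>\<in>Pi_M_bc p N \<delta> k. c < (\<integral>\<^sup>+ z. ennreal (f (snd z, \<alpha> z) + C) \<partial>\<gamma>)"
proof -
  have \<alpha>m: "\<alpha> \<in> RR_borel N \<rightarrow>\<^sub>M R_borel N"
    and \<alpha>K: "\<And>z. z \<in> space (RR_borel N) \<Longrightarrow> \<alpha> z \<in> {1..N} \<rightarrow>\<^sub>E K"
    and \<alpha>pred: "\<And>t x y x' y'. t \<in> {1..N} \<Longrightarrow> (x, y) \<in> space (RR_borel N) \<Longrightarrow> (x', y') \<in> space (RR_borel N) \<Longrightarrow>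
       cut (t - 1) x = cut (t - 1) x' \<Longrightarrow> cut (t - 1) y = cut (t - 1) y' \<Longrightarrow> \<alpha> (x, y) t = \<alpha> (x', y') t"
    using \<alpha> unfolding controls_def by blast+
  define ext :: "nat \<Rightarrow> path \<Rightarrow> path" where "ext t x = (\<lambda>i\<in>{1..N}. if i \<le> t then x i else 0)" for t x
  define ext2 where "ext2 t z = (ext t (fst z), ext t (snd z))" for t z
  define A where "A t z = cut t (\<alpha> (ext2 t z))" for t z
  have ext_meas: "ext t \<in> R_borel t \<rightarrow>\<^sub>M R_borel N" for t
    unfolding ext_def
  proof (rule measurable_restrict)
    fix i assume "i \<in> {1..N}"
    then show "(\<lambda>x. if i \<le> t then x i else 0) \<in> borel_measurable (R_borel t)"
      by (cases "i \<le> t") (auto intro!: measurable_component_singleton)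
  qed
  have ext2_meas: "ext2 t \<in> RR_borel t \<rightarrow>\<^sub>M RR_borel N" for t
    unfolding ext2_def
    by (intro measurable_Pair measurable_compose[OF measurable_fst ext_meas] measurable_compose[OF measurable_snd ext_meas])
  have ext2_space: "ext2 t z \<in> space (RR_borel N)" for t z
    by (simp add: ext2_def ext_def space_RR_borel)
  have A_meas: "A t \<in> RR_borel t \<rightarrow>\<^sub>M R_borel t" for t
    unfolding A_def
    by (rule measurable_compose[OF measurable_compose[OF measurable_compose[OF ext2_meas \<alpha>m] measurable_path_embed] measurable_cut])
  have A_Suc: "A (Suc t) (append_pair t z w) = (A t z)(Suc t := \<alpha> (ext2 t z) (Suc t))" if t: "t < N" for t z w
  proof
    fix i
    have eq: "\<alpha> (ext2 (Suc t) (append_pair t z w)) i = \<alpha> (ext2 t z) i" if i: "i \<in> {1..Suc t}"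
      using ext2_space[of "Suc t" "append_pair t z w"] ext2_space[of t z] i t unfolding ext2_def
      by (intro \<alpha>pred) (auto simp: ext_def append_pair_def restrict_def fun_eq_iff)
    show "A (Suc t) (append_pair t z w) i = ((A t z)(Suc t := \<alpha> (ext2 t z) (Suc t))) i"
      using eq by (auto simp: A_def restrict_def le_Suc_eq)
  qed
  have "\<exists>g \<psi>. (\<forall>s<t. decodable_kernel s (g s) (\<psi> s)) \<and> c < (\<integral>\<^sup>+ z. V t (fst z, snd z, A t z) \<partial>pair_path_law g t)"
    if "t \<le> N" for t
    using that
  proof (induction t)
    case 0
    have A0: "A 0 z = empty_path" for z by (simp add: A_def restrict_def)
    have "(\<integral>\<^sup>+ z. V 0 (fst z, snd z, A 0 z) \<partial>pair_path_law g 0) = V 0 (empty_path, empty_path, empty_path)" for g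
      using nn_integral_return[OF _ V_extend_measurable[where t=0 and A="A 0" and s=0, OF _ A_meas], of "(empty_path, empty_path)"]
      by (simp add: space_pair_measure space_PiM_empty A0)
    then show ?case using c by auto
  next
    case (Suc t)
    then have t: "t < N" by simp
    then obtain g \<psi> where g: "\<And>s. s < t \<Longrightarrow> decodable_kernel s (g s) (\<psi> s)"
      and cg: "c < (\<integral>\<^sup>+ z. V t (fst z, snd z, A t z) \<partial>pair_path_law g t)"
      using Suc.IH by auto
    have kern: "kernels t g" using g by (auto simp: kernels_def decodable_kernel_def)
    define b where "b z = \<alpha> (ext2 t z) (Suc t)" for z
    have b_meas: "b \<in> borel_measurable (RR_borel t)"
      unfolding b_def using t
      by (intro measurable_compose[OF measurable_compose[OF ext2_meas \<alpha>m] measurable_component_singleton]) auto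
    have "b z \<in> K" for z using \<alpha>K[OF ext2_space[of t z]] t by (auto simp: b_def PiE_def Pi_def)
    then have "V t (fst z, snd z, A t z) \<le> G t (fst z, snd z, A t z) (b z)" for z
      unfolding V_step[OF t] by (intro INF_lower)
    then have "c < (\<integral>\<^sup>+ z. G t (fst z, snd z, A t z) (b z) \<partial>pair_path_law g t)"
      by (intro less_le_trans[OF cg] nn_integral_mono)
    from ex_decodable_kernel_above[OF t prob_space_pair_path_law[OF kern] sets_pair_path_law[OF kern] A_meas b_meas this]
    obtain g' \<psi>' where g': "decodable_kernel t g' \<psi>'"
      and cg': "c < (\<integral>\<^sup>+ z. \<integral>\<^sup>+ w. V (Suc t) (advance t (fst z, snd z, A t z) (b z) w) \<partial>g' z \<partial>pair_path_law g t)"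
      by blast
    let ?g = "g(t := g')"
    have gS: "decodable_kernel s (?g s) ((\<psi>(t := \<psi>')) s)" if "s < Suc t" for s
      using g g' that by (auto simp: less_Suc_eq)
    then have kernS: "kernels (Suc t) ?g" by (auto simp: kernels_def decodable_kernel_def)
    have law: "pair_path_law ?g t = pair_path_law g t" by (rule pair_path_law_cong) simp
    have adv: "(fst (append_pair t z w), snd (append_pair t z w), A (Suc t) (append_pair t z w)) = advance t (fst z, snd z, A t z) (b z) w" for z w
      unfolding A_Suc[OF t] b_def by (cases w) (simp add: append_pair_def)
    have "(\<integral>\<^sup>+ z. V (Suc t) (fst z, snd z, A (Suc t) z) \<partial>pair_path_law ?g (Suc t))
      = (\<integral>\<^sup>+ z. \<integral>\<^sup>+ w. V (Suc t) (advance t (fst z, snd z, A t z) (b z) w) \<partial>g' z \<partial>pair_path_law g t)"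
      by (subst nn_integral_pair_path_law_Suc[OF kernS V_extend_measurable[OF Suc.prems A_meas]]) (simp add: adv law)
    with cg' have "c < (\<integral>\<^sup>+ z. V (Suc t) (fst z, snd z, A (Suc t) z) \<partial>pair_path_law ?g (Suc t))" by (rule back_subst[where P="\<lambda>v. c < v", OF _ sym])
    then show ?case using gS by (intro exI[of _ ?g] exI[of _ "\<psi>(t := \<psi>')"] conjI allI impI)
  qed
  from this[OF order.refl] obtain g \<psi> where g: "\<And>s. s < N \<Longrightarrow> decodable_kernel s (g s) (\<psi> s)"
    and cg: "c < (\<integral>\<^sup>+ z. V N (fst z, snd z, A N z) \<partial>pair_path_law g N)" by auto
  have kern: "kernels N g" using g by (auto simp: kernels_def decodable_kernel_def)
  have "g t (x, y) \<in> Pi_M p \<delta> (k t x)" if "t < N" "(x, y) \<in> space (RR_borel t)" for t x y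
    using g[OF that(1)] that(2) unfolding decodable_kernel_def by force
  then have "pair_path_law g N \<in> Pi_M_path p N \<delta> k"
    unfolding Pi_M_path_def pair_disintegration_def
    using kern by (auto intro!: exI[of _ g] simp: kernels_def)
  moreover have "bicausal N (pair_path_law g N)"
  proof (rule bicausal_if_decodable[OF kern k_meas])
    show "distr (g t z) borel fst = k t (fst z)" if "t < N" "z \<in> space (RR_borel t)" for t z
      using g[OF that(1)] that(2) by (auto simp: decodable_kernel_def Pi_M_def couplings_fst_def)
    show "(\<lambda>(z, v). \<psi> t z v) \<in> borel_measurable (RR_borel t \<Otimes>\<^sub>M borel)" if "t < N" for t
      using g[OF that] by (auto simp: decodable_kernel_def)
    show "AE w in g t z. fst w = \<psi> t z (snd w)" if "t < N" "z \<in> space (RR_borel t)" for t z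
      using g[OF that(1)] that(2) by (auto simp: decodable_kernel_def)
  qed
  ultimately have "pair_path_law g N \<in> Pi_M_bc p N \<delta> k" by (simp add: Pi_M_bc_def)
  moreover have "(\<integral>\<^sup>+ z. V N (fst z, snd z, A N z) \<partial>pair_path_law g N) = (\<integral>\<^sup>+ z. ennreal (f (snd z, \<alpha> z) + C) \<partial>pair_path_law g N)"
  proof (rule nn_integral_cong)
    fix z assume "z \<in> space (pair_path_law g N)"
    then have z: "z \<in> space (RR_borel N)" by (simp add: space_pair_path_law[OF kern])
    then have "ext2 N z = z"
      by (auto simp: ext2_def ext_def space_RR_borel restrict_def extensional_def fun_eq_iff prod_eq_iff)
    moreover have "cut N (snd z) = snd z" using z by (auto simp: space_RR_borel extensional_restrict)
    moreover have "cut N (\<alpha> z) = \<alpha> z" using \<alpha>K[OF z] by (auto simp: PiE_def extensional_restrict)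
    ultimately show "V N (fst z, snd z, A N z) = ennreal (f (snd z, \<alpha> z) + C)" by (simp add: V_end A_def)
  qed
  ultimately show ?thesis using cg by auto
qed

lemma value_eq: "value_M p N k K f \<delta> = unshift C (V 0 (empty_path, empty_path, empty_path))"
proof -
  let ?v = "V 0 (empty_path, empty_path, empty_path)"
  have conv: "ext_integral \<gamma> (\<lambda>(x, y). ereal (f (y, \<alpha> (x, y)))) = unshift C (\<integral>\<^sup>+ z. ennreal (f (snd z, \<alpha> z) + C) \<partial>\<gamma>)"
    if \<alpha>: "\<alpha> \<in> controls N K" and \<gamma>: "\<gamma> \<in> Pi_M_path p N \<delta> k" for \<alpha> \<gamma>
  proof -
    obtain g where g: "\<gamma> = pair_path_law g N" "kernels N g"
      using \<gamma> unfolding Pi_M_path_def pair_disintegration_def kernels_def by blast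
    have \<alpha>m: "\<alpha> \<in> RR_borel N \<rightarrow>\<^sub>M R_borel N"
      and \<alpha>K: "\<And>z. z \<in> space (RR_borel N) \<Longrightarrow> \<alpha> z \<in> {1..N} \<rightarrow>\<^sub>E K"
      using \<alpha> by (auto simp: controls_def)
    have sp: "space \<gamma> = space (RR_borel N)" "sets \<gamma> = sets (RR_borel N)"
      using space_pair_path_law[OF g(2)] sets_pair_path_law[OF g(2)] by (simp_all add: g(1))
    have V: "V N (fst z, snd z, \<alpha> z) = ennreal (f (snd z, \<alpha> z) + C)" if "z \<in> space \<gamma>" for z
      using that \<alpha>K[of z] by (auto simp: sp V_end space_RR_borel extensional_restrict PiE_def)
    have "(\<lambda>z. V N (fst z, snd z, \<alpha> z)) \<in> borel_measurable \<gamma>"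
      using V_extend_measurable[OF order.refl \<alpha>m] by (simp add: measurable_cong_sets[OF sp(2) refl])
    then have m: "(\<lambda>z. ennreal (f (snd z, \<alpha> z) + C)) \<in> borel_measurable \<gamma>"
      using measurable_cong[of \<gamma>, OF V] by simp
    show ?thesis
    proof (rule ext_integral_unshift[OF _ C m])
      show "prob_space \<gamma>" using prob_space_pair_path_law[OF g(2)] g(1) by simp
      fix z assume "z \<in> space \<gamma>"
      then have "snd z \<in> extensional {1..N}" "\<alpha> z \<in> extensional {1..N}"
        using \<alpha>K[of z] by (auto simp: sp space_RR_borel PiE_def)
      then show "(case z of (x, y) \<Rightarrow> ereal (f (y, \<alpha> (x, y)))) = unshift C (ennreal (f (snd z, \<alpha> z) + C))"
        using f_bound[of "snd z" "\<alpha> z"] by (cases z) (simp add: unshift_ennreal)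
    qed
  qed
  have sub: "Pi_M_bc p N \<delta> k \<subseteq> Pi_M_path p N \<delta> k" by (auto simp: Pi_M_bc_def)
  have val: "value_M p N k K f \<delta> = (INF \<alpha>\<in>controls N K. SUP \<gamma>\<in>Pi_M_bc p N \<delta> k. unshift C (\<integral>\<^sup>+ z. ennreal (f (snd z, \<alpha> z) + C) \<partial>\<gamma>))"
    unfolding value_M_def using sub by (intro INF_cong SUP_cong refl conv) auto
  show ?thesis
    unfolding val
  proof (rule antisym)
    obtain \<alpha> where \<alpha>: "\<alpha> \<in> controls N K" "\<And>\<gamma>. \<gamma> \<in> Pi_M_path p N \<delta> k \<Longrightarrow> (\<integral>\<^sup>+ z. ennreal (f (snd z, \<alpha> z) + C) \<partial>\<gamma>) \<le> ?v"
      using upper_bound by blast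
    show "(INF \<alpha>\<in>controls N K. SUP \<gamma>\<in>Pi_M_bc p N \<delta> k. unshift C (\<integral>\<^sup>+ z. ennreal (f (snd z, \<alpha> z) + C) \<partial>\<gamma>)) \<le> unshift C ?v"
      using sub by (intro INF_lower2[OF \<alpha>(1)] SUP_least unshift_mono \<alpha>(2)) auto
    show "unshift C ?v \<le> (INF \<alpha>\<in>controls N K. SUP \<gamma>\<in>Pi_M_bc p N \<delta> k. unshift C (\<integral>\<^sup>+ z. ennreal (f (snd z, \<alpha> z) + C) \<partial>\<gamma>))"
    proof (rule INF_greatest)
      fix \<alpha> assume \<alpha>: "\<alpha> \<in> controls N K"
      let ?S = "SUP \<gamma>\<in>Pi_M_bc p N \<delta> k. unshift C (\<integral>\<^sup>+ z. ennreal (f (snd z, \<alpha> z) + C) \<partial>\<gamma>)"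
      show "unshift C ?v \<le> ?S"
      proof -
        have "?v \<le> (SUP \<gamma>\<in>Pi_M_bc p N \<delta> k. \<integral>\<^sup>+ z. ennreal (f (snd z, \<alpha> z) + C) \<partial>\<gamma>)"
        proof (rule dense_le)
          fix c assume "c < ?v"
          from lower_bound[OF \<alpha> this] obtain \<gamma> where "\<gamma> \<in> Pi_M_bc p N \<delta> k" "c < (\<integral>\<^sup>+ z. ennreal (f (snd z, \<alpha> z) + C) \<partial>\<gamma>)" by blast
          then show "c \<le> (SUP \<gamma>\<in>Pi_M_bc p N \<delta> k. \<integral>\<^sup>+ z. ennreal (f (snd z, \<alpha> z) + C) \<partial>\<gamma>)"
            by (intro SUP_upper2[of \<gamma>]) auto
        qed
        then have "unshift C ?v \<le> unshift C (SUP \<gamma>\<in>Pi_M_bc p N \<delta> k. \<integral>\<^sup>+ z. ennreal (f (snd z, \<alpha> z) + C) \<partial>\<gamma>)"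
          by (rule unshift_mono)
        also have "\<dots> = ?S"
          using lower_bound[OF \<alpha>, of 0] less_le_trans[OF zero_less_one V_ge_1] by (intro unshift_SUP[OF C]) auto
        finally show ?thesis .
      qed
    qed
  qed
qed

end

theorem corollary4p9:
  fixes N :: nat and p \<delta> :: real
    and \<mu> :: "(nat \<Rightarrow> real) measure"
    and k :: "nat \<Rightarrow> (nat \<Rightarrow> real) \<Rightarrow> real measure"
    and K :: "real set"
    and f :: "(nat \<Rightarrow> real) \<times> (nat \<Rightarrow> real) \<Rightarrow> real"
  assumes "1 \<le> N" and "1 \<le> p"
    and "\<mu> \<in> P_p_path p N"
    and "disintegration N k \<mu>"
    and "successively_W_continuous p N k"
    and "martingale_measure N k \<mu>"
    and "compact K" and "K \<noteq> {}"
    and "\<delta> > 0"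
    and "lsc_on_top (prod_topology (R_top N) (R_top N)) f"
    and "bdd_below (f ` topspace (prod_topology (R_top N) (R_top N)))"
  shows "value_M p N k K f \<delta> = dyn_value_M p N k K f \<delta> 0 empty_path empty_path empty_path"
proof -
  obtain c where c: "\<And>z. z \<in> topspace (prod_topology (R_top N) (R_top N)) \<Longrightarrow> c \<le> f z"
    using assms(11) unfolding bdd_below_def by blast
  \<comment> \<open>The 1 makes the shifted function at least 1.\<close>
  define C where "C = max 0 (1 - c)"
  have "1 - C \<le> f (y, a)" if "y \<in> extensional {1..N}" "a \<in> extensional {1..N}" for y a
    using c[of "(y, a)"] that by (auto simp: C_def PiE_UNIV_domain PiE_def)
  then interpret martingale_robust_control p \<delta> N k K f C
    using assms by unfold_locales (auto simp: disintegration_def C_def)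
  show ?thesis by (simp add: value_eq dyn_value_eq)
qed

end
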